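(* Let $X$ be a set, $F$ a set of functions from $X$ to $[0,1]$, and $\epsilon,\delta>0$. (i) If there is a $\kappa>0$ such that for all $\epsilon'>0$, $\mathrm{fat}_F((1/2-\kappa)\epsilon')$ is finite, then there is a learner $A$ that $(\epsilon,\delta)$-learns in the agnostic sense with respect to $F$ from $$O\left(\frac{1}{\epsilon^2}\,\mathrm{fat}_F((1/2-\kappa)\epsilon)\left(\log^2\frac1\epsilon\right)\left(\log\frac1\delta\right)\right)$$ examples. (ii) If there is a $\kappa>0$ such that for all $\epsilon'>0$, $\mathrm{fatV}_F((1/2-\kappa)\epsilon')$ is finite, then there is a learner $A$ that $(\epsilon,\delta)$-learns in the agnostic sense with respect to $F$ from $$O\left(\frac{1}{\epsilon^3}\,\mathrm{fatV}_F((1/2-\kappa)\epsilon)\left(\log\frac1\epsilon\right)\left(\log\frac1\delta\right)\right)$$ examples.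
   Context: A learner for $X$ is a mapping from $\bigcup_{n}(X\times[0,1])^n$ to $[0,1]^X$. For $h:X\to[0,1]$ and a probability distribution $P$ on $X\times[0,1]$, $\mathbf{er}_P(h)=\int|h(x)-y|\,dP(x,y)$. For $0<\epsilon,\delta<1$ and $m\in\mathbb N$, a learner $A$ $(\epsilon,\delta)$-learns in the agnostic sense with respect to $F$ from $m$ examples if for all probability distributions $P$ on $X\times[0,1]$, $$P^m\Big\{w\in(X\times[0,1])^m:\ \mathbf{er}_P(A(w))\ge\inf_{f\in F}\mathbf{er}_P(f)+\epsilon\Big\}<\delta .$$ For a scale $\gamma>0$, $F$ $\gamma$-fatly shatters a sequence $(x_1,r_1),\dots,(x_d,r_d)$ in $X\times[0,1]$ if for every $b\in\{0,1\}^d$ there is $f\in F$ with, for all $j$, $f(x_j)\ge r_j+\gamma$ if $b_j=1$ and $f(x_j)\le r_j-\gamma$ if $b_j=0$. $\mathrm{fat}_F(\gamma)$ is the largest length of such a sequence ($\infty$ if unbounded). $\mathrm{fatV}_F(\gamma)$ is defined in the same way but requiring all the thresholds to be equal, $r_1=\dots=r_d=r$ for a single $r\in[0,1]$. Convention: issues of measurability are ignored; the reader may assume that $X$ is countable. *)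

theory Defs
  imports "HOL-Probability.Probability" "HOL-Library.Extended_Nat"
begin

text \<open>
  The instance space is a countable carrier set \<open>X\<close> with the discrete sigma-algebra. A function
  \<open>X \<rightarrow> [0,1]\<close> is a total HOL function in \<open>X \<rightarrow> {0..1}\<close>; its values outside \<open>X\<close> are irrelevant to
  every notion below.
\<close>

definition example_space :: "'x set \<Rightarrow> ('x \<times> real) measure" where
  "example_space X = count_space X \<Otimes>\<^sub>M restrict_space borel {0..1}"

definition example_distribution :: "'x set \<Rightarrow> ('x \<times> real) measure \<Rightarrow> bool" where
  "example_distribution X P \<longleftrightarrow> prob_space P \<and> sets P = sets (example_space X)"

definition er :: "('x \<times> real) measure \<Rightarrow> ('x \<Rightarrow> real) \<Rightarrow> real" where
  "er P h = (\<integral>z. \<bar>h (fst z) - snd z\<bar> \<partial>P)"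

definition learner :: "'x set \<Rightarrow> (('x \<times> real) list \<Rightarrow> 'x \<Rightarrow> real) \<Rightarrow> bool" where
  "learner X A \<longleftrightarrow> (\<forall>zs \<in> lists (X \<times> {0..1}). A zs \<in> X \<rightarrow> {0..1})"

text \<open>
  The product measure lives on functions on \<open>{..<m}\<close>, which are turned into lists for the learner.
  Since \<^const>\<open>measure\<close> is 0 on non-measurable sets, measurability of the failure event is demanded
  explicitly. The infimum is taken in the extended reals, so that it is \<open>\<infinity>\<close> for empty \<open>F\<close>.
\<close>

definition failure_event ::
    "('x \<Rightarrow> real) set \<Rightarrow> (('x \<times> real) list \<Rightarrow> 'x \<Rightarrow> real) \<Rightarrow> real \<Rightarrow> nat \<Rightarrow> ('x \<times> real) measure
      \<Rightarrow> (nat \<Rightarrow> 'x \<times> real) set" where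
  "failure_event F A \<epsilon> m P =
     {w \<in> space (\<Pi>\<^sub>M i\<in>{..<m}. P).
        ereal (er P (A (map w [0..<m]))) \<ge> (INF f\<in>F. ereal (er P f)) + ereal \<epsilon>}"

definition agnostically_learns ::
    "'x set \<Rightarrow> ('x \<Rightarrow> real) set \<Rightarrow> (('x \<times> real) list \<Rightarrow> 'x \<Rightarrow> real) \<Rightarrow> real \<Rightarrow> real \<Rightarrow> nat \<Rightarrow> bool" where
  "agnostically_learns X F A \<epsilon> \<delta> m \<longleftrightarrow>
     (\<forall>P. example_distribution X P \<longrightarrow>
        failure_event F A \<epsilon> m P \<in> sets (\<Pi>\<^sub>M i\<in>{..<m}. P) \<and>
        measure (\<Pi>\<^sub>M i\<in>{..<m}. P) (failure_event F A \<epsilon> m P) < \<delta>)"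

definition fatly_shatters :: "'x set \<Rightarrow> ('x \<Rightarrow> real) set \<Rightarrow> real \<Rightarrow> ('x \<times> real) list \<Rightarrow> bool" where
  "fatly_shatters X F \<gamma> xrs \<longleftrightarrow>
     set xrs \<subseteq> X \<times> {0..1} \<and>
     (\<forall>b::bool list. length b = length xrs \<longrightarrow>
        (\<exists>f\<in>F. \<forall>j<length xrs.
           (b ! j \<longrightarrow> f (fst (xrs ! j)) \<ge> snd (xrs ! j) + \<gamma>) \<and>
           (\<not> b ! j \<longrightarrow> f (fst (xrs ! j)) \<le> snd (xrs ! j) - \<gamma>)))"

definition fat :: "'x set \<Rightarrow> ('x \<Rightarrow> real) set \<Rightarrow> real \<Rightarrow> enat" where
  "fat X F \<gamma> = Sup {enat (length xrs) | xrs. fatly_shatters X F \<gamma> xrs}"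

definition fatV :: "'x set \<Rightarrow> ('x \<Rightarrow> real) set \<Rightarrow> real \<Rightarrow> enat" where
  "fatV X F \<gamma> =
     Sup {enat (length xs) | xs. \<exists>r\<in>{0..1}. fatly_shatters X F \<gamma> (map (\<lambda>x. (x, r)) xs)}"

end

theory Submission
  imports Defs "HOL-Real_Asymp.Real_Asymp"
begin

text \<open>
  The learner draws unlabelled points, builds from them a finite list of candidate functions, repeats
  this \<open>O(log (1/\<delta>))\<close> times, and minimises the empirical error over all candidates on a fresh
  labelled sample. It suffices that for each single \<open>f \<in> F\<close> some candidate has expected
  \<open>L\<^sub>1\<close> distance at most about \<open>\<epsilon>/2\<close> from \<open>f\<close>: this distance is
  nonnegative, so by Markov's inequality it is below \<open>(1 - \<kappa>) \<epsilon>\<close> with probability at least 1/2.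
  This is where the constant 1/2 in front of the scale comes from.

  With \<open>d = fatV\<close>, a candidate is given by \<open>O(d/\<epsilon>)\<close> sample points with guessed
  quantised labels. At every threshold one predicts by an orientation of the one-inclusion graph, which
  makes at most \<open>2 d\<close> leave-one-out errors; integrating the predicted bits over the thresholds
  gives an error of at most the scale plus \<open>O(d/n)\<close>.

  With \<open>d = fat\<close>, a halving argument first gives \<open>exp (O(d log\<^sup>2 (1/\<epsilon>)))\<close>
  representatives in \<open>F\<close>, one of which is within \<open>O(\<epsilon>)\<close> of \<open>f\<close>
  outside a small set. Around a representative only boundedly many thresholds matter, so that
  \<open>O(d)\<close> labelled points refine it as before to the sharp constant.
\<close>

section \<open>Leave-one-out prediction on the one-inclusion graph\<close>

text \<open>The candidates are built without labels, every labelling of the few positions that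
  matter being guessed, and validation costs about the logarithm of the number of candidates divided
  by \<epsilon>^2. That logarithm is what the two bounds measure: it is (d/\<epsilon>) log
  (1/\<epsilon>) in (ii), where about d/\<epsilon> labels with about 1/\<epsilon> values each are
  guessed. For (i) the factor 1/\<epsilon> has to leave the guessed labels, which is the purpose of
  the coarse representatives; refining them needs thresholds that move with the representative,
  which \<open>fat\<close> allows and \<open>fatV\<close> does not. The sharp constant rests on two
  facts: prediction at single thresholds loses the scale once, not twice, and only one near-optimal
  f has to be approximated, so that Markov's inequality suffices at the fine scale. Both bounds tend
  to 0 as \<epsilon> tends to 1 and vanish in dimension 0, so these cases require a learner that
  sees no example at all. In contrast, \<delta> \<le> \<open>\<delta>0\<close> < 1 keeps log
  (1/\<delta>) away from 0.\<close>

definition set_shatters :: "'i set set \<Rightarrow> 'i set \<Rightarrow> bool" where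
  "set_shatters \<A> S \<longleftrightarrow> (\<forall>T\<subseteq>S. \<exists>A\<in>\<A>. A \<inter> S = T)"

text \<open>The one-inclusion graph: each edge is recorded once, by its lower endpoint and its
  direction, so that \<open>card\<close> counts edges and not incidences.\<close>

definition cube_edges :: "'i set \<Rightarrow> 'i set set \<Rightarrow> ('i set \<times> 'i) set" where
  "cube_edges J \<A> = {(A, s). s \<in> J \<and> s \<notin> A \<and> A \<in> \<A> \<and> insert s A \<in> \<A>}"

definition flip :: "'i \<Rightarrow> 'i set \<Rightarrow> 'i set" where
  "flip s A = (if s \<in> A then A - {s} else insert s A)"

lemma finite_cube_edges: "finite J \<Longrightarrow> finite \<A> \<Longrightarrow> finite (cube_edges J \<A>)"
  by (rule finite_subset[of _ "\<A> \<times> J"]) (auto simp: cube_edges_def)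

text \<open>Splitting along a coordinate x yields two sections. Edges in other directions live
  inside a section, and edges in direction x correspond to sets common to both. Trading the sections
  for their union and intersection does not decrease the number of edges, and the intersection has
  smaller dimension because x can be added to whatever it shatters.\<close>

lemma card_cube_edges_le:
  assumes "finite J" "\<A> \<subseteq> Pow J" "\<And>S. S \<subseteq> J \<Longrightarrow> set_shatters \<A> S \<Longrightarrow> card S \<le> d"
  shows "card (cube_edges J \<A>) \<le> d * card \<A>"
  using assms
proof (induction J arbitrary: \<A> d rule: finite_induct)
  case empty
  then show ?case by (simp add: cube_edges_def)
next
  case (insert x J)
  define A0 where "A0 = {A\<in>\<A>. x \<notin> A}"
  \<comment> \<open>The section above x is stored with x removed, so that both sections live in
    \<open>Pow J\<close> and can be intersected.\<close>
  define A1 where "A1 = {A. x \<notin> A \<and> insert x A \<in> \<A>}"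
  have sub: "A0 \<subseteq> Pow J" "A1 \<subseteq> Pow J"
    using insert.prems(1) insert.hyps(2) by (auto simp: A0_def A1_def)
  have fin: "finite A0" "finite A1"
    using sub insert.hyps(1) by (auto intro: finite_subset)
  have split: "\<A> = A0 \<union> insert x ` A1"
  proof (intro equalityI subsetI)
    fix A assume A: "A \<in> \<A>"
    show "A \<in> A0 \<union> insert x ` A1"
    proof (cases "x \<in> A")
      case True
      then have "A = insert x (A - {x})" "A - {x} \<in> A1"
        using A by (auto simp: A1_def insert_absorb)
      then show ?thesis by blast
    qed (use A in \<open>auto simp: A0_def\<close>)
  qed (auto simp: A0_def A1_def)
  have inj: "inj_on (insert x) A1"
    by (rule inj_onI) (auto simp: A1_def insert_ident)
  have "card \<A> = card A0 + card (insert x ` A1)"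
    unfolding split by (rule card_Un_disjoint) (use fin in \<open>auto simp: A0_def\<close>)
  also have "\<dots> = card A0 + card A1" by (simp add: card_image inj)
  also have "\<dots> = card (A0 \<union> A1) + card (A0 \<inter> A1)"
    using card_Un_Int[OF fin] .
  finally have card: "card \<A> = card (A0 \<union> A1) + card (A0 \<inter> A1)" .
  let ?E = "cube_edges J"
  have finE: "finite (?E A0)" "finite (?E A1)"
    using finite_cube_edges insert.hyps(1) fin by blast+
  have "cube_edges (insert x J) \<A>
      \<subseteq> ?E A0 \<union> (\<lambda>(A, s). (insert x A, s)) ` ?E A1 \<union> (\<lambda>A. (A, x)) ` (A0 \<inter> A1)"
  proof
    fix e assume "e \<in> cube_edges (insert x J) \<A>"
    then obtain A s where e: "e = (A, s)" and
      As: "s \<in> insert x J" "s \<notin> A" "A \<in> \<A>" "insert s A \<in> \<A>"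
      by (auto simp: cube_edges_def)
    consider "s = x" | "s \<noteq> x" "x \<in> A" | "s \<noteq> x" "x \<notin> A" by blast
    then show "e \<in> ?E A0 \<union> (\<lambda>(A, s). (insert x A, s)) ` ?E A1 \<union> (\<lambda>A. (A, x)) ` (A0 \<inter> A1)"
    proof cases
      case 1
      then show ?thesis using As e by (auto simp: A0_def A1_def)
    next
      case 2
      have "insert x (A - {x}) = A" "insert x (insert s (A - {x})) = insert s A"
        using 2 by auto
      then have "(A - {x}, s) \<in> ?E A1"
        using 2 As by (auto simp: cube_edges_def A1_def)
      moreover have "e = (\<lambda>(A, s). (insert x A, s)) (A - {x}, s)"
        using e 2 by (simp add: insert_absorb)
      ultimately show ?thesis by (metis (no_types, lifting) UnI1 UnI2 image_eqI)
    next
      case 3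
      then show ?thesis using As e by (auto simp: A0_def cube_edges_def)
    qed
  qed
  then have "card (cube_edges (insert x J) \<A>)
      \<le> card (?E A0 \<union> (\<lambda>(A, s). (insert x A, s)) ` ?E A1 \<union> (\<lambda>A. (A, x)) ` (A0 \<inter> A1))"
    by (rule card_mono[rotated]) (use finE fin in auto)
  also have "\<dots> \<le> card (?E A0) + card (?E A1) + card (A0 \<inter> A1)"
    by (intro order.trans[OF card_Un_le] add_mono card_image_le) (use finE fin in auto)
  also have "card (?E A0) + card (?E A1) = card (?E A0 \<union> ?E A1) + card (?E A0 \<inter> ?E A1)"
    using card_Un_Int[OF finE] .
  also have "\<dots> \<le> card (?E (A0 \<union> A1)) + card (?E (A0 \<inter> A1))"
    by (intro add_mono card_mono finite_cube_edges)
       (use insert.hyps(1) fin in \<open>auto simp: cube_edges_def\<close>)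
  also have "card (?E (A0 \<union> A1)) \<le> d * card (A0 \<union> A1)"
  proof (rule insert.IH)
    fix S assume S: "S \<subseteq> J" "set_shatters (A0 \<union> A1) S"
    have "set_shatters \<A> S"
      unfolding set_shatters_def
    proof (intro allI impI)
      fix T assume "T \<subseteq> S"
      then obtain A where A: "A \<in> A0 \<union> A1" "A \<inter> S = T"
        using S(2) unfolding set_shatters_def by blast
      have "insert x A \<inter> S = T" using A S(1) insert.hyps(2) by auto
      then show "\<exists>A\<in>\<A>. A \<inter> S = T" using A by (auto simp: A0_def A1_def)
    qed
    then show "card S \<le> d" using insert.prems(2) S(1) by blast
  qed (use sub in auto)
  also have "card (?E (A0 \<inter> A1)) \<le> (d - 1) * card (A0 \<inter> A1)"
  proof (rule insert.IH)
    fix S assume S: "S \<subseteq> J" "set_shatters (A0 \<inter> A1) S"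
    have "set_shatters \<A> (insert x S)"
      unfolding set_shatters_def
    proof (intro allI impI)
      fix T assume T: "T \<subseteq> insert x S"
      then have "T - {x} \<subseteq> S" by auto
      then obtain A where A: "A \<in> A0 \<inter> A1" "A \<inter> S = T - {x}"
        using S(2) unfolding set_shatters_def by blast
      show "\<exists>A\<in>\<A>. A \<inter> insert x S = T"
      proof (cases "x \<in> T")
        case True
        then have "insert x A \<inter> insert x S = T" "insert x A \<in> \<A>"
          using A by (auto simp: A1_def)
        then show ?thesis by blast
      next
        case False
        then have "A \<inter> insert x S = T" "A \<in> \<A>"
          using A by (auto simp: A0_def)
        then show ?thesis by blast
      qed
    qed
    then have "card (insert x S) \<le> d" by (intro insert.prems(2)) (use S(1) in auto)
    moreover have "card (insert x S) = Suc (card S)"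
      using S(1) insert.hyps by (meson card_insert_disjoint finite_subset subsetD)
    ultimately show "card S \<le> d - 1" by simp
  qed (use sub in auto)
  finally have le: "card (cube_edges (insert x J) \<A>)
      \<le> d * card (A0 \<union> A1) + (d - 1) * card (A0 \<inter> A1) + card (A0 \<inter> A1)"
    by simp
  \<comment> \<open>\<open>d - 1\<close> is truncated at 0. Two sections with a common set shatter
    {x}, so d is positive whenever the intersection contributes.\<close>
  have "d \<ge> 1" if ne: "A0 \<inter> A1 \<noteq> {}"
  proof -
    obtain A where A: "A \<in> A0" "A \<in> A1" using ne by blast
    have "set_shatters \<A> {x}"
      unfolding set_shatters_def
    proof (intro allI impI)
      fix T assume "T \<subseteq> {x}"
      then consider "T = {}" | "T = {x}" by blast
      then show "\<exists>A\<in>\<A>. A \<inter> {x} = T"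
      proof cases
        case 1
        then have "A \<inter> {x} = T" "A \<in> \<A>" using A by (auto simp: A0_def)
        then show ?thesis by blast
      next
        case 2
        then have "insert x A \<inter> {x} = T" "insert x A \<in> \<A>" using A by (auto simp: A1_def)
        then show ?thesis by blast
      qed
    qed
    then have "card {x} \<le> d" by (intro insert.prems(2)) auto
    then show ?thesis by simp
  qed
  then have "(d - 1) * card (A0 \<inter> A1) + card (A0 \<inter> A1) = d * card (A0 \<inter> A1)"
    by (cases "A0 \<inter> A1 = {}"; cases d) auto
  then show ?case using le card by (simp add: algebra_simps)
qed

text \<open>Every edge has two endpoints, so the degrees add up to at most 2 d times the number of
  vertices, and some vertex is no worse than the average.\<close>

lemma low_degree_vertex:
  assumes fin: "finite J" "finite \<A>" and ne: "\<A> \<noteq> {}"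
    and edges: "card (cube_edges J \<A>) \<le> d * card \<A>"
  shows "\<exists>A\<in>\<A>. card {s\<in>J. flip s A \<in> \<A>} \<le> 2 * d"
proof (rule ccontr)
  assume "\<not> ?thesis"
  then have deg: "2 * d + 1 \<le> card {s\<in>J. flip s A \<in> \<A>}" if "A \<in> \<A>" for A
    using that by fastforce
  let ?S = "SIGMA A:\<A>. {s\<in>J. flip s A \<in> \<A>}"
  have "(2 * d + 1) * card \<A> \<le> (\<Sum>A\<in>\<A>. card {s\<in>J. flip s A \<in> \<A>})"
    using sum_mono[of \<A> "\<lambda>_. 2 * d + 1"] deg by (simp add: mult.commute)
  also have "\<dots> = card ?S" using fin by simp
  also have "?S \<subseteq> cube_edges J \<A> \<union> (\<lambda>(A, s). (insert s A, s)) ` cube_edges J \<A>"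
  proof
    fix e assume "e \<in> ?S"
    then obtain A s where e: "e = (A, s)" "A \<in> \<A>" "s \<in> J" "flip s A \<in> \<A>" by auto
    show "e \<in> cube_edges J \<A> \<union> (\<lambda>(A, s). (insert s A, s)) ` cube_edges J \<A>"
    proof (cases "s \<in> A")
      case True
      then have "(A - {s}, s) \<in> cube_edges J \<A>" "e = (\<lambda>(A, s). (insert s A, s)) (A - {s}, s)"
        using e by (auto simp: cube_edges_def flip_def insert_absorb)
      then show ?thesis by blast
    qed (use e in \<open>auto simp: cube_edges_def flip_def\<close>)
  qed
  then have "card ?S \<le> card (cube_edges J \<A> \<union> (\<lambda>(A, s). (insert s A, s)) ` cube_edges J \<A>)"
    by (rule card_mono[rotated]) (use fin finite_cube_edges in auto)
  also have "\<dots> \<le> card (cube_edges J \<A>) + card (cube_edges J \<A>)"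
    by (intro order.trans[OF card_Un_le] add_mono card_image_le order.refl)
       (use fin finite_cube_edges in auto)
  also have "\<dots> \<le> 2 * d * card \<A>" using edges by simp
  finally have "card \<A> = 0" by simp
  then show False using fin ne by simp
qed

text \<open>Vertices are peeled off in order of low degree, and every edge is oriented away from the
  endpoint that is removed first. This loses a factor 2 against an optimal orientation, but avoids
  Hall's theorem.\<close>

lemma orient_edges:
  assumes fin: "finite J" "finite \<A>"
    and edges: "\<And>\<B>. \<B> \<subseteq> \<A> \<Longrightarrow> card (cube_edges J \<B>) \<le> d * card \<B>"
  shows "\<exists>b. \<forall>A\<in>\<A>. card {s\<in>J. b (A - {s}) s \<noteq> (s \<in> A)} \<le> 2 * d"
  using fin(2) edges
proof (induction "card \<A>" arbitrary: \<A>)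
  case 0
  then show ?case by simp
next
  case (Suc n)
  then have "\<A> \<noteq> {}" by auto
  then obtain C where C: "C \<in> \<A>" "card {s\<in>J. flip s C \<in> \<A>} \<le> 2 * d"
    using low_degree_vertex[OF fin(1) Suc.prems(1)] Suc.prems(2) by blast
  have "\<exists>b. \<forall>A\<in>\<A> - {C}. card {s\<in>J. b (A - {s}) s \<noteq> (s \<in> A)} \<le> 2 * d"
    using Suc.prems C(1) Suc.hyps(2) by (intro Suc.hyps(1)) auto
  then obtain b where b: "card {s\<in>J. b (A - {s}) s \<noteq> (s \<in> A)} \<le> 2 * d" if "A \<in> \<A>" "A \<noteq> C" for A
    by blast
  \<comment> \<open>\<open>D\<close> is the vertex with s erased, hence what both endpoints of an
    edge in direction s share. On edges at C the prediction is the other endpoint, so C pays for its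
    at most 2 d edges and no other vertex gets a new error. Without such an edge C itself is
    predicted.\<close>
  define b' where
    "b' D s = (if D = C - {s} then (if flip s C \<in> \<A> then s \<notin> C else s \<in> C) else b D s)" for D s
  have "card {s\<in>J. b' (A - {s}) s \<noteq> (s \<in> A)} \<le> 2 * d" if A: "A \<in> \<A>" for A
  proof (cases "A = C")
    case True
    have "{s\<in>J. b' (A - {s}) s \<noteq> (s \<in> A)} \<subseteq> {s\<in>J. flip s C \<in> \<A>}"
      by (auto simp: b'_def True)
    then have "card {s\<in>J. b' (A - {s}) s \<noteq> (s \<in> A)} \<le> card {s\<in>J. flip s C \<in> \<A>}"
      using fin(1) by (intro card_mono) auto
    then show ?thesis using C(2) by simp
  next
    case False
    have *: "A = flip s C \<and> (s \<in> A) \<noteq> (s \<in> C)" if "A - {s} = C - {s}" for s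
      using that False by (auto simp: flip_def)
    have "{s\<in>J. b' (A - {s}) s \<noteq> (s \<in> A)} \<subseteq> {s\<in>J. b (A - {s}) s \<noteq> (s \<in> A)}"
      using * A by (auto simp: b'_def split: if_splits)
    then have "card {s\<in>J. b' (A - {s}) s \<noteq> (s \<in> A)} \<le> card {s\<in>J. b (A - {s}) s \<noteq> (s \<in> A)}"
      using fin(1) by (intro card_mono) auto
    then show ?thesis using b[OF A False] by simp
  qed
  then show ?case by blast
qed

section \<open>Predicting integer values threshold by threshold\<close>

definition gap_shatters :: "('i \<Rightarrow> int) set \<Rightarrow> int \<Rightarrow> int \<Rightarrow> 'i set \<Rightarrow> bool" where
  "gap_shatters H G \<theta> S \<longleftrightarrow>
     (\<forall>T\<subseteq>S. \<exists>u\<in>H. (\<forall>i\<in>T. u i \<ge> \<theta> + G) \<and> (\<forall>i\<in>S - T. u i \<le> \<theta> - G))"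

text \<open>Only positions whose value leaves the margin around the threshold can count as errors.
  Each set \<open>J\<close> of such decided positions carries its own family \<open>fam J\<close>;
  whatever it shatters is gap-shattered by H, and its edges are oriented separately. Setting the
  value at s to 0 hides it from the predictor.\<close>

lemma threshold_predictor:
  assumes fin: "finite I" and G: "G \<ge> 1"
    and vc: "\<And>S. S \<subseteq> I \<Longrightarrow> gap_shatters H G \<theta> S \<Longrightarrow> card S \<le> d"
  shows "\<exists>bit. \<forall>u\<in>H. card {s\<in>I. (u s \<ge> \<theta> + G \<and> \<not> bit s (u(s := 0)))
                                \<or> (u s \<le> \<theta> - G \<and> bit s (u(s := 0)))} \<le> 2 * d"
proof -
  define up where "up u J = {i\<in>J. u i \<ge> \<theta> + G}" for u and J :: "'a set"
  define fam where "fam J = {up u J | u. u \<in> H \<and> (\<forall>i\<in>J. u i \<ge> \<theta> + G \<or> u i \<le> \<theta> - G)}" for J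
  have "\<exists>b. \<forall>A\<in>fam J. card {s\<in>J. b (A - {s}) s \<noteq> (s \<in> A)} \<le> 2 * d" if J: "J \<subseteq> I" for J
  proof (rule orient_edges)
    show "finite J" using J fin by (rule finite_subset)
    have sub: "fam J \<subseteq> Pow J" by (auto simp: fam_def up_def)
    then show "finite (fam J)" using \<open>finite J\<close> by (auto intro: finite_subset)
    fix \<B> assume B: "\<B> \<subseteq> fam J"
    show "card (cube_edges J \<B>) \<le> d * card \<B>"
    proof (rule card_cube_edges_le)
      fix S assume S: "S \<subseteq> J" "set_shatters \<B> S"
      have "gap_shatters H G \<theta> S"
        unfolding gap_shatters_def
      proof (intro allI impI)
        fix T assume "T \<subseteq> S"
        then obtain A where A: "A \<in> fam J" "A \<inter> S = T"
          using S(2) B unfolding set_shatters_def by blast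
        then obtain u where u: "u \<in> H" "A = up u J" "\<forall>i\<in>J. u i \<ge> \<theta> + G \<or> u i \<le> \<theta> - G"
          by (auto simp: fam_def)
        have "(\<forall>i\<in>T. u i \<ge> \<theta> + G) \<and> (\<forall>i\<in>S - T. u i \<le> \<theta> - G)"
          using u A S(1) by (auto simp: up_def)
        then show "\<exists>u\<in>H. (\<forall>i\<in>T. u i \<ge> \<theta> + G) \<and> (\<forall>i\<in>S - T. u i \<le> \<theta> - G)"
          using u by blast
      qed
      then show "card S \<le> d" using vc S(1) J by blast
    qed (use B sub \<open>finite J\<close> in auto)
  qed
  then have "\<exists>b. \<forall>J\<in>Pow I. \<forall>A\<in>fam J. card {s\<in>J. b J (A - {s}) s \<noteq> (s \<in> A)} \<le> 2 * d"
    by (intro bchoice ballI) simp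
  then obtain b where b: "card {s\<in>J. b J (A - {s}) s \<noteq> (s \<in> A)} \<le> 2 * d"
    if "J \<subseteq> I" "A \<in> fam J" for J A by blast
  \<comment> \<open>Whether s itself is decided is hidden, but an error is counted only if it is;
    inserting s into the decided positions is therefore right whenever it matters.\<close>
  define bit where "bit s w = b (insert s {i\<in>I - {s}. w i \<ge> \<theta> + G \<or> w i \<le> \<theta> - G})
      (up w (I - {s})) s" for s w
  have "card {s\<in>I. (u s \<ge> \<theta> + G \<and> \<not> bit s (u(s := 0))) \<or> (u s \<le> \<theta> - G \<and> bit s (u(s := 0)))} \<le> 2 * d"
    if u: "u \<in> H" for u
  proof -
    define J where "J = {i\<in>I. u i \<ge> \<theta> + G \<or> u i \<le> \<theta> - G}"
    have bit: "bit s (u(s := 0)) = b J (up u J - {s}) s" if "s \<in> J" for s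
    proof -
      have "insert s {i\<in>I - {s}. (u(s := 0)) i \<ge> \<theta> + G \<or> (u(s := 0)) i \<le> \<theta> - G} = J"
        using that by (auto simp: J_def)
      moreover have "up (u(s := 0)) (I - {s}) = up u J - {s}"
        by (auto simp: up_def J_def)
      ultimately show ?thesis by (simp add: bit_def)
    qed
    have "{s\<in>I. (u s \<ge> \<theta> + G \<and> \<not> bit s (u(s := 0))) \<or> (u s \<le> \<theta> - G \<and> bit s (u(s := 0)))}
        \<subseteq> {s\<in>J. b J (up u J - {s}) s \<noteq> (s \<in> up u J)}"
    proof
      fix s assume s: "s \<in> {s\<in>I. (u s \<ge> \<theta> + G \<and> \<not> bit s (u(s := 0))) \<or> (u s \<le> \<theta> - G \<and> bit s (u(s := 0)))}"
      then have "s \<in> J" by (auto simp: J_def)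
      then show "s \<in> {s\<in>J. b J (up u J - {s}) s \<noteq> (s \<in> up u J)}"
        using s bit[of s] G by (auto simp: up_def)
    qed
    then have "card {s\<in>I. (u s \<ge> \<theta> + G \<and> \<not> bit s (u(s := 0))) \<or> (u s \<le> \<theta> - G \<and> bit s (u(s := 0)))}
        \<le> card {s\<in>J. b J (up u J - {s}) s \<noteq> (s \<in> up u J)}"
      using fin by (intro card_mono) (auto simp: J_def)
    also have "\<dots> \<le> 2 * d"
      using u by (intro b) (auto simp: J_def fam_def)
    finally show ?thesis .
  qed
  then show ?thesis by blast
qed

text \<open>An integer in \<open>{0..B}\<close> is the number of thresholds in \<open>{1..B}\<close>
  not exceeding it, so the predicted bits are added up. Thresholds closer than G to the true value
  cost at most G per position; the remaining wrong bits cost at most 2 d for each threshold, summed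
  over all positions. Bits of different thresholds are chosen independently and need not be
  monotone.\<close>

lemma leave_one_out_predictor:
  fixes H :: "('i \<Rightarrow> int) set"
  assumes fin: "finite I" and G: "G \<ge> 1" and B: "B \<ge> 0"
    and range: "\<And>u i. u \<in> H \<Longrightarrow> i \<in> I \<Longrightarrow> 0 \<le> u i \<and> u i \<le> B"
    and vc: "\<And>\<theta> S. 1 \<le> \<theta> \<Longrightarrow> \<theta> \<le> B \<Longrightarrow> S \<subseteq> I \<Longrightarrow> gap_shatters H G \<theta> S \<Longrightarrow> card S \<le> d"
  shows "\<exists>pred :: 'i \<Rightarrow> ('i \<Rightarrow> int) \<Rightarrow> int.
           \<forall>u\<in>H. (\<Sum>s\<in>I. \<bar>pred s (u(s := 0)) - u s\<bar>) \<le> int (card I) * G + 2 * int d * B"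
proof -
  have "\<exists>bit. \<forall>\<theta>\<in>{1..B}. \<forall>u\<in>H.
      card {s\<in>I. (u s \<ge> \<theta> + G \<and> \<not> bit \<theta> s (u(s := 0))) \<or> (u s \<le> \<theta> - G \<and> bit \<theta> s (u(s := 0)))} \<le> 2 * d"
    by (intro bchoice ballI threshold_predictor fin G vc) auto
  then obtain bit where bit: "card {s\<in>I. (u s \<ge> \<theta> + G \<and> \<not> bit \<theta> s (u(s := 0)))
      \<or> (u s \<le> \<theta> - G \<and> bit \<theta> s (u(s := 0)))} \<le> 2 * d" if "\<theta> \<in> {1..B}" "u \<in> H" for \<theta> u
    by blast
  define pred where "pred s w = int (card {\<theta>\<in>{1..B}. bit \<theta> s w})" for s w
  have "(\<Sum>s\<in>I. \<bar>pred s (u(s := 0)) - u s\<bar>) \<le> int (card I) * G + 2 * int d * B" if u: "u \<in> H" for u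
  proof -
    define bad where "bad s \<theta> \<longleftrightarrow> (u s \<ge> \<theta> + G \<and> \<not> bit \<theta> s (u(s := 0)))
      \<or> (u s \<le> \<theta> - G \<and> bit \<theta> s (u(s := 0)))" for s \<theta>
    have one: "\<bar>pred s (u(s := 0)) - u s\<bar> \<le> G + int (card {\<theta>\<in>{1..B}. bad s \<theta>})" if s: "s \<in> I" for s
    proof -
      define T where "T = {\<theta>\<in>{1..B}. bit \<theta> s (u(s := 0))}"
      define E where "E = {\<theta>\<in>{1..B}. bad s \<theta>}"
      have fin: "finite T" "finite E" by (auto simp: T_def E_def intro: finite_subset[of _ "{1..B}"])
      have r: "0 \<le> u s" "u s \<le> B" using range u s by auto
      have "{1..u s - G} \<subseteq> T \<union> E" using r G by (auto simp: bad_def T_def E_def)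
      then have "card {1..u s - G} \<le> card (T \<union> E)" using fin by (intro card_mono) auto
      also have "\<dots> \<le> card T + card E" by (rule card_Un_le)
      finally have 1: "u s - G \<le> int (card T) + int (card E)" by simp
      have "T \<subseteq> {1..u s + G - 1} \<union> E" by (auto simp: bad_def T_def E_def)
      then have "card T \<le> card ({1..u s + G - 1} \<union> E)" using fin by (intro card_mono) auto
      also have "\<dots> \<le> card {1..u s + G - 1} + card E" by (rule card_Un_le)
      finally have 2: "int (card T) \<le> u s + G + int (card E)" using r G by simp
      show ?thesis using 1 2 unfolding pred_def T_def[symmetric] E_def[symmetric] by linarith
    qed
    have "(\<Sum>s\<in>I. \<bar>pred s (u(s := 0)) - u s\<bar>) \<le> (\<Sum>s\<in>I. G + int (card {\<theta>\<in>{1..B}. bad s \<theta>}))"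
      by (intro sum_mono one)
    also have "\<dots> = int (card I) * G + int (\<Sum>s\<in>I. card {\<theta>\<in>{1..B}. bad s \<theta>})"
      by (simp add: sum.distrib)
    \<comment> \<open>Double counting exchanges positions and thresholds, because the orientation
      bound holds for one threshold over all positions.\<close>
    also have "(\<Sum>s\<in>I. card {\<theta>\<in>{1..B}. bad s \<theta>}) = (\<Sum>\<theta>\<in>{1..B}. card {s\<in>I. bad s \<theta>})"
      using sum_multicount_gen[of I "{1..B}" "\<lambda>s \<theta>. bad s \<theta>" "\<lambda>\<theta>. card {s\<in>I. bad s \<theta>}"] fin by simp
    finally have le: "(\<Sum>s\<in>I. \<bar>pred s (u(s := 0)) - u s\<bar>)
        \<le> int (card I) * G + int (\<Sum>\<theta>\<in>{1..B}. card {s\<in>I. bad s \<theta>})" .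
    have "(\<Sum>\<theta>\<in>{1..B}. card {s\<in>I. bad s \<theta>}) \<le> (\<Sum>\<theta>\<in>{1..B}. 2 * d)"
      using bit[OF _ u] by (intro sum_mono) (auto simp: bad_def)
    then have "int (\<Sum>\<theta>\<in>{1..B}. card {s\<in>I. bad s \<theta>}) \<le> int (\<Sum>\<theta>\<in>{1..B}. 2 * d)"
      by (simp only: of_nat_le_iff)
    also have "\<dots> = 2 * int d * B" using B by simp
    finally show ?thesis using le by linarith
  qed
  then show ?thesis by blast
qed

section \<open>Improper covers by halving\<close>

text \<open>The discrete form of fat shattering, with an individual threshold for each point,
  whereas \<open>gap_shatters\<close> corresponds to \<open>fatV\<close>.\<close>

definition pair_shatters :: "('i \<Rightarrow> int) set \<Rightarrow> int \<Rightarrow> ('i \<times> int) set \<Rightarrow> bool" where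
  "pair_shatters V G A \<longleftrightarrow>
     (\<forall>T\<subseteq>A. \<exists>u\<in>V. (\<forall>(i, \<theta>)\<in>T. u i \<ge> \<theta> + G) \<and> (\<forall>(i, \<theta>)\<in>A - T. u i \<le> \<theta> - G))"

definition shattered_pairs :: "('i \<Rightarrow> int) set \<Rightarrow> int \<Rightarrow> int \<Rightarrow> 'i set \<Rightarrow> ('i \<times> int) set set" where
  "shattered_pairs V G B I = {A. A \<subseteq> I \<times> {0..B} \<and> pair_shatters V G A}"

lemma finite_shattered_pairs: "finite I \<Longrightarrow> finite (shattered_pairs V G B I)"
  by (rule finite_subset[of _ "Pow (I \<times> {0..B})"]) (auto simp: shattered_pairs_def)

lemma pair_shatters_mono: "V \<subseteq> V' \<Longrightarrow> pair_shatters V G A \<Longrightarrow> pair_shatters V' G A"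
  unfolding pair_shatters_def by (meson subsetD)

lemma card_shattered_pairs_mono:
  "finite I' \<Longrightarrow> V \<subseteq> V' \<Longrightarrow> I \<subseteq> I' \<Longrightarrow>
    card (shattered_pairs V G B I) \<le> card (shattered_pairs V' G B I')"
  by (rule card_mono[OF finite_shattered_pairs])
     (auto simp: shattered_pairs_def intro: pair_shatters_mono)

lemma shattered_pairs_empty: "shattered_pairs {} G B I = {}"
  by (auto simp: shattered_pairs_def pair_shatters_def)

lemma card_shattered_pairs_pos:
  assumes "finite I" "V \<noteq> {}"
  shows "card (shattered_pairs V G B I) \<ge> 1"
proof -
  have "{} \<in> shattered_pairs V G B I"
    using assms by (auto simp: shattered_pairs_def pair_shatters_def)
  then show ?thesis
    using finite_shattered_pairs[OF assms(1)] by (metis One_nat_def Suc_leI card_gt_0_iff empty_iff)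
qed

text \<open>A set shattered by both parts stays shattered by V after adding (x, \<theta>), because
  the upper part realises one side of \<theta> at x and the lower part the other. Such sets thus
  count twice on the right as well. Hence one of the two parts owns at most half of the shattered
  sets, which drives the halving.\<close>

lemma shattered_pairs_split:
  assumes I: "finite I" "x \<notin> I" and \<theta>: "\<theta> \<in> {0..B}"
  shows "card (shattered_pairs {u\<in>V. u x \<ge> \<theta> + G} G B I) + card (shattered_pairs {u\<in>V. u x \<le> \<theta> - G} G B I)
    \<le> card (shattered_pairs V G B (insert x I))"
proof -
  let ?U = "shattered_pairs {u\<in>V. u x \<ge> \<theta> + G} G B I"
  let ?L = "shattered_pairs {u\<in>V. u x \<le> \<theta> - G} G B I"
  have fin: "finite ?U" "finite ?L" using finite_shattered_pairs I(1) by blast+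
  have sub: "A \<subseteq> I \<times> {0..B}" if "A \<in> ?U \<or> A \<in> ?L" for A
    using that by (auto simp: shattered_pairs_def)
  have new: "(x, \<theta>) \<notin> A" if "A \<in> ?U \<or> A \<in> ?L" for A
    using sub[OF that] I(2) by auto
  have inj: "inj_on (insert (x, \<theta>)) (?U \<inter> ?L)"
    by (rule inj_onI) (use new in \<open>auto simp: insert_ident\<close>)
  have 1: "?U \<union> ?L \<subseteq> shattered_pairs V G B (insert x I)"
    by (auto simp: shattered_pairs_def intro: pair_shatters_mono[rotated])
  have 2: "insert (x, \<theta>) A \<in> shattered_pairs V G B (insert x I)" if A: "A \<in> ?U" "A \<in> ?L" for A
  proof -
    have "pair_shatters V G (insert (x, \<theta>) A)"
      unfolding pair_shatters_def
    proof (intro allI impI)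
      fix T assume T: "T \<subseteq> insert (x, \<theta>) A"
      have T': "T - {(x, \<theta>)} \<subseteq> A" using T by auto
      show "\<exists>u\<in>V. (\<forall>(i, \<theta>)\<in>T. u i \<ge> \<theta> + G) \<and> (\<forall>(i, \<theta>)\<in>insert (x, \<theta>) A - T. u i \<le> \<theta> - G)"
      proof (cases "(x, \<theta>) \<in> T")
        case True
        obtain u where "u \<in> V" "u x \<ge> \<theta> + G" "\<forall>(i, \<theta>)\<in>T - {(x, \<theta>)}. u i \<ge> \<theta> + G"
          "\<forall>(i, \<theta>)\<in>A - (T - {(x, \<theta>)}). u i \<le> \<theta> - G"
          using A(1) T' unfolding shattered_pairs_def pair_shatters_def by blast
        then show ?thesis using True new A by (intro bexI[of _ u]) auto
      next
        case False
        obtain u where "u \<in> V" "u x \<le> \<theta> - G" "\<forall>(i, \<theta>)\<in>T - {(x, \<theta>)}. u i \<ge> \<theta> + G"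
          "\<forall>(i, \<theta>)\<in>A - (T - {(x, \<theta>)}). u i \<le> \<theta> - G"
          using A(2) T' unfolding shattered_pairs_def pair_shatters_def by blast
        then show ?thesis using False by (intro bexI[of _ u]) auto
      qed
    qed
    then show ?thesis using sub A(1) \<theta> by (auto simp: shattered_pairs_def)
  qed
  have "card ?U + card ?L = card (?U \<union> ?L) + card (?U \<inter> ?L)"
    by (rule card_Un_Int[OF fin])
  also have "card (?U \<inter> ?L) = card (insert (x, \<theta>) ` (?U \<inter> ?L))"
    by (simp add: card_image inj)
  also have "card (?U \<union> ?L) + card (insert (x, \<theta>) ` (?U \<inter> ?L))
      = card ((?U \<union> ?L) \<union> insert (x, \<theta>) ` (?U \<inter> ?L))"
    by (rule card_Un_disjoint[symmetric]) (use fin new in auto)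
  also have "\<dots> \<le> card (shattered_pairs V G B (insert x I))"
    by (rule card_mono[OF finite_shattered_pairs]) (use 1 2 I(1) in auto)
  finally show ?thesis .
qed

text \<open>At each point the predicted value \<open>p\<close> is chosen such that any function deviating from it by
  more than \<open>G\<close> lies in a subclass with at most half of the shattered sets, so a function is
  mispredicted at most \<open>M\<close> times. The free parameter \<open>z\<close> is a generating function variable: it
  replaces the binomial sum counting the mistake patterns.\<close>

lemma halving_cover:
  fixes V :: "('i \<Rightarrow> int) set"
  assumes "finite I" "\<And>u i. u \<in> V \<Longrightarrow> i \<in> I \<Longrightarrow> 0 \<le> u i \<and> u i \<le> B" and G: "G \<ge> 1" and B: "B \<ge> 0"
    and "card (shattered_pairs V G B I) < 2 ^ (M + 1)" and z: "0 < (z::real)" "z \<le> 1"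
  shows "\<exists>C. finite C \<and> real (card C) \<le> (1 + z * (B + 1)) ^ card I / z ^ M \<and>
    (\<forall>u\<in>V. \<exists>c\<in>C. \<forall>i\<in>I. \<bar>u i - c i\<bar> \<le> G)"
  using assms(1,2,5)
proof (induction I arbitrary: V M rule: finite_induct)
  case empty
  have "1 \<le> 1 / z ^ M" using z by (simp add: power_le_one)
  then show ?case by (intro exI[of _ "{\<lambda>_. 0}"]) auto
next
  case (insert x I)
  let ?S = "card (shattered_pairs V G B (insert x I))"
  let ?b = "1 + z * (B + 1)"
  \<comment> \<open>The prediction q is the first level whose upper part owns at most half of the
    shattered sets. At q - 1 the upper part owns more than half, so by the split the lower part
    there owns less than half.\<close>
  define P where "P q \<longleftrightarrow> 2 * card (shattered_pairs {u\<in>V. u x \<ge> int q + G} G B I) \<le> ?S" for q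
  define q where "q = (LEAST q. P q)"
  have none: "{u\<in>V. u x \<ge> int (nat (B + 1)) + G} = {}"
    using insert.prems(1) G B by fastforce
  have PB: "P (nat (B + 1))"
    unfolding P_def none shattered_pairs_empty by simp
  have Pq: "P q" unfolding q_def using PB by (rule LeastI)
  have qB: "q \<le> nat (B + 1)" unfolding q_def using PB by (rule Least_le)
  have low: "2 * card (shattered_pairs {u\<in>V. u x \<le> int q - 1 - G} G B I) \<le> ?S" if "q \<ge> 1"
  proof -
    have "\<not> P (q - 1)" using that not_less_Least[of "q - 1" P] unfolding q_def by simp
    moreover have "int (q - 1) = int q - 1" using that by simp
    moreover have "card (shattered_pairs {u\<in>V. u x \<ge> int (q - 1) + G} G B I)
        + card (shattered_pairs {u\<in>V. u x \<le> int (q - 1) - G} G B I) \<le> ?S"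
      by (rule shattered_pairs_split) (use insert.hyps qB that B in auto)
    ultimately show ?thesis unfolding P_def by simp
  qed
  have cell: "2 * card (shattered_pairs {u\<in>V. u x = v} G B I) \<le> ?S"
    if v: "0 \<le> v" "\<bar>v - int q\<bar> > G" for v
  proof (cases "v \<ge> int q + G")
    case True
    have "card (shattered_pairs {u\<in>V. u x = v} G B I) \<le> card (shattered_pairs {u\<in>V. u x \<ge> int q + G} G B I)"
      by (rule card_shattered_pairs_mono) (use insert.hyps True in auto)
    then show ?thesis using Pq unfolding P_def by simp
  next
    case False
    then have v': "v \<le> int q - 1 - G" "q \<ge> 1" using v G by linarith+
    have "card (shattered_pairs {u\<in>V. u x = v} G B I) \<le> card (shattered_pairs {u\<in>V. u x \<le> int q - 1 - G} G B I)"
      by (rule card_shattered_pairs_mono) (use insert.hyps v' in auto)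
    then show ?thesis using low v' by simp
  qed
  have "card (shattered_pairs V G B I) \<le> ?S"
    by (rule card_shattered_pairs_mono) (use insert.hyps in auto)
  then have "card (shattered_pairs V G B I) < 2 ^ (M + 1)" using insert.prems(2) by simp
  then obtain C0 where C0: "finite C0" "real (card C0) \<le> ?b ^ card I / z ^ M"
    "\<forall>u\<in>V. \<exists>c\<in>C0. \<forall>i\<in>I. \<bar>u i - c i\<bar> \<le> G"
    using insert.IH[of V M] insert.prems(1) by auto
  have b1: "?b \<ge> 1" using z B by simp
  define W where "W = {v\<in>{0..B}. \<bar>v - int q\<bar> > G}"
  have "W \<subseteq> {0..B}" by (auto simp: W_def)
  then have W: "finite W" "card W \<le> nat (B + 1)"
    using card_mono[of "{0..B}" W] by (auto intro: finite_subset)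
  \<comment> \<open>A label in W is a mistake: the budget M drops by one, which appears in the bound
    as the extra factor z. With no budget left, fewer than two shattered sets are halved to none, so
    no function remains.\<close>
  have "\<exists>C. finite C \<and> real (card C) \<le> ?b ^ card I * z / z ^ M \<and>
      (\<forall>u\<in>{u\<in>V. u x = v}. \<exists>c\<in>C. \<forall>i\<in>I. \<bar>u i - c i\<bar> \<le> G)" if v: "v \<in> W" for v
  proof (cases M)
    case 0
    have "card (shattered_pairs {u\<in>V. u x = v} G B I) = 0"
      using cell[of v] v insert.prems(2) 0 by (auto simp: W_def)
    then have "{u\<in>V. u x = v} = {}"
      using card_shattered_pairs_pos[OF insert.hyps(1)] by (metis not_one_le_zero)
    then show ?thesis using z b1 by (intro exI[of _ "{}"]) auto
  next
    case (Suc m)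
    have "card (shattered_pairs {u\<in>V. u x = v} G B I) < 2 ^ (m + 1)"
      using cell[of v] v insert.prems(2) Suc by (auto simp: W_def)
    then obtain C where "finite C" "real (card C) \<le> ?b ^ card I / z ^ m"
      "\<forall>u\<in>{u\<in>V. u x = v}. \<exists>c\<in>C. \<forall>i\<in>I. \<bar>u i - c i\<bar> \<le> G"
      using insert.IH[of "{u\<in>V. u x = v}" m] insert.prems(1) by auto
    then show ?thesis using z Suc by (intro exI[of _ C]) auto
  qed
  then have "\<exists>D. \<forall>v\<in>W. finite (D v) \<and> real (card (D v)) \<le> ?b ^ card I * z / z ^ M \<and>
      (\<forall>u\<in>{u\<in>V. u x = v}. \<exists>c\<in>D v. \<forall>i\<in>I. \<bar>u i - c i\<bar> \<le> G)"
    by (intro bchoice ballI)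
  then obtain D where D: "finite (D v)" "real (card (D v)) \<le> ?b ^ card I * z / z ^ M"
    "\<forall>u\<in>{u\<in>V. u x = v}. \<exists>c\<in>D v. \<forall>i\<in>I. \<bar>u i - c i\<bar> \<le> G" if "v \<in> W" for v
    by blast
  \<comment> \<open>The branch with the predicted label keeps the budget M; each of the at most B +
    1 mistaken labels contributes at most z times the same bound. This is the recursion solved by (1
    + z (B + 1))^n / z^M.\<close>
  define C where "C = (\<lambda>c. c(x := int q)) ` C0 \<union> (\<Union>v\<in>W. (\<lambda>c. c(x := v)) ` D v)"
  have "finite C" unfolding C_def using C0 W D by auto
  moreover have "real (card C) \<le> ?b ^ card (insert x I) / z ^ M"
  proof -
    have "card C \<le> card C0 + (\<Sum>v\<in>W. card (D v))"
      unfolding C_def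
      by (intro order.trans[OF card_Un_le] add_mono order.trans[OF card_UN_le] sum_mono card_image_le)
         (use C0 W D in auto)
    then have "real (card C) \<le> real (card C0) + (\<Sum>v\<in>W. real (card (D v)))"
      by (metis of_nat_add of_nat_le_iff of_nat_sum)
    also have "(\<Sum>v\<in>W. real (card (D v))) \<le> (\<Sum>v\<in>W. ?b ^ card I * z / z ^ M)"
      by (rule sum_mono) (use D in auto)
    also have "\<dots> = real (card W) * (?b ^ card I * z / z ^ M)" by simp
    also have "\<dots> \<le> (B + 1) * (?b ^ card I * z / z ^ M)"
      using W(2) z b1 B by (intro mult_right_mono) auto
    also have "real (card C0) + \<dots> \<le> ?b ^ card I / z ^ M + (B + 1) * (?b ^ card I * z / z ^ M)"
      using C0(2) by simp
    also have "\<dots> = ?b ^ card (insert x I) / z ^ M"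
      using insert.hyps z by (simp add: field_simps)
    finally show ?thesis by simp
  qed
  moreover have "\<exists>c\<in>C. \<forall>i\<in>insert x I. \<bar>u i - c i\<bar> \<le> G" if u: "u \<in> V" for u
  proof (cases "\<bar>u x - int q\<bar> \<le> G")
    case True
    obtain c where "c \<in> C0" "\<forall>i\<in>I. \<bar>u i - c i\<bar> \<le> G" using C0(3) u by blast
    then show ?thesis using True insert.hyps(2)
      by (intro bexI[of _ "c(x := int q)"]) (auto simp: C_def)
  next
    case False
    then have "u x \<in> W" using insert.prems(1)[of u x] u by (auto simp: W_def)
    then obtain c where "c \<in> D (u x)" "\<forall>i\<in>I. \<bar>u i - c i\<bar> \<le> G" using D(3) u by blast
    then show ?thesis using \<open>u x \<in> W\<close> G insert.hyps(2)
      by (intro bexI[of _ "c(x := u x)"]) (auto simp: C_def)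
  qed
  ultimately show ?case by blast
qed

section \<open>Counting shattered sets with a generating function\<close>

lemma sum_Pow_power:
  fixes y :: real
  assumes "finite X"
  shows "(\<Sum>A\<in>Pow X. y ^ card A) = (1 + y) ^ card X"
  using assms
proof (induction X rule: finite_induct)
  case (insert x X)
  have inj: "inj_on (insert x) (Pow X)"
    by (rule inj_onI) (use insert.hyps in \<open>auto simp: insert_ident\<close>)
  have "(\<Sum>A\<in>Pow (insert x X). y ^ card A)
      = (\<Sum>A\<in>Pow X. y ^ card A) + (\<Sum>A\<in>insert x ` Pow X. y ^ card A)"
    unfolding Pow_insert by (rule sum.union_disjoint) (use insert.hyps in auto)
  also have "(\<Sum>A\<in>insert x ` Pow X. y ^ card A) = (\<Sum>A\<in>Pow X. y * y ^ card A)"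
    unfolding sum.reindex[OF inj] o_def
  proof (rule sum.cong)
    fix A assume "A \<in> Pow X"
    then have "x \<notin> A" "finite A" using insert.hyps by (auto intro: finite_subset)
    then show "y ^ card (insert x A) = y * y ^ card A" by simp
  qed simp
  finally show ?case using insert by (simp add: sum_distrib_left[symmetric] algebra_simps)
qed simp

text \<open>A Sauer bound without binomial sums: for y \<le> 1 a set with at most d elements has
  weight at least y^d, and the total weight of all subsets is a power of 1 + y.\<close>

lemma card_shattered_pairs_le:
  assumes I: "finite I" and B: "B \<ge> 0" and y: "0 < (y::real)" "y \<le> 1"
    and vc: "\<And>A. A \<subseteq> I \<times> {0..B} \<Longrightarrow> pair_shatters V G A \<Longrightarrow> card A \<le> d"
  shows "real (card (shattered_pairs V G B I)) \<le> (1 + y) ^ (card I * nat (B + 1)) / y ^ d"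
proof -
  have "real (card (shattered_pairs V G B I)) * y ^ d = (\<Sum>A\<in>shattered_pairs V G B I. y ^ d)"
    by simp
  also have "\<dots> \<le> (\<Sum>A\<in>shattered_pairs V G B I. y ^ card A)"
    by (intro sum_mono power_decreasing) (use vc y in \<open>auto simp: shattered_pairs_def\<close>)
  also have "\<dots> \<le> (\<Sum>A\<in>Pow (I \<times> {0..B}). y ^ card A)"
    by (rule sum_mono2) (use I y in \<open>auto simp: shattered_pairs_def\<close>)
  also have "\<dots> = (1 + y) ^ (card I * nat (B + 1))"
    by (subst sum_Pow_power) (use I in \<open>auto simp: card_cartesian_product\<close>)
  finally show ?thesis using y by (simp add: field_simps)
qed

section \<open>Swaps between a sample and its ghost copy\<close>

text \<open>Index sets are doubled as \<open>I \<times> bool\<close>; \<open>T\<close> selects the pairs whose two halves are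
  exchanged, \<open>(i, True)\<close> being the ghost copy.\<close>

definition swap_pairs :: "'i set \<Rightarrow> 'i \<times> bool \<Rightarrow> 'i \<times> bool" where
  "swap_pairs T j = (fst j, snd j \<noteq> (fst j \<in> T))"

text \<open>Let K be the pairs with at least one half in Q. A swap that keeps Q out of all first
  halves has no choice on K, and K has at least k elements because k pairs show Q in their second
  half. At most card I - k membership choices remain free.\<close>

lemma card_swaps_le:
  assumes I: "finite I"
  shows "card {T\<in>Pow I. (\<forall>i\<in>I. swap_pairs T (i, False) \<notin> Q) \<and>
      k \<le> card {i\<in>I. swap_pairs T (i, True) \<in> Q}} * 2 ^ k \<le> 2 ^ card I"
proof (cases "{T\<in>Pow I. (\<forall>i\<in>I. swap_pairs T (i, False) \<notin> Q) \<and>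
      k \<le> card {i\<in>I. swap_pairs T (i, True) \<in> Q}} = {}")
  case False
  define K where "K = {i\<in>I. (i, False) \<in> Q \<or> (i, True) \<in> Q}"
  let ?Z = "{T\<in>Pow I. (\<forall>i\<in>I. swap_pairs T (i, False) \<notin> Q) \<and> k \<le> card {i\<in>I. swap_pairs T (i, True) \<in> Q}}"
  obtain R where R: "R \<in> ?Z" using False by blast
  have K: "K \<subseteq> I" "finite K" using I by (auto simp: K_def)
  have "k \<le> card {i\<in>I. swap_pairs R (i, True) \<in> Q}" using R by simp
  also have "{i\<in>I. swap_pairs R (i, True) \<in> Q} \<subseteq> K"
    unfolding K_def swap_pairs_def by (auto, metis (full_types))
  then have "card {i\<in>I. swap_pairs R (i, True) \<in> Q} \<le> card K"
    using K(2) by (rule card_mono[rotated])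
  finally have kK: "k \<le> card K" .
  have "?Z \<subseteq> (\<lambda>T. T \<union> (K \<inter> R)) ` Pow (I - K)"
  proof
    fix T assume T: "T \<in> ?Z"
    have "i \<in> T \<longleftrightarrow> i \<in> R" if i: "i \<in> K" for i
    proof -
      have "swap_pairs T (i, False) \<notin> Q" "swap_pairs R (i, False) \<notin> Q" using T R i by (auto simp: K_def)
      then show ?thesis using i by (cases "i \<in> T"; cases "i \<in> R") (auto simp: K_def swap_pairs_def)
    qed
    then have "T = (T - K) \<union> (K \<inter> R)" by auto
    moreover have "T - K \<in> Pow (I - K)" using T by auto
    ultimately show "T \<in> (\<lambda>T. T \<union> (K \<inter> R)) ` Pow (I - K)" by blast
  qed
  then have "card ?Z \<le> card ((\<lambda>T. T \<union> (K \<inter> R)) ` Pow (I - K))"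
    by (rule card_mono[rotated]) (use I in auto)
  also have "\<dots> \<le> card (Pow (I - K))" by (rule card_image_le) (use I in auto)
  also have "\<dots> = 2 ^ (card I - card K)" using I K by (simp add: card_Pow card_Diff_subset)
  also have "\<dots> \<le> 2 ^ (card I - k)" using kK by (intro power_increasing) auto
  finally have "card ?Z * 2 ^ k \<le> 2 ^ (card I - k) * 2 ^ k" by simp
  also have "\<dots> = 2 ^ card I"
    using kK card_mono[OF I K(1)] by (simp flip: power_add)
  finally show ?thesis .
next
  case True
  show ?thesis unfolding True by simp
qed

section \<open>Candidates from the leave-one-out predictor\<close>

text \<open>Of two independent draws with the same law it is immaterial which one ends up at s. This
  turns the leave-one-out error at a sample position into the expected error at a fresh test
  point.\<close>

lemma Pi_pmf_resample:
  assumes "finite A" "s \<in> A"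
  shows "do {W \<leftarrow> Pi_pmf A dflt (\<lambda>_. p); x \<leftarrow> p; return_pmf (W(s := x))} = Pi_pmf A dflt (\<lambda>_. p)"
proof -
  have A: "Pi_pmf A dflt (\<lambda>_. p) = do {y \<leftarrow> p; f \<leftarrow> Pi_pmf (A - {s}) dflt (\<lambda>_. p); return_pmf (f(s := y))}"
    using Pi_pmf_insert'[of "A - {s}" s dflt "\<lambda>_. p"] assms by (simp add: insert_absorb)
  have "do {W \<leftarrow> Pi_pmf A dflt (\<lambda>_. p); x \<leftarrow> p; return_pmf (W(s := x))}
      = do {f \<leftarrow> Pi_pmf (A - {s}) dflt (\<lambda>_. p); x \<leftarrow> p; return_pmf (f(s := x))}"
    unfolding A by (simp add: bind_assoc_pmf bind_return_pmf)
  also have "\<dots> = Pi_pmf A dflt (\<lambda>_. p)"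
    unfolding A by (rule bind_commute_pmf)
  finally show ?thesis .
qed

lemma nn_integral_Pi_pmf_resample:
  assumes "finite A" "s \<in> A"
  shows "(\<integral>\<^sup>+W. \<phi> W \<partial>measure_pmf (Pi_pmf A dflt (\<lambda>_. p)))
    = (\<integral>\<^sup>+W. (\<integral>\<^sup>+x. \<phi> (W(s := x)) \<partial>measure_pmf p) \<partial>measure_pmf (Pi_pmf A dflt (\<lambda>_. p)))"
  by (subst Pi_pmf_resample[OF assms, symmetric])
     (simp add: nn_integral_bind_pmf nn_integral_return_pmf)

lemma set_Pi_pmf_const:
  assumes "finite A" "W \<in> set_pmf (Pi_pmf A dflt (\<lambda>_. p))"
  shows "i \<in> A \<Longrightarrow> W i \<in> set_pmf p" "i \<notin> A \<Longrightarrow> W i = dflt"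
  using assms by (auto simp: set_Pi_pmf PiE_dflt_def)

section \<open>Quantised labels and the refined candidates\<close>

definition clip01 :: "real \<Rightarrow> real" where "clip01 y = max 0 (min 1 y)"

lemma clip01: "clip01 y \<in> {0..1}" "v \<in> {0..1} \<Longrightarrow> \<bar>clip01 y - v\<bar> \<le> \<bar>y - v\<bar>"
  "v \<in> {0..1} \<Longrightarrow> \<bar>clip01 y - v\<bar> \<le> 1"
  by (auto simp: clip01_def)

text \<open>The base \<open>lo\<close> and the height B describe a window. With \<open>lo\<close> =
  0 it covers [0,1] and B grows like 1/\<epsilon>; placed around a coarse representative it needs
  only a number of levels bounded in terms of \<kappa>.\<close>

definition quantise :: "('x \<Rightarrow> real) \<Rightarrow> real \<Rightarrow> int \<Rightarrow> ('x \<Rightarrow> real) \<Rightarrow> 'x \<Rightarrow> int" where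
  "quantise lo \<tau> B f x = max 0 (min B \<lfloor>(f x - lo x) / \<tau>\<rfloor>)"

text \<open>The value 0 outside I puts all label vectors into the finite set
  \<open>PiE_dflt I 0 (\<lambda>_. {0..B})\<close>, over which the candidates range.\<close>

definition labels :: "('x \<Rightarrow> real) \<Rightarrow> real \<Rightarrow> int \<Rightarrow> 'i set \<Rightarrow> ('i \<Rightarrow> 'x) \<Rightarrow> ('x \<Rightarrow> real) \<Rightarrow> 'i \<Rightarrow> int" where
  "labels lo \<tau> B I W f i = (if i \<in> I then quantise lo \<tau> B f (W i) else 0)"

text \<open>Shattered sets consist of positions and the sample W is universally quantified, so a
  sample with repeated points is treated like any other.\<close>

definition gap_dim_le :: "'x set \<Rightarrow> ('x \<Rightarrow> real) set \<Rightarrow> ('x \<Rightarrow> real) \<Rightarrow> real \<Rightarrow> int \<Rightarrow> int \<Rightarrow> nat \<Rightarrow> 'i set \<Rightarrow> bool" where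
  "gap_dim_le X F lo \<tau> B G d I \<longleftrightarrow> (\<forall>W \<theta> S. W ` I \<subseteq> X \<longrightarrow> 1 \<le> \<theta> \<longrightarrow> \<theta> \<le> B \<longrightarrow> S \<subseteq> I \<longrightarrow>
     gap_shatters (labels lo \<tau> B I W ` F) G \<theta> S \<longrightarrow> card S \<le> d)"

text \<open>The predictor may depend on all points, the test point included; only the label at s is
  withheld from it. It is chosen for the whole class F and not for the unknown f.\<close>

definition loo_pred :: "('x \<Rightarrow> real) set \<Rightarrow> ('x \<Rightarrow> real) \<Rightarrow> real \<Rightarrow> int \<Rightarrow> int \<Rightarrow> nat \<Rightarrow> 'i set
    \<Rightarrow> ('i \<Rightarrow> 'x) \<Rightarrow> 'i \<Rightarrow> ('i \<Rightarrow> int) \<Rightarrow> int" where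
  "loo_pred F lo \<tau> B G d I W = (SOME pred. \<forall>u\<in>labels lo \<tau> B I W ` F.
     (\<Sum>s\<in>I. \<bar>pred s (u(s := 0)) - u s\<bar>) \<le> int (card I) * G + 2 * int d * B)"

text \<open>The candidates are indexed by the position \<open>s\<close> of the sample that is replaced by the test
  point, and by the labels \<open>w\<close> of the remaining positions.\<close>

definition refine_fun :: "('x \<Rightarrow> real) set \<Rightarrow> ('x \<Rightarrow> real) \<Rightarrow> real \<Rightarrow> int \<Rightarrow> int \<Rightarrow> nat \<Rightarrow> 'i set
    \<Rightarrow> ('i \<Rightarrow> 'x) \<Rightarrow> 'i \<Rightarrow> ('i \<Rightarrow> int) \<Rightarrow> 'x \<Rightarrow> real" where
  "refine_fun F lo \<tau> B G d I W s w x = clip01 (lo x + \<tau> * loo_pred F lo \<tau> B G d I (W(s := x)) s w)"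

definition refine_cands :: "('x \<Rightarrow> real) set \<Rightarrow> ('x \<Rightarrow> real) \<Rightarrow> real \<Rightarrow> int \<Rightarrow> int \<Rightarrow> nat \<Rightarrow> 'i set
    \<Rightarrow> ('i \<Rightarrow> 'x) \<Rightarrow> ('x \<Rightarrow> real) set" where
  "refine_cands F lo \<tau> B G d I W =
     (\<lambda>(s, w). refine_fun F lo \<tau> B G d I W s w) ` (I \<times> PiE_dflt I 0 (\<lambda>_. {0..B}))"

lemma refine_cands_finite:
  assumes "finite I" "B \<ge> 0"
  shows "finite (refine_cands F lo \<tau> B G d I W)"
    "card (refine_cands F lo \<tau> B G d I W) \<le> card I * nat (B + 1) ^ card I"
proof -
  have fin: "finite (I \<times> PiE_dflt I 0 (\<lambda>_. {0..B}))" using assms by auto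
  show "finite (refine_cands F lo \<tau> B G d I W)"
    unfolding refine_cands_def using fin by (rule finite_imageI)
  have "card (refine_cands F lo \<tau> B G d I W) \<le> card (I \<times> PiE_dflt I (0::int) (\<lambda>_. {0..B}))"
    unfolding refine_cands_def using fin by (rule card_image_le)
  also have "\<dots> = card I * nat (B + 1) ^ card I"
    using assms by (simp add: card_cartesian_product card_PiE_dflt)
  finally show "card (refine_cands F lo \<tau> B G d I W) \<le> card I * nat (B + 1) ^ card I" .
qed

lemma refine_cands_range: "h \<in> refine_cands F lo \<tau> B G d I W \<Longrightarrow> h x \<in> {0..1}"
  by (auto simp: refine_cands_def refine_fun_def clip01(1) simp del: atLeastAtMost_iff)

lemma loo_pred:
  assumes "finite I" "G \<ge> 1" "B \<ge> 0" "gap_dim_le X F lo \<tau> B G d I" "W ` I \<subseteq> X" "f \<in> F"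
  shows "(\<Sum>s\<in>I. \<bar>loo_pred F lo \<tau> B G d I W s ((labels lo \<tau> B I W f)(s := 0)) - labels lo \<tau> B I W f s\<bar>)
    \<le> int (card I) * G + 2 * int d * B"
proof -
  have "\<exists>pred. \<forall>u\<in>labels lo \<tau> B I W ` F.
     (\<Sum>s\<in>I. \<bar>pred s (u(s := 0)) - u s\<bar>) \<le> int (card I) * G + 2 * int d * B"
  proof (rule leave_one_out_predictor)
    fix u i assume "u \<in> labels lo \<tau> B I W ` F" "i \<in> I"
    then show "0 \<le> u i \<and> u i \<le> B" using assms(3) by (auto simp: labels_def quantise_def)
  next
    fix \<theta> S assume "1 \<le> \<theta>" "\<theta> \<le> B" "S \<subseteq> I" "gap_shatters (labels lo \<tau> B I W ` F) G \<theta> S"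
    then show "card S \<le> d" using assms(4,5) unfolding gap_dim_le_def by blast
  qed (use assms in auto)
  from someI_ex[OF this] show ?thesis
    using assms(6) unfolding loo_pred_def by blast
qed

text \<open>By resampling, the error of position s is the expected error at the sample point W s,
  and the leave-one-out bound controls the sum over s for every sample. Hence some position does as
  well as the average. It depends on p and f, which is why all positions become candidates. The
  extra 1 beside G pays for rounding down, and a point outside the window costs at most 1.\<close>

lemma refine_error:
  assumes I: "finite I" "I \<noteq> {}" and GB: "G \<ge> 1" "B \<ge> 0" and \<tau>: "\<tau> > 0"
    and vc: "gap_dim_le X F lo \<tau> B G d I" and F: "F \<subseteq> X \<rightarrow> {0..1}" and p: "set_pmf p \<subseteq> X" and f: "f \<in> F"
  shows "\<exists>s\<in>I. (\<integral>\<^sup>+W. (\<integral>\<^sup>+x. ennreal \<bar>refine_fun F lo \<tau> B G d I W s ((labels lo \<tau> B I W f)(s := 0)) x - f x\<bar> \<partial>measure_pmf p)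
      \<partial>measure_pmf (Pi_pmf I dflt (\<lambda>_. p)))
    \<le> ennreal (\<tau> * (G + 1 + 2 * d * B / card I)) + emeasure (measure_pmf p) {x. \<not> (lo x \<le> f x \<and> f x < lo x + \<tau> * (B + 1))}"
    (is "\<exists>s\<in>I. ?L s \<le> ?c + ?out")
proof -
  let ?n = "card I"
  let ?O = "{x. \<not> (lo x \<le> f x \<and> f x < lo x + \<tau> * (B + 1))}"
  define Q where "Q = Pi_pmf I dflt (\<lambda>_. p)"
  define lab where "lab W = labels lo \<tau> B I W f" for W
  define e where "e W s = \<bar>refine_fun F lo \<tau> B G d I W s ((lab W)(s := 0)) (W s) - f (W s)\<bar>" for W s
  have n: "?n > 0" using I by auto
  have L: "?L s = (\<integral>\<^sup>+W. ennreal (e W s) \<partial>measure_pmf Q)" if s: "s \<in> I" for s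
  proof -
    \<comment> \<open>Erasing the label at s removes the only trace of W s in the labels, so the
      resampled point influences the prediction only as the test point.\<close>
    have "(lab (W(s := x)))(s := 0) = (lab W)(s := 0)" for W x
      by (auto simp: lab_def labels_def)
    then have "e (W(s := x)) s = \<bar>refine_fun F lo \<tau> B G d I W s ((lab W)(s := 0)) x - f x\<bar>" for W x
      by (simp add: e_def refine_fun_def)
    then have "(\<integral>\<^sup>+W. (\<integral>\<^sup>+x. ennreal (e (W(s := x)) s) \<partial>measure_pmf p) \<partial>measure_pmf (Pi_pmf I dflt (\<lambda>_. p))) = ?L s"
      by (simp add: lab_def)
    then show ?thesis
      using nn_integral_Pi_pmf_resample[OF I(1) s, where \<phi> = "\<lambda>W. ennreal (e W s)" and dflt = dflt and p = p] unfolding Q_def by simp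
  qed
  have point: "e W s \<le> \<tau> * real_of_int \<bar>loo_pred F lo \<tau> B G d I W s ((lab W)(s := 0)) - lab W s\<bar> + \<tau> + indicator ?O (W s)"
    if W: "W s \<in> X" and s: "s \<in> I" for W s
  proof -
    let ?p = "loo_pred F lo \<tau> B G d I W s ((lab W)(s := 0))"
    have fx: "f (W s) \<in> {0..1}" using funcset_mem[OF subsetD[OF F f] W] .
    have e: "e W s = \<bar>clip01 (lo (W s) + \<tau> * ?p) - f (W s)\<bar>" by (simp add: e_def refine_fun_def)
    show ?thesis
    proof (cases "W s \<in> ?O")
      case True
      have "e W s \<le> 1" unfolding e using clip01(3)[OF fx] .
      moreover have "0 \<le> \<tau> * real_of_int \<bar>?p - lab W s\<bar>" using \<tau> by simp
      moreover have "indicator ?O (W s) = (1::real)" using True by simp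
      ultimately show ?thesis using \<tau> by linarith
    next
      case False
      define y where "y = (f (W s) - lo (W s)) / \<tau>"
      have "0 \<le> y" "y < B + 1" using False \<tau> by (auto simp: y_def field_simps)
      then have "0 \<le> \<lfloor>y\<rfloor>" "\<lfloor>y\<rfloor> \<le> B" by (auto simp: floor_less_iff le_floor_iff) linarith
      then have "lab W s = \<lfloor>y\<rfloor>" using s by (simp add: lab_def labels_def quantise_def y_def)
      then have y: "real_of_int (lab W s) \<le> y" "y < lab W s + 1" by linarith+
      have fy: "f (W s) = lo (W s) + \<tau> * y" using \<tau> by (simp add: y_def)
      have "e W s \<le> \<bar>lo (W s) + \<tau> * ?p - f (W s)\<bar>" unfolding e using clip01(2)[OF fx] .
      also have "\<dots> = \<tau> * \<bar>real_of_int ?p - y\<bar>"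
        unfolding fy using \<tau> by (simp add: abs_mult flip: right_diff_distrib)
      also have "\<dots> \<le> \<tau> * (real_of_int \<bar>?p - lab W s\<bar> + 1)"
        using y \<tau> by (intro mult_left_mono) linarith+
      finally show ?thesis using False by (simp add: distrib_left)
    qed
  qed
  have "(\<Sum>s\<in>I. ?L s) = (\<integral>\<^sup>+W. (\<Sum>s\<in>I. ennreal (e W s)) \<partial>measure_pmf Q)"
    using L by (simp add: nn_integral_sum)
  also have "\<dots> \<le> (\<integral>\<^sup>+W. (ennreal (?n * (\<tau> * (G + 1 + 2 * d * B / ?n))) + (\<Sum>s\<in>I. indicator ?O (W s))) \<partial>measure_pmf Q)"
  proof (rule nn_integral_mono_AE, rule AE_pmfI)
    fix W assume "W \<in> set_pmf Q"
    then have "\<And>i. i \<in> I \<Longrightarrow> W i \<in> set_pmf p" unfolding Q_def by (rule set_Pi_pmf_const(1)[OF I(1)])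
    then have W: "W ` I \<subseteq> X" using p by blast
    have "(\<Sum>s\<in>I. e W s) \<le> (\<Sum>s\<in>I. \<tau> * real_of_int \<bar>loo_pred F lo \<tau> B G d I W s ((lab W)(s := 0)) - lab W s\<bar> + \<tau> + indicator ?O (W s))"
      by (intro sum_mono point) (use W in auto)
    also have "\<dots> = \<tau> * real_of_int (\<Sum>s\<in>I. \<bar>loo_pred F lo \<tau> B G d I W s ((lab W)(s := 0)) - lab W s\<bar>) + ?n * \<tau> + (\<Sum>s\<in>I. indicator ?O (W s))"
      by (simp add: sum.distrib sum_distrib_left)
    also have "\<dots> \<le> \<tau> * real_of_int (int ?n * G + 2 * int d * B) + ?n * \<tau> + (\<Sum>s\<in>I. indicator ?O (W s))"
      using loo_pred[OF I(1) GB vc W f] \<tau> unfolding lab_def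
      by (intro add_right_mono mult_left_mono, unfold of_int_le_iff) auto
    also have "\<dots> = ?n * (\<tau> * (G + 1 + 2 * d * B / ?n)) + (\<Sum>s\<in>I. indicator ?O (W s))"
      using n by (simp add: field_simps)
    finally have "ennreal (\<Sum>s\<in>I. e W s) \<le> ennreal (?n * (\<tau> * (G + 1 + 2 * d * B / ?n)) + (\<Sum>s\<in>I. indicator ?O (W s)))"
      by (rule ennreal_leI)
    also have "\<dots> = ennreal (?n * (\<tau> * (G + 1 + 2 * d * B / ?n))) + ennreal (\<Sum>s\<in>I. indicator ?O (W s))"
      by (rule ennreal_plus) (use \<tau> GB in \<open>auto intro!: sum_nonneg mult_nonneg_nonneg add_nonneg_nonneg\<close>)
    also have "ennreal (\<Sum>s\<in>I. indicator ?O (W s)) = (\<Sum>s\<in>I. indicator ?O (W s))"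
      by (subst sum_ennreal[symmetric]) (auto intro!: sum.cong simp: ennreal_indicator)
    finally show "(\<Sum>s\<in>I. ennreal (e W s)) \<le> ennreal (?n * (\<tau> * (G + 1 + 2 * d * B / ?n))) + (\<Sum>s\<in>I. indicator ?O (W s))"
      by (simp add: sum_ennreal e_def)
  qed
  also have "\<dots> = ennreal (?n * (\<tau> * (G + 1 + 2 * d * B / ?n))) + (\<Sum>s\<in>I. \<integral>\<^sup>+W. indicator ?O (W s) \<partial>measure_pmf Q)"
    by (simp add: nn_integral_add nn_integral_sum)
  also have "(\<Sum>s\<in>I. \<integral>\<^sup>+W. indicator ?O (W s) \<partial>measure_pmf Q) = (\<Sum>s\<in>I. ?out)"
  proof (rule sum.cong)
    fix s assume s: "s \<in> I"
    show "(\<integral>\<^sup>+W. indicator ?O (W s) \<partial>measure_pmf Q) = ?out"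
      unfolding Q_def by (subst nn_integral_Pi_pmf_resample[OF I(1) s]) simp
  qed simp
  also have "ennreal (?n * (\<tau> * (G + 1 + 2 * d * B / ?n))) = of_nat ?n * ?c"
    using \<tau> GB by (subst ennreal_mult) (auto simp: ennreal_of_nat_eq_real_of_nat intro!: mult_nonneg_nonneg add_nonneg_nonneg)
  also have "of_nat ?n * ?c + (\<Sum>s\<in>I. ?out) = of_nat ?n * (?c + ?out)" by (simp add: distrib_left)
  finally have "(\<Sum>s\<in>I. ?L s) \<le> of_nat ?n * (?c + ?out)" .
  moreover obtain s0 where s0: "s0 \<in> I" "\<And>s. s \<in> I \<Longrightarrow> ?L s0 \<le> ?L s"
    using arg_min_if_finite(1)[OF I, of ?L] arg_min_least[OF I, of _ ?L] by blast
  moreover have "of_nat ?n * ?L s0 \<le> (\<Sum>s\<in>I. ?L s)"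
    using sum_mono[of I "\<lambda>_. ?L s0" ?L] s0(2) by simp
  ultimately have "of_nat ?n * ?L s0 \<le> of_nat ?n * (?c + ?out)" by (meson order.trans)
  then have "?L s0 \<le> ?c + ?out"
    using n by (subst (asm) ennreal_mult_le_mult_iff) auto
  then show ?thesis using s0(1) by blast
qed

section \<open>Generalisation of a coarse cover\<close>

lemma swap_pairs_invol: "swap_pairs T (swap_pairs T j) = j"
  by (cases j) (auto simp: swap_pairs_def)

lemma Pi_pmf_swap:
  assumes "finite I" "T \<subseteq> I"
  shows "Pi_pmf (I \<times> UNIV) dflt (\<lambda>_. p) = map_pmf (\<lambda>D. D \<circ> swap_pairs T) (Pi_pmf (I \<times> UNIV) dflt (\<lambda>_. p))"
proof (rule Pi_pmf_bij_betw)
  show "bij_betw (swap_pairs T) (I \<times> UNIV) (I \<times> UNIV)"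
    by (rule bij_betw_byWitness[where f' = "swap_pairs T"])
       (auto simp: swap_pairs_invol, auto simp: swap_pairs_def)
qed (use assms in \<open>auto simp: swap_pairs_def\<close>)

lemma Pi_pmf_first_half:
  assumes I: "finite I"
  shows "Pi_pmf I dflt (\<lambda>_. p) = map_pmf (\<lambda>D i. if i \<in> I then D (i, False) else dflt) (Pi_pmf (I \<times> UNIV) dflt (\<lambda>_. p))"
proof -
  have "Pi_pmf I dflt (\<lambda>_. p) = map_pmf (\<lambda>g. g \<circ> (\<lambda>i. (i, False))) (Pi_pmf (I \<times> {False}) dflt (\<lambda>_. p))"
    by (rule Pi_pmf_bij_betw) (use I in \<open>auto intro!: bij_betwI[where g = fst]\<close>)
  also have "Pi_pmf (I \<times> {False}) dflt (\<lambda>_. p)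
      = map_pmf (\<lambda>f x. if x \<in> I \<times> {False} then f x else dflt) (Pi_pmf (I \<times> UNIV) dflt (\<lambda>_. p))"
    by (rule Pi_pmf_subset) (use I in auto)
  finally show ?thesis by (simp add: pmf.map_comp o_def)
qed

text \<open>The law of the double sample is invariant under every swap, so the probability is an
  average over all swaps T. For a fixed double sample a cover replaces the members of Q, and each of
  its at most N elements admits at most a fraction 2^-k of the swaps. The radii 2 G, 3 G and 4 G
  leave room for the distance G to the cover element on both halves.\<close>

lemma coarse_double_sample:
  fixes f :: "'x \<Rightarrow> int" and Q :: "('x \<Rightarrow> int) set" and I :: "'i set"
  assumes I: "finite I" and p: "set_pmf p \<subseteq> X"
    and cover: "\<And>D :: 'i \<times> bool \<Rightarrow> 'x. D ` (I \<times> UNIV) \<subseteq> X \<Longrightarrow>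
      \<exists>C. finite C \<and> real (card C) \<le> N \<and> (\<forall>g\<in>Q. \<exists>c\<in>C. \<forall>j\<in>I \<times> UNIV. \<bar>g (D j) - c j\<bar> \<le> G)"
  shows "measure_pmf.prob (Pi_pmf (I \<times> UNIV) dflt (\<lambda>_. p))
     {D. \<exists>g\<in>Q. (\<forall>i\<in>I. \<bar>g (D (i, False)) - f (D (i, False))\<bar> \<le> 2 * G) \<and>
        k \<le> card {i\<in>I. \<bar>g (D (i, True)) - f (D (i, True))\<bar> > 4 * G}} \<le> N / 2 ^ k"
    (is "measure_pmf.prob ?P ?E \<le> _")
proof -
  have swap: "measure_pmf.prob ?P ?E = measure_pmf.expectation ?P (\<lambda>D. indicator ?E (D \<circ> swap_pairs T))"
    if "T \<in> Pow I" for T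
  proof -
    have "measure_pmf.prob ?P ?E = measure_pmf.prob (map_pmf (\<lambda>D. D \<circ> swap_pairs T) ?P) ?E"
      using Pi_pmf_swap[OF I, of T dflt p] that by simp
    also have "\<dots> = measure_pmf.prob ?P ((\<lambda>D. D \<circ> swap_pairs T) -` ?E)" by simp
    also have "\<dots> = measure_pmf.expectation ?P (indicator ((\<lambda>D. D \<circ> swap_pairs T) -` ?E))" by simp
    also have "indicator ((\<lambda>D. D \<circ> swap_pairs T) -` ?E) = (\<lambda>D. indicator ?E (D \<circ> swap_pairs T) :: real)"
      by (auto simp: indicator_def fun_eq_iff)
    finally show ?thesis .
  qed
  have int: "integrable ?P (\<lambda>D. indicator ?E (D \<circ> swap_pairs T) :: real)" for T
    by (rule measure_pmf.integrable_const_bound[where B = 1]) auto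
  have "2 ^ card I * measure_pmf.prob ?P ?E = (\<Sum>T\<in>Pow I. measure_pmf.prob ?P ?E)"
    using I by (simp add: card_Pow)
  also have "\<dots> = (\<Sum>T\<in>Pow I. measure_pmf.expectation ?P (\<lambda>D. indicator ?E (D \<circ> swap_pairs T)))"
    by (rule sum.cong) (use swap in auto)
  also have "\<dots> = measure_pmf.expectation ?P (\<lambda>D. \<Sum>T\<in>Pow I. indicator ?E (D \<circ> swap_pairs T))"
    by (rule Bochner_Integration.integral_sum[symmetric]) (rule int)
  also have "\<dots> \<le> measure_pmf.expectation ?P (\<lambda>D. N * (2 ^ card I / 2 ^ k))"
  proof (rule integral_mono_AE)
    show "AE D in measure_pmf ?P. (\<Sum>T\<in>Pow I. indicator ?E (D \<circ> swap_pairs T)) \<le> N * (2 ^ card I / 2 ^ k)"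
    proof (rule AE_pmfI)
      fix D assume D: "D \<in> set_pmf ?P"
      have "D j \<in> set_pmf p" if "j \<in> I \<times> UNIV" for j
        by (rule set_Pi_pmf_const(1)[OF _ D that]) (use I in simp)
      then have "D ` (I \<times> UNIV) \<subseteq> X" using p by blast
      from cover[OF this] obtain C where C: "finite C" "real (card C) \<le> N"
        "\<forall>g\<in>Q. \<exists>c\<in>C. \<forall>j\<in>I \<times> UNIV. \<bar>g (D j) - c j\<bar> \<le> G" by blast
      \<comment> \<open>The cover is taken for the unswapped sample D and indexed by position; a
        swap only permutes positions, so one cover serves all swaps.\<close>
      define R where "R c = {j. \<bar>c j - f (D j)\<bar> > 3 * G}" for c
      define Z where "Z c = {T\<in>Pow I. (\<forall>i\<in>I. swap_pairs T (i, False) \<notin> R c) \<and>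
        k \<le> card {i\<in>I. swap_pairs T (i, True) \<in> R c}}" for c
      have sub: "{T\<in>Pow I. D \<circ> swap_pairs T \<in> ?E} \<subseteq> (\<Union>c\<in>C. Z c)"
      proof
        fix T assume T: "T \<in> {T\<in>Pow I. D \<circ> swap_pairs T \<in> ?E}"
        then obtain g where g: "g \<in> Q"
          "\<forall>i\<in>I. \<bar>g (D (swap_pairs T (i, False))) - f (D (swap_pairs T (i, False)))\<bar> \<le> 2 * G"
          "k \<le> card {i\<in>I. \<bar>g (D (swap_pairs T (i, True))) - f (D (swap_pairs T (i, True)))\<bar> > 4 * G}"
          by auto
        obtain c where c: "c \<in> C" "\<forall>j\<in>I \<times> UNIV. \<bar>g (D j) - c j\<bar> \<le> G" using C(3) g(1) by blast
        have cs: "\<bar>g (D (swap_pairs T (i, b))) - c (swap_pairs T (i, b))\<bar> \<le> G" if "i \<in> I" for i b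
          using c(2) that by (auto simp: swap_pairs_def)
        have "swap_pairs T (i, False) \<notin> R c" if "i \<in> I" for i
          using cs[OF that, of False] bspec[OF g(2) that] by (auto simp: R_def)
        moreover have "{i\<in>I. \<bar>g (D (swap_pairs T (i, True))) - f (D (swap_pairs T (i, True)))\<bar> > 4 * G}
            \<subseteq> {i\<in>I. swap_pairs T (i, True) \<in> R c}"
        proof
          fix i assume i: "i \<in> {i\<in>I. \<bar>g (D (swap_pairs T (i, True))) - f (D (swap_pairs T (i, True)))\<bar> > 4 * G}"
          then show "i \<in> {i\<in>I. swap_pairs T (i, True) \<in> R c}"
            using cs[of i True] by (auto simp: R_def)
        qed
        then have "k \<le> card {i\<in>I. swap_pairs T (i, True) \<in> R c}"
          by (rule order.trans[OF g(3) card_mono[rotated]]) (use I in simp)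
        ultimately have "T \<in> Z c" using T by (auto simp: Z_def)
        then show "T \<in> (\<Union>c\<in>C. Z c)" using c(1) by blast
      qed
      have "(\<Sum>T\<in>Pow I. indicator ?E (D \<circ> swap_pairs T)) = real (card {T\<in>Pow I. D \<circ> swap_pairs T \<in> ?E})"
      proof -
        have "(\<Sum>T\<in>Pow I. indicator ?E (D \<circ> swap_pairs T)) = (\<Sum>T\<in>Pow I. if D \<circ> swap_pairs T \<in> ?E then 1 else (0::real))"
          by (intro sum.cong refl) (simp add: indicator_def del: mem_Collect_eq)
        also have "\<dots> = real (card {T\<in>Pow I. D \<circ> swap_pairs T \<in> ?E})"
          using I by (subst sum.inter_filter[symmetric]) auto
        finally show ?thesis .
      qed
      also have "\<dots> \<le> real (card (\<Union>c\<in>C. Z c))"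
        using sub C(1) I by (intro of_nat_mono card_mono) (auto simp: Z_def)
      also have "\<dots> \<le> real (\<Sum>c\<in>C. card (Z c))"
        using card_UN_le[OF C(1), of Z] by (rule of_nat_mono)
      also have "\<dots> = (\<Sum>c\<in>C. real (card (Z c)))" by simp
      also have "\<dots> \<le> (\<Sum>c\<in>C. 2 ^ card I / 2 ^ k)"
      proof (rule sum_mono)
        fix c
        have "real (card (Z c) * 2 ^ k) \<le> real (2 ^ card I)"
          using card_swaps_le[OF I, of "R c" k] unfolding Z_def by (rule of_nat_mono)
        then show "real (card (Z c)) \<le> 2 ^ card I / 2 ^ k" by (simp add: field_simps)
      qed
      also have "\<dots> = real (card C) * (2 ^ card I / 2 ^ k)" by simp
      also have "\<dots> \<le> N * (2 ^ card I / 2 ^ k)" using C(2) by (intro mult_right_mono) auto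
      finally show "(\<Sum>T\<in>Pow I. indicator ?E (D \<circ> swap_pairs T)) \<le> N * (2 ^ card I / 2 ^ k)" .
    qed
  qed (auto intro!: Bochner_Integration.integrable_sum int)
  also have "\<dots> = N * (2 ^ card I / 2 ^ k)" by simp
  finally show ?thesis by (simp add: field_simps)
qed

text \<open>A ghost position is as good as a fresh test point, so the expected mass of the bad set
  is the expected fraction of bad ghost positions. This fraction is below k / card I unless the
  double-sample event occurs, and then it is at most 1. The selected function may depend on the
  sample in any way, because the event covers all of Q.\<close>

lemma coarse_error:
  fixes f :: "'x \<Rightarrow> int" and Q :: "('x \<Rightarrow> int) set" and I :: "'i set"
  assumes I: "finite I" "I \<noteq> {}" and p: "set_pmf p \<subseteq> X"
    and cover: "\<And>D :: 'i \<times> bool \<Rightarrow> 'x. D ` (I \<times> UNIV) \<subseteq> X \<Longrightarrow>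
      \<exists>C. finite C \<and> real (card C) \<le> N \<and> (\<forall>g\<in>Q. \<exists>c\<in>C. \<forall>j\<in>I \<times> UNIV. \<bar>g (D j) - c j\<bar> \<le> G)"
    and sel: "\<And>U. U ` I \<subseteq> X \<Longrightarrow> sel U \<in> Q \<and> (\<forall>i\<in>I. \<bar>sel U (U i) - f (U i)\<bar> \<le> 2 * G)"
  shows "(\<integral>\<^sup>+U. emeasure (measure_pmf p) {x. \<bar>sel U x - f x\<bar> > 4 * G} \<partial>measure_pmf (Pi_pmf I dflt (\<lambda>_. p)))
    \<le> ennreal (k / card I + N / 2 ^ k)"
proof -
  let ?P = "Pi_pmf (I \<times> (UNIV::bool set)) dflt (\<lambda>_. p)"
  let ?n = "card I"
  let ?E = "{D. \<exists>g\<in>Q. (\<forall>i\<in>I. \<bar>g (D (i, False)) - f (D (i, False))\<bar> \<le> 2 * G) \<and>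
        k \<le> card {i\<in>I. \<bar>g (D (i, True)) - f (D (i, True))\<bar> > 4 * G}}"
  define h where "h D = (\<lambda>i. if i \<in> I then D (i, False) else dflt)" for D :: "'i \<times> bool \<Rightarrow> 'x"
  define bad where "bad U x \<longleftrightarrow> \<bar>sel U x - f x\<bar> > 4 * G" for U x
  let ?L = "\<integral>\<^sup>+U. emeasure (measure_pmf p) {x. bad U x} \<partial>measure_pmf (Pi_pmf I dflt (\<lambda>_. p))"
  have n: "?n > 0" using I by auto
  have L: "?L = (\<integral>\<^sup>+D. indicator {D. bad (h D) (D (i, True))} D \<partial>measure_pmf ?P)" if i: "i \<in> I" for i
  proof -
    have hi: "h (D((i, True) := x)) = h D" for D x by (auto simp: h_def)
    have fi: "finite (I \<times> (UNIV::bool set))" "(i, True) \<in> I \<times> UNIV" using I i by auto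
    have "(\<integral>\<^sup>+D. indicator {D. bad (h D) (D (i, True))} D \<partial>measure_pmf ?P)
      = (\<integral>\<^sup>+D. (\<integral>\<^sup>+x. indicator {D. bad (h D) (D (i, True))} (D((i, True) := x)) \<partial>measure_pmf p) \<partial>measure_pmf ?P)"
      by (rule nn_integral_Pi_pmf_resample[OF fi])
    also have "\<dots> = (\<integral>\<^sup>+D. (\<integral>\<^sup>+x. indicator {x. bad (h D) x} x \<partial>measure_pmf p) \<partial>measure_pmf ?P)"
      by (intro nn_integral_cong) (auto simp: indicator_def hi)
    also have "\<dots> = (\<integral>\<^sup>+D. emeasure (measure_pmf p) {x. bad (h D) x} \<partial>measure_pmf ?P)"
      by simp
    also have "\<dots> = ?L"
      unfolding Pi_pmf_first_half[OF I(1)] by (simp add: h_def)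
    finally show ?thesis by simp
  qed
  have cnt: "(\<Sum>i\<in>I. indicator {D. bad (h D) (D (i, True))} D) \<le> of_nat k + of_nat ?n * (indicator ?E D :: ennreal)"
    if D: "D \<in> set_pmf ?P" for D
  proof -
    have Dj: "D j \<in> X" if "j \<in> I \<times> UNIV" for j
      using set_Pi_pmf_const(1)[OF _ D that] I p by auto
    have hX: "h D ` I \<subseteq> X" using Dj by (auto simp: h_def)
    have s: "sel (h D) \<in> Q" "\<forall>i\<in>I. \<bar>sel (h D) (D (i, False)) - f (D (i, False))\<bar> \<le> 2 * G"
      using sel[OF hX] by (auto simp: h_def)
    have eq: "(\<Sum>i\<in>I. indicator {D. bad (h D) (D (i, True))} D) = (of_nat (card {i\<in>I. bad (h D) (D (i, True))}) :: ennreal)"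
    proof -
      have "(\<Sum>i\<in>I. indicator {D. bad (h D) (D (i, True))} D) = (\<Sum>i\<in>I. if bad (h D) (D (i, True)) then 1 else (0::ennreal))"
        by (intro sum.cong refl) (simp add: indicator_def)
      also have "\<dots> = of_nat (card {i\<in>I. bad (h D) (D (i, True))})"
        using I by (subst sum.inter_filter[symmetric]) auto
      finally show ?thesis .
    qed
    show ?thesis
    proof (cases "k \<le> card {i\<in>I. bad (h D) (D (i, True))}")
      case True
      then have "D \<in> ?E" using s unfolding bad_def by blast
      then have "indicator ?E D = (1::ennreal)" by (rule indicator_eq_1_iff[THEN iffD2])
      moreover have "(of_nat (card {i\<in>I. bad (h D) (D (i, True))}) :: ennreal) \<le> of_nat ?n"
        using I by (intro of_nat_mono card_mono) auto
      ultimately show ?thesis unfolding eq by (simp add: add_increasing)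
    next
      case False
      then have "(of_nat (card {i\<in>I. bad (h D) (D (i, True))}) :: ennreal) \<le> of_nat k"
        by (intro of_nat_mono) simp
      then show ?thesis unfolding eq by (rule add_increasing2[rotated]) simp
    qed
  qed
  have "of_nat ?n * ?L = (\<Sum>i\<in>I. ?L)" by simp
  also have "\<dots> = (\<integral>\<^sup>+D. (\<Sum>i\<in>I. indicator {D. bad (h D) (D (i, True))} D) \<partial>measure_pmf ?P)"
    using L by (simp add: nn_integral_sum)
  also have "\<dots> \<le> (\<integral>\<^sup>+D. of_nat k + of_nat ?n * (indicator ?E D) \<partial>measure_pmf ?P)"
    by (rule nn_integral_mono_AE, rule AE_pmfI, rule cnt)
  also have "\<dots> = of_nat k + of_nat ?n * emeasure (measure_pmf ?P) ?E"
    by (subst nn_integral_add) (auto simp: nn_integral_cmult)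
  also have "emeasure (measure_pmf ?P) ?E \<le> ennreal (N / 2 ^ k)"
    unfolding measure_pmf.emeasure_eq_measure
    by (intro ennreal_leI coarse_double_sample[OF I(1) p cover])
  finally have *: "of_nat ?n * ?L \<le> of_nat k + of_nat ?n * ennreal (N / 2 ^ k)"
    by (meson add_left_mono mult_left_mono order.trans zero_le)
  \<comment> \<open>N is nonnegative because it bounds the size of an actual cover; the support of p
    supplies the points of X for it.\<close>
  obtain U :: "'i \<times> bool \<Rightarrow> 'x" where "U ` (I \<times> UNIV) \<subseteq> X"
    using p set_pmf_not_empty[of p] by (metis image_subsetI subsetD all_not_in_conv)
  then have N: "N \<ge> 0" using cover[of U] by (meson of_nat_0_le_iff order.trans)
  have "of_nat k + of_nat ?n * ennreal (N / 2 ^ k) = of_nat ?n * ennreal (k / ?n + N / 2 ^ k)"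
    using n N by (simp add: ennreal_of_nat_eq_real_of_nat flip: ennreal_mult ennreal_plus)
      (simp add: field_simps)
  then have "of_nat ?n * ?L \<le> of_nat ?n * ennreal (k / ?n + N / 2 ^ k)" using * by simp
  then have "?L \<le> ennreal (k / ?n + N / 2 ^ k)"
    using n by (subst (asm) ennreal_mult_le_mult_iff) auto
  then show ?thesis unfolding bad_def .
qed

section \<open>Lists of candidates from fat-shattering bounds\<close>

lemma gap_imp_pair_shatters:
  assumes "gap_shatters V G \<theta> S"
  shows "pair_shatters V G (S \<times> {\<theta>})"
  unfolding pair_shatters_def
proof (intro allI impI)
  fix T assume T: "T \<subseteq> S \<times> {\<theta>}"
  then have "fst ` T \<subseteq> S" by auto
  then obtain u where u: "u \<in> V" "\<forall>i\<in>fst ` T. u i \<ge> \<theta> + G" "\<forall>i\<in>S - fst ` T. u i \<le> \<theta> - G"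
    using assms[unfolded gap_shatters_def, rule_format, of "fst ` T"] by blast
  have 1: "\<forall>(i, \<theta>)\<in>T. u i \<ge> \<theta> + G"
  proof clarify
    fix i \<theta>' assume "(i, \<theta>') \<in> T"
    then have "\<theta>' = \<theta>" "i \<in> fst ` T" using T by (auto intro: rev_image_eqI)
    then show "\<theta>' + G \<le> u i" using u(2) by blast
  qed
  have 2: "\<forall>(i, \<theta>)\<in>S \<times> {\<theta>} - T. u i \<le> \<theta> - G"
  proof clarify
    fix i assume "i \<in> S" "(i, \<theta>) \<notin> T"
    then have "i \<in> S - fst ` T" using T by auto
    then show "u i \<le> \<theta> - G" using u(3) by blast
  qed
  show "\<exists>u\<in>V. (\<forall>(i, \<theta>)\<in>T. u i \<ge> \<theta> + G) \<and> (\<forall>(i, \<theta>)\<in>S \<times> {\<theta>} - T. u i \<le> \<theta> - G)"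
    by (rule bexI[of _ u], rule conjI[OF 1 2], rule u(1))
qed

text \<open>Up to clipping, a label k stands for values in [lo + \<tau> k, lo + \<tau> (k + 1)).
  Labels at least \<theta> + G and at most \<theta> - G are therefore separated by \<tau> (2 G - 1),
  and the midpoint lo + \<tau> (\<theta> + 1/2) leaves the margin \<tau> (G - 1/2) on each
  side.\<close>

lemma pair_shatters_imp_fatly_shatters:
  assumes A: "A \<subseteq> I \<times> {0..B}" and W: "W ` I \<subseteq> X" and F: "F \<subseteq> X \<rightarrow> {0..1}"
    and G: "G \<ge> 1" and \<tau>: "\<tau> > 0" and \<gamma>: "0 < \<gamma>" "\<gamma> \<le> \<tau> * (G - 1/2)"
    and sh: "pair_shatters (labels lo \<tau> B I W ` F) G A" and xs: "distinct xs" "set xs = A"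
  shows "fatly_shatters X F \<gamma> (map (\<lambda>(i, \<theta>). (W i, lo (W i) + \<tau> * (real_of_int \<theta> + 1/2))) xs)"
proof -
  define r where "r i \<theta> = lo (W i) + \<tau> * (real_of_int \<theta> + 1/2)" for i \<theta>
  have pat: "\<exists>f\<in>F. (\<forall>(i, \<theta>)\<in>T. f (W i) \<ge> r i \<theta> + \<gamma>) \<and> (\<forall>(i, \<theta>)\<in>A - T. f (W i) \<le> r i \<theta> - \<gamma>)"
    if T: "T \<subseteq> A" for T
  proof -
    obtain f where f: "f \<in> F" "\<forall>(i, \<theta>)\<in>T. labels lo \<tau> B I W f i \<ge> \<theta> + G"
      "\<forall>(i, \<theta>)\<in>A - T. labels lo \<tau> B I W f i \<le> \<theta> - G"
      using sh T unfolding pair_shatters_def by blast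
    have "f (W i) \<ge> r i \<theta> + \<gamma>" if it: "(i, \<theta>) \<in> T" for i \<theta>
    proof -
      have i: "i \<in> I" "0 \<le> \<theta>" using it T A by auto
      have "labels lo \<tau> B I W f i \<ge> \<theta> + G" using f(2) it by auto
      \<comment> \<open>The clip at 0 is below \<theta> + G and, in the dual case, the clip at B is
        above \<theta> - G, so the inequality holds for the unclipped value.\<close>
      then have "\<lfloor>(f (W i) - lo (W i)) / \<tau>\<rfloor> \<ge> \<theta> + G"
        using i G by (auto simp: labels_def quantise_def)
      then have "(f (W i) - lo (W i)) / \<tau> \<ge> \<theta> + G" by (simp add: le_floor_iff)
      then have "f (W i) - lo (W i) \<ge> (\<theta> + G) * \<tau>" using \<tau> by (simp add: pos_le_divide_eq)
      then show ?thesis using \<gamma> by (simp add: r_def algebra_simps)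
    qed
    moreover have "f (W i) \<le> r i \<theta> - \<gamma>" if it: "(i, \<theta>) \<in> A - T" for i \<theta>
    proof -
      have i: "i \<in> I" "\<theta> \<le> B" using it A by auto
      have "labels lo \<tau> B I W f i \<le> \<theta> - G" using f(3) it by auto
      then have "\<lfloor>(f (W i) - lo (W i)) / \<tau>\<rfloor> \<le> \<theta> - G"
        using i G by (auto simp: labels_def quantise_def)
      then have "(f (W i) - lo (W i)) / \<tau> < \<theta> - G + 1" by (simp add: floor_le_iff)
      then have "f (W i) - lo (W i) < (\<theta> - G + 1) * \<tau>" using \<tau> by (simp add: pos_divide_less_eq)
      then show ?thesis using \<gamma> by (simp add: r_def algebra_simps)
    qed
    ultimately show ?thesis using f(1) by (intro bexI[of _ f]) auto
  qed
  have FX: "f x \<in> {0..1}" if "f \<in> F" "x \<in> X" for f x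
    using funcset_mem[OF subsetD[OF F that(1)] that(2)] .
  \<comment> \<open>The threshold lies between two values of members of F, hence in [0,1]; the
    patterns \<open>A\<close> and \<open>{}\<close> supply them.\<close>
  have r01: "(W i, r i \<theta>) \<in> X \<times> {0..1}" if it: "(i, \<theta>) \<in> A" for i \<theta>
  proof -
    have i: "W i \<in> X" using it A W by auto
    obtain f where "f \<in> F" "f (W i) \<ge> r i \<theta> + \<gamma>" using pat[of A] it by auto
    moreover obtain f' where "f' \<in> F" "f' (W i) \<le> r i \<theta> - \<gamma>" using pat[of "{}"] it by auto
    ultimately show ?thesis using FX[of f "W i"] FX[of f' "W i"] i \<gamma>(1) by auto
  qed
  define ys where "ys = map (\<lambda>(i, \<theta>). (W i, r i \<theta>)) xs"
  have ys: "set ys \<subseteq> X \<times> {0..1}" using r01 xs by (auto simp: ys_def)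
  have pats: "\<exists>f\<in>F. \<forall>j<length ys. (b ! j \<longrightarrow> f (fst (ys ! j)) \<ge> snd (ys ! j) + \<gamma>) \<and>
      (\<not> b ! j \<longrightarrow> f (fst (ys ! j)) \<le> snd (ys ! j) - \<gamma>)" for b :: "bool list"
  proof -
    define T where "T = {xs ! j | j. j < length xs \<and> b ! j}"
    have "T \<subseteq> A" using xs by (auto simp: T_def)
    then obtain f where f: "f \<in> F" "\<forall>(i, \<theta>)\<in>T. f (W i) \<ge> r i \<theta> + \<gamma>" "\<forall>(i, \<theta>)\<in>A - T. f (W i) \<le> r i \<theta> - \<gamma>"
      using pat[of T] by blast
    have "(b ! j \<longrightarrow> f (fst (ys ! j)) \<ge> snd (ys ! j) + \<gamma>) \<and>
      (\<not> b ! j \<longrightarrow> f (fst (ys ! j)) \<le> snd (ys ! j) - \<gamma>)" if "j < length ys" for j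
    proof -
      have j: "j < length xs" using that by (simp add: ys_def)
      obtain i \<theta> where it: "xs ! j = (i, \<theta>)" by (cases "xs ! j")
      have T: "b ! j \<longleftrightarrow> xs ! j \<in> T"
        using j xs(1) by (auto simp: T_def nth_eq_iff_index_eq)
      have "xs ! j \<in> A" using j xs(2) nth_mem by blast
      then show ?thesis
        using j it f(2,3) T by (cases "b ! j") (auto simp: ys_def)
    qed
    then show ?thesis using f(1) by blast
  qed
  have "fatly_shatters X F \<gamma> ys"
    unfolding fatly_shatters_def using ys pats by blast
  then show ?thesis by (simp add: ys_def r_def)
qed

lemma fat_pair_shatters:
  assumes "A \<subseteq> I \<times> {0..B}" "W ` I \<subseteq> X" "F \<subseteq> X \<rightarrow> {0..1}" and I: "finite I"
    and "G \<ge> 1" "\<tau> > 0" "0 < \<gamma>" "\<gamma> \<le> \<tau> * (G - 1/2)"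
    and "pair_shatters (labels lo \<tau> B I W ` F) G A" and fat: "fat X F \<gamma> \<le> enat d"
  shows "card A \<le> d"
proof -
  have "finite A" using assms(1) I by (auto intro: finite_subset)
  then obtain xs where xs: "distinct xs" "set xs = A" using finite_distinct_list by blast
  have "fatly_shatters X F \<gamma> (map (\<lambda>(i, \<theta>). (W i, lo (W i) + \<tau> * (real_of_int \<theta> + 1/2))) xs)"
    by (rule pair_shatters_imp_fatly_shatters[OF assms(1-3) assms(5-9) xs])
  then have "enat (length (map (\<lambda>(i, \<theta>). (W i, lo (W i) + \<tau> * (real_of_int \<theta> + 1/2))) xs)) \<le> fat X F \<gamma>"
    unfolding fat_def by (intro Sup_upper) blast
  then have "enat (length xs) \<le> fat X F \<gamma>" by simp
  then have "enat (length xs) \<le> enat d" using fat by (rule order.trans)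
  then show ?thesis using xs distinct_card by fastforce
qed

text \<open>Since \<open>fat\<close> lets every point have its own threshold, the base
  \<open>lo\<close> is arbitrary here. The refinement around a coarse representative relies on
  this.\<close>

lemma gap_dim_le_fat:
  assumes "F \<subseteq> X \<rightarrow> {0..1}" "finite I" "G \<ge> 1" "\<tau> > 0" "0 < \<gamma>" "\<gamma> \<le> \<tau> * (G - 1/2)" "fat X F \<gamma> \<le> enat d"
  shows "gap_dim_le X F lo \<tau> B G d I"
  unfolding gap_dim_le_def
proof (intro allI impI)
  fix W :: "'b \<Rightarrow> 'a" and \<theta> :: int and S
  assume a: "W ` I \<subseteq> X" "1 \<le> \<theta>" "\<theta> \<le> B" "S \<subseteq> I" "gap_shatters (labels lo \<tau> B I W ` F) G \<theta> S"
  have "card (S \<times> {\<theta>}) \<le> d"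
    by (rule fat_pair_shatters[OF _ a(1) assms(1-6) gap_imp_pair_shatters[OF a(5)] assms(7)]) (use a in auto)
  then show "card S \<le> d" by (simp add: card_cartesian_product)
qed

text \<open>A common integer threshold becomes a common real threshold when the base is constant,
  which is why \<open>lo\<close> is 0 here.\<close>

lemma gap_dim_le_fatV:
  assumes F: "F \<subseteq> X \<rightarrow> {0..1}" and I: "finite I"
    and G: "G \<ge> 1" "\<tau> > 0" "0 < \<gamma>" "\<gamma> \<le> \<tau> * (G - 1/2)" and fat: "fatV X F \<gamma> \<le> enat d"
  shows "gap_dim_le X F (\<lambda>_. 0) \<tau> B G d I"
  unfolding gap_dim_le_def
proof (intro allI impI)
  fix W :: "'b \<Rightarrow> 'a" and \<theta> :: int and S
  assume a: "W ` I \<subseteq> X" "1 \<le> \<theta>" "\<theta> \<le> B" "S \<subseteq> I" "gap_shatters (labels (\<lambda>_. 0) \<tau> B I W ` F) G \<theta> S"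
  show "card S \<le> d"
  proof (cases "S = {}")
    case False
    have "finite S" using a(4) I by (rule finite_subset)
    then obtain xs where xs: "distinct xs" "set xs = S" using finite_distinct_list by blast
    define r where "r = \<tau> * (real_of_int \<theta> + 1/2)"
    have "fatly_shatters X F \<gamma> (map (\<lambda>(i, \<theta>). (W i, 0 + \<tau> * (real_of_int \<theta> + 1/2))) (map (\<lambda>i. (i, \<theta>)) xs))"
      by (rule pair_shatters_imp_fatly_shatters[OF _ a(1) F G gap_imp_pair_shatters[OF a(5)]])
         (use a xs in \<open>auto simp: distinct_map inj_on_def\<close>)
    then have sh: "fatly_shatters X F \<gamma> (map (\<lambda>x. (x, r)) (map W xs))"
      by (simp add: o_def r_def)
    moreover have "r \<in> {0..1}"
    proof -
      obtain i where "i \<in> set xs" using False xs by blast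
      then have "(W i, r) \<in> set (map (\<lambda>x. (x, r)) (map W xs))" by auto
      then show ?thesis using sh unfolding fatly_shatters_def by blast
    qed
    ultimately have "enat (length (map W xs)) \<le> fatV X F \<gamma>"
      unfolding fatV_def by (intro Sup_upper) blast
    then have "enat (length xs) \<le> fatV X F \<gamma>" by simp
    then have "enat (length xs) \<le> enat d" using fat by (rule order.trans)
    then show ?thesis using xs distinct_card by fastforce
  qed simp
qed

text \<open>p and f are fixed before the sample is drawn, so the best candidate need only be good on
  average for each f, and no supremum over F enters. \<open>cands\<close> sees points without
  labels, so the labels drawn from P matter only at validation.\<close>

definition list_learner :: "'x set \<Rightarrow> ('x \<Rightarrow> real) set \<Rightarrow> nat \<Rightarrow> real \<Rightarrow> real
    \<Rightarrow> ((nat \<Rightarrow> 'x) \<Rightarrow> ('x \<Rightarrow> real) set) \<Rightarrow> bool" where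
  "list_learner X F n N e cands \<longleftrightarrow>
     (\<forall>W. finite (cands W) \<and> real (card (cands W)) \<le> N \<and> (\<forall>h\<in>cands W. \<forall>x. h x \<in> {0..1})) \<and>
     (\<forall>p f. set_pmf p \<subseteq> X \<longrightarrow> f \<in> F \<longrightarrow>
        (\<integral>\<^sup>+W. (INF h\<in>cands W. \<integral>\<^sup>+x. ennreal \<bar>h x - f x\<bar> \<partial>measure_pmf p)
           \<partial>measure_pmf (Pi_pmf {..<n} undefined (\<lambda>_. p))) \<le> ennreal e)"

lemma refine_cands_error:
  assumes I: "finite I" "I \<noteq> {}" and GB: "G \<ge> 1" "B \<ge> 0" and \<tau>: "\<tau> > 0"
    and vc: "gap_dim_le X F lo \<tau> B G d I" and F: "F \<subseteq> X \<rightarrow> {0..1}" and p: "set_pmf p \<subseteq> X" and f: "f \<in> F"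
  shows "(\<integral>\<^sup>+W. (INF h\<in>refine_cands F lo \<tau> B G d I W. \<integral>\<^sup>+x. ennreal \<bar>h x - f x\<bar> \<partial>measure_pmf p)
      \<partial>measure_pmf (Pi_pmf I dflt (\<lambda>_. p)))
    \<le> ennreal (\<tau> * (real_of_int G + 1 + 2 * real d * real_of_int B / real (card I))) + emeasure (measure_pmf p) {x. \<not> (lo x \<le> f x \<and> f x < lo x + \<tau> * (B + 1))}"
proof -
  obtain s where s: "s \<in> I"
    "(\<integral>\<^sup>+W. (\<integral>\<^sup>+x. ennreal \<bar>refine_fun F lo \<tau> B G d I W s ((labels lo \<tau> B I W f)(s := 0)) x - f x\<bar> \<partial>measure_pmf p)
      \<partial>measure_pmf (Pi_pmf I dflt (\<lambda>_. p)))
    \<le> ennreal (\<tau> * (real_of_int G + 1 + 2 * real d * real_of_int B / real (card I))) + emeasure (measure_pmf p) {x. \<not> (lo x \<le> f x \<and> f x < lo x + \<tau> * (B + 1))}"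
    using refine_error[OF assms] by blast
  have mem: "refine_fun F lo \<tau> B G d I W s ((labels lo \<tau> B I W f)(s := 0)) \<in> refine_cands F lo \<tau> B G d I W" for W
  proof -
    have "(labels lo \<tau> B I W f)(s := 0) \<in> PiE_dflt I 0 (\<lambda>_. {0..B})"
      using GB by (auto simp: PiE_dflt_def labels_def quantise_def)
    then show ?thesis unfolding refine_cands_def using s(1) by force
  qed
  show ?thesis
    by (rule order.trans[OF _ s(2)], rule nn_integral_mono, rule INF_lower, rule mem)
qed

text \<open>With base 0 and \<tau> (B + 1) > 1 the window contains all of [0,1], and the error term
  for leaving it vanishes.\<close>

lemma refine_list_learner:
  assumes n: "n > 0" and GB: "G \<ge> 1" "B \<ge> 0" and \<tau>: "\<tau> > 0" "1 < \<tau> * (B + 1)"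
    and vc: "gap_dim_le X F (\<lambda>_. 0) \<tau> B G d {..<n}" and F: "F \<subseteq> X \<rightarrow> {0..1}"
  shows "list_learner X F n (real n * (real_of_int B + 1) ^ n) (\<tau> * (real_of_int G + 1 + 2 * real d * real_of_int B / real n))
    (refine_cands F (\<lambda>_. 0) \<tau> B G d {..<n})"
  unfolding list_learner_def
proof (intro conjI allI impI)
  fix W
  show "finite (refine_cands F (\<lambda>_. 0) \<tau> B G d {..<n} W)"
    using GB by (intro refine_cands_finite) auto
  have "real (card (refine_cands F (\<lambda>_. 0) \<tau> B G d {..<n} W)) \<le> real (n * nat (B + 1) ^ n)"
    using refine_cands_finite(2)[of "{..<n}" B F "\<lambda>_. 0" \<tau> G d W] GB by (intro of_nat_mono) simp
  also have "\<dots> = real n * (real_of_int B + 1) ^ n" using GB by simp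
  finally show "real (card (refine_cands F (\<lambda>_. 0) \<tau> B G d {..<n} W)) \<le> real n * (real_of_int B + 1) ^ n" .
  show "\<forall>h\<in>refine_cands F (\<lambda>_. 0) \<tau> B G d {..<n} W. \<forall>x. h x \<in> {0..1}"
    by (intro ballI allI refine_cands_range)
next
  fix p f assume p: "set_pmf p \<subseteq> X" and f: "f \<in> F"
  let ?O = "{x. \<not> (0 \<le> f x \<and> f x < 0 + \<tau> * (real_of_int B + 1))}"
  have "x \<notin> ?O" if "x \<in> set_pmf p" for x
  proof -
    have "f x \<in> {0..1}" by (rule funcset_mem[OF subsetD[OF F f]]) (use that p in blast)
    then show ?thesis using \<tau> by auto
  qed
  then have "emeasure (measure_pmf p) ?O = 0"
    by (subst measure_pmf.emeasure_eq_measure) (simp add: measure_pmf_zero_iff disjoint_iff)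
  then show "(\<integral>\<^sup>+W. (INF h\<in>refine_cands F (\<lambda>_. 0) \<tau> B G d {..<n} W. \<integral>\<^sup>+x. ennreal \<bar>h x - f x\<bar> \<partial>measure_pmf p)
           \<partial>measure_pmf (Pi_pmf {..<n} undefined (\<lambda>_. p))) \<le> ennreal (\<tau> * (real_of_int G + 1 + 2 * real d * real_of_int B / real n))"
    using refine_cands_error[OF _ _ GB \<tau>(1) vc F p f, of undefined] n by auto
qed

text \<open>With m = card J (B + 1), both generating-function variables are set to z = d / m, where
  the numerators are at most exp d. The number of shattered sets is then at most (exp 1 / z)^d \<le>
  2^(d q), so d q mistakes suffice, and the cover has at most (exp 1 / z)^(d q) elements. The two
  nested logarithms are the source of q^2.\<close>

lemma fat_cover:
  fixes J :: "'i set" and D :: "'i \<Rightarrow> 'x"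
  assumes F: "F \<subseteq> X \<rightarrow> {0..1}" and J: "finite J" and B: "B \<ge> 0"
    and G: "G \<ge> 1" "\<tau> > 0" "0 < \<gamma>" "\<gamma> \<le> \<tau> * (G - 1/2)" and fat: "fat X F \<gamma> \<le> enat d"
    and d: "d \<ge> 1" "real d \<le> real (card J) * (B + 1)"
    and q: "exp 1 * (real (card J) * (B + 1)) / d \<le> 2 ^ q" and D: "D ` J \<subseteq> X"
  shows "\<exists>C. finite C \<and> real (card C) \<le> 2 ^ (d * q\<^sup>2) \<and>
    (\<forall>g\<in>quantise (\<lambda>_. 0) \<tau> B ` F. \<exists>c\<in>C. \<forall>j\<in>J. \<bar>g (D j) - c j\<bar> \<le> G)"
proof -
  define m where "m = real (card J) * (B + 1)"
  define z where "z = real d / m"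
  define V where "V = labels (\<lambda>_. 0) \<tau> B J D ` F"
  have m: "m > 0" "real d \<le> m" using d by (auto simp: m_def)
  have z: "0 < z" "z \<le> 1" using d m by (auto simp: z_def)
  have cJ: "card J > 0" using m B by (auto simp: m_def zero_less_mult_iff)
  have ez: "exp 1 / z \<le> 2 ^ q" using q d by (simp add: z_def m_def)
  have q1: "q \<ge> 1"
  proof (rule ccontr)
    assume "\<not> q \<ge> 1"
    then have "q = 0" by simp
    then have "exp 1 / z \<le> 1" using ez by simp
    moreover have "exp 1 / z \<ge> exp 1" using z by (simp add: field_simps)
    moreover have "exp 1 > (1::real)" by simp
    ultimately show False by linarith
  qed
  have mnat: "real (card J * nat (B + 1)) = m" using B by (simp add: m_def)
  have exp_bd: "(1 + a) ^ n \<le> exp (a * n)" if "a \<ge> 0" for a :: real and n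
  proof -
    have "(1 + a) ^ n \<le> exp a ^ n" using that by (intro power_mono exp_ge_add_one_self) auto
    then show ?thesis by (simp add: exp_of_nat_mult[symmetric] mult.commute)
  qed
  have "real (card (shattered_pairs V G B J)) \<le> (1 + z) ^ (card J * nat (B + 1)) / z ^ d"
  proof (rule card_shattered_pairs_le[OF J B z])
    fix A assume A: "A \<subseteq> J \<times> {0..B}" "pair_shatters V G A"
    show "card A \<le> d"
      by (rule fat_pair_shatters[OF A(1) D F J G A(2)[unfolded V_def] fat])
  qed
  also have "\<dots> \<le> exp (z * (card J * nat (B + 1))) / z ^ d"
    using z by (intro divide_right_mono exp_bd) auto
  also have "exp (z * (card J * nat (B + 1))) = exp 1 ^ d"
    unfolding mnat using m by (simp add: z_def flip: exp_of_nat_mult)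
  also have "exp 1 ^ d / z ^ d = (exp 1 / z) ^ d" by (simp add: power_divide)
  also have "\<dots> \<le> (2 ^ q) ^ d" using z ez by (intro power_mono) auto
  also have "\<dots> < real (2 ^ (d * q + 1))" by (simp add: power_mult[symmetric] mult.commute)
  finally have lt: "card (shattered_pairs V G B J) < 2 ^ (d * q + 1)" by (simp only: of_nat_less_iff)
  have range: "0 \<le> u i \<and> u i \<le> B" if "u \<in> V" "i \<in> J" for u i
    using that B by (auto simp: V_def labels_def quantise_def)
  have "\<exists>C. finite C \<and> real (card C) \<le> (1 + z * (B + 1)) ^ card J / z ^ (d * q) \<and>
    (\<forall>u\<in>V. \<exists>c\<in>C. \<forall>i\<in>J. \<bar>u i - c i\<bar> \<le> G)"
    by (rule halving_cover[OF J _ G(1) B lt z]) (rule range)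
  then obtain C where C: "finite C" "real (card C) \<le> (1 + z * (B + 1)) ^ card J / z ^ (d * q)"
    "\<forall>u\<in>V. \<exists>c\<in>C. \<forall>i\<in>J. \<bar>u i - c i\<bar> \<le> G"
    by blast
  have "(1 + z * (B + 1)) ^ card J / z ^ (d * q) \<le> exp (z * (B + 1) * card J) / z ^ (d * q)"
    using z B by (intro divide_right_mono exp_bd) auto
  also have "z * (B + 1) * card J = z * m" by (simp add: m_def)
  also have "exp (z * m) = exp 1 ^ d" using m by (simp add: z_def flip: exp_of_nat_mult)
  \<comment> \<open>q \<ge> 1 allows the exponent d to be raised to d q, which merges numerator and
    denominator into one power.\<close>
  also have "exp 1 ^ d / z ^ (d * q) \<le> exp 1 ^ (d * q) / z ^ (d * q)"
    using z q1 by (intro divide_right_mono power_increasing) auto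
  also have "\<dots> = (exp 1 / z) ^ (d * q)" by (simp add: power_divide)
  also have "\<dots> \<le> (2 ^ q) ^ (d * q)" using z ez by (intro power_mono) auto
  also have "\<dots> = 2 ^ (d * q\<^sup>2)" by (simp add: power2_eq_square mult_ac flip: power_mult)
  finally have "real (card C) \<le> 2 ^ (d * q\<^sup>2)" using C(2) by linarith
  moreover have "\<forall>g\<in>quantise (\<lambda>_. 0) \<tau> B ` F. \<exists>c\<in>C. \<forall>j\<in>J. \<bar>g (D j) - c j\<bar> \<le> G"
  proof
    fix g assume "g \<in> quantise (\<lambda>_. 0) \<tau> B ` F"
    then obtain f where f: "f \<in> F" "g = quantise (\<lambda>_. 0) \<tau> B f" by blast
    then obtain c where "c \<in> C" "\<forall>i\<in>J. \<bar>labels (\<lambda>_. 0) \<tau> B J D f i - c i\<bar> \<le> G"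
      using C(3) unfolding V_def by blast
    then show "\<exists>c\<in>C. \<forall>j\<in>J. \<bar>g (D j) - c j\<bar> \<le> G"
      using f by (intro bexI[of _ c]) (auto simp: labels_def)
  qed
  ultimately show ?thesis using C(1) by blast
qed

text \<open>Cover elements are arbitrary functions of the position. Replacing each one by some
  member of F in its ball doubles the radius from G to 2 G, and gives functions that can be
  evaluated off the sample.\<close>

lemma cover_representatives:
  fixes Q :: "('x \<Rightarrow> real) \<Rightarrow> 'x \<Rightarrow> int"
  assumes cover: "\<And>D :: 'i \<times> bool \<Rightarrow> 'x. D ` (I \<times> UNIV) \<subseteq> X \<Longrightarrow>
      \<exists>C. finite C \<and> real (card C) \<le> N \<and> (\<forall>g\<in>Q ` F. \<exists>c\<in>C. \<forall>j\<in>I \<times> UNIV. \<bar>g (D j) - c j\<bar> \<le> G)"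
    and N: "N \<ge> 0"
  shows "\<exists>R. finite R \<and> R \<subseteq> F \<and> real (card R) \<le> N \<and>
    (U ` I \<subseteq> X \<longrightarrow> (\<forall>f\<in>F. \<exists>g\<in>R. \<forall>i\<in>I. \<bar>Q g (U i) - Q f (U i)\<bar> \<le> 2 * G))"
proof (cases "U ` I \<subseteq> X")
  case True
  \<comment> \<open>Each sample point occupies both halves of the doubled index set, so the cover
    for double samples also serves the single sample.\<close>
  define D where "D j = U (fst j)" for j :: "'i \<times> bool"
  have "D ` (I \<times> UNIV) \<subseteq> X" using True by (auto simp: D_def)
  from cover[OF this] obtain C where C: "finite C" "real (card C) \<le> N"
    "\<forall>g\<in>Q ` F. \<exists>c\<in>C. \<forall>j\<in>I \<times> UNIV. \<bar>g (D j) - c j\<bar> \<le> G" by blast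
  define P where "P c g \<longleftrightarrow> g \<in> F \<and> (\<forall>j\<in>I \<times> UNIV. \<bar>Q g (D j) - c j\<bar> \<le> G)" for c g
  define C' where "C' = {c\<in>C. \<exists>g. P c g}"
  have rep: "P c (SOME g. P c g)" if "c \<in> C'" for c
    using someI_ex[of "P c"] that by (simp add: C'_def)
  have "finite ((\<lambda>c. SOME g. P c g) ` C')" using C(1) by (simp add: C'_def)
  moreover have "(\<lambda>c. SOME g. P c g) ` C' \<subseteq> F" using rep by (auto simp: P_def)
  moreover have "real (card ((\<lambda>c. SOME g. P c g) ` C')) \<le> N"
  proof -
    have "card ((\<lambda>c. SOME g. P c g) ` C') \<le> card C'"
      using C(1) by (intro card_image_le) (simp add: C'_def)
    also have "\<dots> \<le> card C" using C(1) by (intro card_mono) (auto simp: C'_def)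
    finally show ?thesis using C(2) by linarith
  qed
  moreover have "\<exists>g\<in>(\<lambda>c. SOME g. P c g) ` C'. \<forall>i\<in>I. \<bar>Q g (U i) - Q f (U i)\<bar> \<le> 2 * G" if f: "f \<in> F" for f
  proof -
    obtain c where c: "c \<in> C" "\<forall>j\<in>I \<times> UNIV. \<bar>Q f (D j) - c j\<bar> \<le> G" using C(3) f by blast
    then have c': "c \<in> C'" using f by (auto simp: C'_def P_def)
    have "\<bar>Q (SOME g. P c g) (U i) - Q f (U i)\<bar> \<le> 2 * G" if i: "i \<in> I" for i
    proof -
      have "\<bar>Q (SOME g. P c g) (D (i, True)) - c (i, True)\<bar> \<le> G" "\<bar>Q f (D (i, True)) - c (i, True)\<bar> \<le> G"
        using rep[OF c'] c(2) i unfolding P_def by blast+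
      then show ?thesis by (simp add: D_def)
    qed
    then show ?thesis using c' by blast
  qed
  ultimately show ?thesis by (intro exI[of _ "(\<lambda>c. SOME g. P c g) ` C'"] conjI impI ballI)
next
  case False
  then show ?thesis using N by (intro exI[of _ "{}"]) auto
qed

text \<open>The first n1 points fix the representatives; the next n2 points, independent of them,
  drive one refinement per representative. The list length is bounded by the product of both counts.
  The error adds the refinement loss around the good representative and the mass where that one is
  off by more than 4 G levels.\<close>

lemma coarse_refine_list_learner:
  fixes n1 n2 k q d :: nat
  assumes F: "F \<subseteq> X \<rightarrow> {0..1}" and G: "G \<ge> 1" and \<tau>: "\<tau> > 0"
    and B: "B \<ge> 0" "1 < \<tau> * (B + 1)" and n: "n1 > 0" "n2 > 0" and N: "N \<ge> 0"
    and vc: "\<And>lo B. gap_dim_le X F lo \<tau> B G d {n1..<n1 + n2}"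
    and cover: "\<And>D :: nat \<times> bool \<Rightarrow> 'x. D ` ({..<n1} \<times> UNIV) \<subseteq> X \<Longrightarrow>
      \<exists>C. finite C \<and> real (card C) \<le> N \<and>
        (\<forall>g\<in>quantise (\<lambda>_. 0) \<tau> B ` F. \<exists>c\<in>C. \<forall>j\<in>{..<n1} \<times> UNIV. \<bar>g (D j) - c j\<bar> \<le> G)"
  shows "\<exists>cands. list_learner X F (n1 + n2) (N * (real n2 * (8 * real_of_int G + 2) ^ n2))
    (\<tau> * (real_of_int G + 1 + 2 * real d * (8 * real_of_int G + 1) / real n2) + (real k / real n1 + N / 2 ^ k)) cands"
proof -
  let ?Q = "quantise (\<lambda>_. 0) \<tau> B"
  let ?I = "{n1..<n1 + n2}"
  let ?c = "\<tau> * (real_of_int G + 1 + 2 * real d * (8 * real_of_int G + 1) / real n2)"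
  \<comment> \<open>Rounded values that differ by at most 4 G belong to values that differ by less
    than \<tau> (4 G + 1). The window starts that far below g and reaches as far above it, which
    makes 8 G + 2 levels, numbered up to 8 G + 1.\<close>
  define lo where "lo g x = g x - \<tau> * (4 * real_of_int G + 1)" for g :: "'x \<Rightarrow> real" and x
  define good where "good U R \<longleftrightarrow> finite R \<and> R \<subseteq> F \<and> real (card R) \<le> N \<and>
    (U ` {..<n1} \<subseteq> X \<longrightarrow> (\<forall>f\<in>F. \<exists>g\<in>R. \<forall>i\<in>{..<n1}. \<bar>?Q g (U i) - ?Q f (U i)\<bar> \<le> 2 * G))" for U R
  have "\<forall>U. \<exists>R. good U R"
    unfolding good_def by (intro allI cover_representatives cover N)
  from choice[OF this] obtain R where "\<forall>U. good U (R U)" by (rule exE)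
  then have good: "good U (R U)" for U by (rule spec)
  have R: "finite (R U)" "R U \<subseteq> F" "real (card (R U)) \<le> N" for U
    using good[of U] unfolding good_def by auto
  have R4: "\<exists>g\<in>R U. \<forall>i\<in>{..<n1}. \<bar>?Q g (U i) - ?Q f (U i)\<bar> \<le> 2 * G"
    if "U ` {..<n1} \<subseteq> X" "f \<in> F" for U f
    using good[of U] that unfolding good_def by simp
  define rc where "rc g = refine_cands F (lo g) \<tau> (8 * G + 1) G d ?I" for g
  define r1 where "r1 W = (\<lambda>i. if i < n1 then W i else undefined)" for W :: "nat \<Rightarrow> 'x"
  define r2 where "r2 W = (\<lambda>i. if i \<in> ?I then W i else undefined)" for W :: "nat \<Rightarrow> 'x"
  define cands where "cands W = (\<Union>g\<in>R (r1 W). rc g (r2 W))" for W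
  have GB: "8 * G + 1 \<ge> 0" using G by simp
  have fin: "finite (rc g V)" and card: "real (card (rc g V)) \<le> real n2 * (8 * real_of_int G + 2) ^ n2" for g V
  proof -
    show "finite (rc g V)" unfolding rc_def using GB by (intro refine_cands_finite) auto
    have "card (rc g V) \<le> n2 * nat (8 * G + 1 + 1) ^ n2"
      using refine_cands_finite(2)[of ?I "8 * G + 1" F "lo g" \<tau> G d V] GB by (simp add: rc_def)
    then have "real (card (rc g V)) \<le> real (n2 * nat (8 * G + 1 + 1) ^ n2)" by (rule of_nat_mono)
    also have "\<dots> = real n2 * (8 * real_of_int G + 2) ^ n2" using G by (simp add: add.commute)
    finally show "real (card (rc g V)) \<le> real n2 * (8 * real_of_int G + 2) ^ n2" .
  qed
  have "list_learner X F (n1 + n2) (N * (real n2 * (8 * real_of_int G + 2) ^ n2)) (?c + (real k / real n1 + N / 2 ^ k)) cands"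
    unfolding list_learner_def
  proof (intro conjI allI impI)
    fix W
    show "finite (cands W)" unfolding cands_def using R(1) fin by blast
    have "card (cands W) \<le> (\<Sum>g\<in>R (r1 W). card (rc g (r2 W)))"
      unfolding cands_def by (rule card_UN_le[OF R(1)])
    then have "real (card (cands W)) \<le> (\<Sum>g\<in>R (r1 W). real (card (rc g (r2 W))))"
      by (metis of_nat_le_iff of_nat_sum)
    also have "\<dots> \<le> (\<Sum>g\<in>R (r1 W). real n2 * (8 * real_of_int G + 2) ^ n2)"
      by (rule sum_mono, rule card)
    also have "\<dots> = real (card (R (r1 W))) * (real n2 * (8 * real_of_int G + 2) ^ n2)" by simp
    also have "\<dots> \<le> N * (real n2 * (8 * real_of_int G + 2) ^ n2)"
      using R(3) G by (intro mult_right_mono) auto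
    finally show "real (card (cands W)) \<le> N * (real n2 * (8 * real_of_int G + 2) ^ n2)" .
    show "\<forall>h\<in>cands W. \<forall>x. h x \<in> {0..1}"
    proof (intro ballI allI)
      fix h x assume "h \<in> cands W"
      then obtain g where "h \<in> rc g (r2 W)" unfolding cands_def by blast
      then show "h x \<in> {0..1}" unfolding rc_def by (rule refine_cands_range)
    qed
  next
    fix p f assume p: "set_pmf p \<subseteq> X" and f: "f \<in> F"
    define err where "err h = (\<integral>\<^sup>+x. ennreal \<bar>h x - f x\<bar> \<partial>measure_pmf p)" for h
    define P1 where "P1 = Pi_pmf {..<n1} undefined (\<lambda>_. p)"
    define P2 where "P2 = Pi_pmf ?I undefined (\<lambda>_. p)"
    define sel where "sel U g \<longleftrightarrow> g \<in> R U \<and> (\<forall>i\<in>{..<n1}. \<bar>?Q g (U i) - ?Q f (U i)\<bar> \<le> 2 * G)" for U g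
    \<comment> \<open>This choice depends on f and serves only the analysis; the list contains the
      refinements of all representatives.\<close>
    define g where "g U = (SOME g. sel U g)" for U
    have "sel U (g U)" if "U ` {..<n1} \<subseteq> X" for U
    proof -
      have "\<exists>g. sel U g" using R4[OF that f] unfolding sel_def by blast
      then show ?thesis unfolding g_def by (rule someI_ex)
    qed
    then have g': "g U \<in> R U \<and> (\<forall>i\<in>{..<n1}. \<bar>?Q (g U) (U i) - ?Q f (U i)\<bar> \<le> 2 * G)"
      if "U ` {..<n1} \<subseteq> X" for U
      using that unfolding sel_def by blast
    have g: "g U \<in> R U" "\<forall>i\<in>{..<n1}. \<bar>?Q (g U) (U i) - ?Q f (U i)\<bar> \<le> 2 * G"
      if "U ` {..<n1} \<subseteq> X" for U
      by (rule conjunct1[OF g'[OF that]], rule conjunct2[OF g'[OF that]])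
    define bad where "bad U = {x. \<bar>?Q (g U) x - ?Q f x\<bar> > 4 * G}" for U
    have FX: "h x \<in> {0..1}" if "h \<in> F" "x \<in> X" for h x
      using funcset_mem[OF subsetD[OF F that(1)] that(2)] .
    have inner: "(\<integral>\<^sup>+V. (INF h\<in>rc (g U) V. err h) \<partial>measure_pmf P2) \<le> ennreal ?c + emeasure (measure_pmf p) (bad U)"
      if U: "U ` {..<n1} \<subseteq> X" for U
    proof -
      let ?O = "{x. \<not> (lo (g U) x \<le> f x \<and> f x < lo (g U) x + \<tau> * (real_of_int (8 * G + 1 + 1)))}"
      have gF: "g U \<in> F" using g(1)[OF U] R(2) by blast
      have O: "x \<in> bad U" if x: "x \<in> X" "x \<in> ?O" for x
      proof (rule ccontr)
        \<comment> \<open>Values of F lie in [0,1] and \<tau> (B + 1) > 1, so the clipping in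
          \<open>quantise\<close> is inactive.\<close>
        have q: "?Q h x = \<lfloor>h x / \<tau>\<rfloor>" if h: "h \<in> F" for h
        proof -
          have h01: "0 \<le> h x" "h x \<le> 1" using FX[OF h x(1)] by auto
          have "0 \<le> h x / \<tau>" using h01 \<tau> by simp
          moreover have "h x / \<tau> < B + 1" using h01 \<tau> B by (simp add: pos_divide_less_eq mult.commute)
          ultimately show ?thesis by (auto simp: quantise_def floor_less_iff) linarith
        qed
        assume "x \<notin> bad U"
        then have "\<bar>\<lfloor>g U x / \<tau>\<rfloor> - \<lfloor>f x / \<tau>\<rfloor>\<bar> \<le> 4 * G" by (simp add: bad_def q[OF gF] q[OF f])
        then have "\<bar>g U x / \<tau> - f x / \<tau>\<bar> < 4 * real_of_int G + 1" by linarith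
        then have "\<bar>(g U x - f x) / \<tau>\<bar> < 4 * real_of_int G + 1" by (simp add: diff_divide_distrib)
        then have "\<bar>g U x - f x\<bar> < (4 * real_of_int G + 1) * \<tau>"
          using \<tau> by (simp add: pos_divide_less_eq)
        then have "x \<notin> ?O" by (auto simp: lo_def algebra_simps abs_less_iff)
        then show False using x(2) by blast
      qed
      have fI: "finite ?I" and neI: "?I \<noteq> {}" using n by auto
      have vc': "gap_dim_le X F (lo (g U)) \<tau> (8 * G + 1) G d ?I" by (rule vc)
      have "(\<integral>\<^sup>+V. (INF h\<in>rc (g U) V. err h) \<partial>measure_pmf P2)
        \<le> ennreal (\<tau> * (real_of_int G + 1 + 2 * real d * real_of_int (8 * G + 1) / real (card ?I))) + emeasure (measure_pmf p) ?O"
        unfolding P2_def err_def rc_def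
        by (rule refine_cands_error[where X = X, OF fI neI G GB \<tau> vc' F p f])
      also have "emeasure (measure_pmf p) ?O \<le> emeasure (measure_pmf p) (bad U)"
        by (rule emeasure_mono_AE, rule AE_pmfI) (use O p in auto)
      finally show ?thesis by simp
    qed
    have U1: "U ` {..<n1} \<subseteq> X" "r1 U = U" if U: "U \<in> set_pmf P1" for U
    proof -
      have "U i \<in> set_pmf p" if "i < n1" for i
        by (rule set_Pi_pmf_const(1)[OF _ U[unfolded P1_def]]) (use that in auto)
      then show "U ` {..<n1} \<subseteq> X" using p by blast
      have "U i = undefined" if "\<not> i < n1" for i
        by (rule set_Pi_pmf_const(2)[OF _ U[unfolded P1_def]]) (use that in auto)
      then show "r1 U = U" by (auto simp: r1_def)
    qed
    have V2: "V i = undefined" if "V \<in> set_pmf P2" "i \<notin> ?I" for V i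
      by (rule set_Pi_pmf_const(2)[OF _ that(1)[unfolded P2_def] that(2)]) simp
    have un: "{..<n1 + n2} = {..<n1} \<union> ?I" by auto
    have "(\<integral>\<^sup>+W. (INF h\<in>cands W. err h) \<partial>measure_pmf (Pi_pmf {..<n1 + n2} undefined (\<lambda>_. p)))
      = (\<integral>\<^sup>+U. (\<integral>\<^sup>+V. (INF h\<in>cands (\<lambda>x. if x < n1 then U x else V x). err h) \<partial>measure_pmf P2) \<partial>measure_pmf P1)"
      unfolding un P1_def P2_def
      by (subst Pi_pmf_union) (auto simp: nn_integral_pair_pmf')
    also have "\<dots> \<le> (\<integral>\<^sup>+U. ennreal ?c + emeasure (measure_pmf p) (bad U) \<partial>measure_pmf P1)"
    proof (rule nn_integral_mono_AE, rule AE_pmfI)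
      fix U assume U: "U \<in> set_pmf P1"
      have "(\<integral>\<^sup>+V. (INF h\<in>cands (\<lambda>x. if x < n1 then U x else V x). err h) \<partial>measure_pmf P2)
        \<le> (\<integral>\<^sup>+V. (INF h\<in>rc (g U) V. err h) \<partial>measure_pmf P2)"
      proof (rule nn_integral_mono_AE, rule AE_pmfI)
        fix V assume V: "V \<in> set_pmf P2"
        let ?W = "\<lambda>x. if x < n1 then U x else V x"
        have "r1 ?W = r1 U" by (auto simp: r1_def)
        then have "r1 ?W = U" using U1(2)[OF U] by simp
        moreover have "r2 ?W = V" using V2[OF V] by (auto simp: r2_def)
        ultimately have "rc (g U) V \<subseteq> cands ?W"
          using g(1)[OF U1(1)[OF U]] unfolding cands_def by auto
        then show "(INF h\<in>cands ?W. err h) \<le> (INF h\<in>rc (g U) V. err h)"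
          by (rule INF_superset_mono) simp
      qed
      also have "\<dots> \<le> ennreal ?c + emeasure (measure_pmf p) (bad U)" by (rule inner[OF U1(1)[OF U]])
      finally show "(\<integral>\<^sup>+V. (INF h\<in>cands (\<lambda>x. if x < n1 then U x else V x). err h) \<partial>measure_pmf P2)
        \<le> ennreal ?c + emeasure (measure_pmf p) (bad U)" .
    qed
    also have "\<dots> = ennreal ?c + (\<integral>\<^sup>+U. emeasure (measure_pmf p) (bad U) \<partial>measure_pmf P1)"
      by (subst nn_integral_add) auto
    finally have 1: "(\<integral>\<^sup>+W. (INF h\<in>cands W. err h) \<partial>measure_pmf (Pi_pmf {..<n1 + n2} undefined (\<lambda>_. p)))
      \<le> ennreal ?c + (\<integral>\<^sup>+U. emeasure (measure_pmf p) (bad U) \<partial>measure_pmf P1)" .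
    have sel: "?Q (g U) \<in> ?Q ` F \<and> (\<forall>i\<in>{..<n1}. \<bar>?Q (g U) (U i) - ?Q f (U i)\<bar> \<le> 2 * G)"
      if "U ` {..<n1} \<subseteq> X" for U
      by (intro conjI imageI) (rule subsetD[OF R(2) conjunct1[OF g'[OF that]]], rule conjunct2[OF g'[OF that]])
    have "(\<integral>\<^sup>+U. emeasure (measure_pmf p) (bad U) \<partial>measure_pmf P1) \<le> ennreal (real k / real (card {..<n1}) + N / 2 ^ k)"
      unfolding P1_def bad_def
      by (rule coarse_error[OF _ _ p cover sel]) (use n in auto)
    then have "ennreal ?c + (\<integral>\<^sup>+U. emeasure (measure_pmf p) (bad U) \<partial>measure_pmf P1)
      \<le> ennreal ?c + ennreal (real k / real n1 + N / 2 ^ k)"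
      by (intro add_left_mono) simp
    also have "\<dots> = ennreal (?c + (real k / real n1 + N / 2 ^ k))"
      using \<tau> G N by (intro ennreal_plus[symmetric] mult_nonneg_nonneg add_nonneg_nonneg divide_nonneg_nonneg) auto
    finally show "(\<integral>\<^sup>+W. (INF h\<in>cands W. (\<integral>\<^sup>+x. ennreal \<bar>h x - f x\<bar> \<partial>measure_pmf p)) \<partial>measure_pmf (Pi_pmf {..<n1 + n2} undefined (\<lambda>_. p)))
      \<le> ennreal (?c + (real k / real n1 + N / 2 ^ k))"
      by (rule order.trans[OF 1[unfolded err_def]])
  qed
  then show ?thesis by blast
qed

section \<open>From lists of candidates to agnostic learning\<close>

text \<open>Re-indexed from 0 and \<open>undefined\<close> elsewhere, so that a block of an i.i.d.
  sample has exactly the law \<open>Pi_pmf {..<n} undefined (\<lambda>_. p)\<close> of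
  \<open>list_learner\<close>.\<close>

definition block :: "nat \<Rightarrow> nat \<Rightarrow> (nat \<Rightarrow> 'x) \<Rightarrow> nat \<Rightarrow> 'x" where
  "block n l W = (\<lambda>i. if i < n then W (l * n + i) else undefined)"

definition block_cands :: "nat \<Rightarrow> nat \<Rightarrow> ((nat \<Rightarrow> 'x) \<Rightarrow> ('x \<Rightarrow> real) set) \<Rightarrow> (nat \<Rightarrow> 'x) \<Rightarrow> ('x \<Rightarrow> real) set" where
  "block_cands n k cands W = (\<Union>l<k. cands (block n l W))"

text \<open>Markov's inequality bounds the failure of one block by 1/2, since the expected distance
  is at most r / 2; disjoint blocks fail independently.\<close>

lemma block_cands_failure:
  assumes L: "list_learner X F n N e cands" and p: "set_pmf p \<subseteq> X" and f: "f \<in> F"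
    and r: "r > 0" "e \<le> r / 2"
  shows "measure_pmf.prob (Pi_pmf {..<k * n} undefined (\<lambda>_. p))
    {W. \<forall>h\<in>block_cands n k cands W. ennreal r < (\<integral>\<^sup>+x. ennreal \<bar>h x - f x\<bar> \<partial>measure_pmf p)} \<le> (1/2) ^ k"
proof -
  define err where "err h = (\<integral>\<^sup>+x. ennreal \<bar>h x - f x\<bar> \<partial>measure_pmf p)" for h
  define bad where "bad W \<longleftrightarrow> (\<forall>h\<in>cands W. ennreal r < err h)" for W
  have one: "emeasure (measure_pmf (Pi_pmf {..<n} undefined (\<lambda>_. p))) {W. bad W} \<le> ennreal (1/2)" (is "emeasure ?P _ \<le> _")
  proof -
    have "ennreal r * emeasure ?P {W. bad W} = (\<integral>\<^sup>+W. ennreal r * indicator {W. bad W} W \<partial>?P)"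
      by (simp add: nn_integral_cmult)
    also have "\<dots> \<le> (\<integral>\<^sup>+W. (INF h\<in>cands W. err h) \<partial>?P)"
      by (rule nn_integral_mono) (auto simp: bad_def indicator_def le_INF_iff intro: less_imp_le)
    also have "\<dots> \<le> ennreal e"
      using L[unfolded list_learner_def, THEN conjunct2, rule_format, OF p f] unfolding err_def .
    also have "\<dots> \<le> ennreal (r / 2)" using r by (intro ennreal_leI) simp
    also have "ennreal (r / 2) = ennreal r * ennreal (1/2)" by (subst ennreal_mult[symmetric]) (use r in auto)
    finally show ?thesis using r by (subst (asm) ennreal_mult_le_mult_iff) auto
  qed
  have "emeasure (measure_pmf (Pi_pmf {..<k * n} undefined (\<lambda>_. p))) {W. \<forall>l<k. bad (block n l W)} \<le> ennreal ((1/2) ^ k)"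
  proof (induction k)
    case (Suc k)
    let ?B = "{k * n..<Suc k * n}"
    let ?P1 = "Pi_pmf {..<k * n} undefined (\<lambda>_. p)" and ?P2 = "Pi_pmf ?B undefined (\<lambda>_. p)"
    let ?E1 = "{W. \<forall>l<k. bad (block n l W)}"
    have un: "{..<Suc k * n} = {..<k * n} \<union> ?B" by auto
    have law: "Pi_pmf {..<n} undefined (\<lambda>_. p) = map_pmf (\<lambda>g. g \<circ> (\<lambda>i. k * n + i)) ?P2"
    proof (rule Pi_pmf_bij_betw)
      show "bij_betw (\<lambda>i. k * n + i) {..<n} ?B"
        by (rule bij_betwI[where g = "\<lambda>j. j - k * n"]) auto
    qed auto
    \<comment> \<open>The first k blocks read only U and the last one only V, so the indicator
      factorises and the double integral becomes a product.\<close>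
    have eq: "indicator {W. \<forall>l<Suc k. bad (block n l W)} (\<lambda>x. if x < k * n then U x else V x)
        = (indicator ?E1 U * indicator {W. bad W} (V \<circ> (\<lambda>i. k * n + i)) :: ennreal)"
      if V: "V \<in> set_pmf ?P2" for U V
    proof -
      have "block n l (\<lambda>x. if x < k * n then U x else V x) = block n l U" if "l < k" for l
      proof -
        have "l * n + i < k * n" if "i < n" for i
        proof -
          have "l * n + i < Suc l * n" using that by simp
          also have "\<dots> \<le> k * n" using \<open>l < k\<close> by (intro mult_right_mono) auto
          finally show ?thesis .
        qed
        then show ?thesis by (auto simp: block_def)
      qed
      moreover have "block n k (\<lambda>x. if x < k * n then U x else V x) = V \<circ> (\<lambda>i. k * n + i)"
      proof -
        have "V (k * n + i) = undefined" if "\<not> i < n" for i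
          by (rule set_Pi_pmf_const(2)[OF _ V]) (use that in auto)
        then show ?thesis by (auto simp: block_def)
      qed
      ultimately show ?thesis by (auto simp: indicator_def less_Suc_eq)
    qed
    have "emeasure (measure_pmf (Pi_pmf {..<Suc k * n} undefined (\<lambda>_. p))) {W. \<forall>l<Suc k. bad (block n l W)}
      = (\<integral>\<^sup>+W. indicator {W. \<forall>l<Suc k. bad (block n l W)} W \<partial>measure_pmf (Pi_pmf {..<Suc k * n} undefined (\<lambda>_. p)))"
      by simp
    also have "\<dots> = (\<integral>\<^sup>+U. (\<integral>\<^sup>+V. indicator {W. \<forall>l<Suc k. bad (block n l W)} (\<lambda>x. if x < k * n then U x else V x) \<partial>measure_pmf ?P2) \<partial>measure_pmf ?P1)"
      unfolding un by (subst Pi_pmf_union) (auto simp: nn_integral_pair_pmf')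
    also have "\<dots> = (\<integral>\<^sup>+U. (\<integral>\<^sup>+V. indicator ?E1 U * indicator {W. bad W} (V \<circ> (\<lambda>i. k * n + i)) \<partial>measure_pmf ?P2) \<partial>measure_pmf ?P1)"
      by (intro nn_integral_cong nn_integral_cong_AE AE_pmfI eq)
    also have "\<dots> = (\<integral>\<^sup>+U. indicator ?E1 U * (\<integral>\<^sup>+V. indicator {W. bad W} (V \<circ> (\<lambda>i. k * n + i)) \<partial>measure_pmf ?P2) \<partial>measure_pmf ?P1)"
      by (simp add: nn_integral_cmult)
    also have "(\<integral>\<^sup>+V. indicator {W. bad W} (V \<circ> (\<lambda>i. k * n + i)) \<partial>measure_pmf ?P2) = (\<integral>\<^sup>+V. indicator {W. bad W} V \<partial>?P)"
      unfolding law by simp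
    also have "\<dots> = emeasure ?P {W. bad W}" by simp
    also have "(\<integral>\<^sup>+U. indicator ?E1 U * emeasure ?P {W. bad W} \<partial>measure_pmf ?P1) = emeasure (measure_pmf ?P1) ?E1 * emeasure ?P {W. bad W}"
      by (simp add: nn_integral_multc)
    also have "\<dots> \<le> ennreal ((1/2) ^ k) * ennreal (1/2)"
      by (rule mult_mono[OF Suc.IH one]) auto
    also have "\<dots> = ennreal ((1/2) ^ Suc k)" by (subst ennreal_mult[symmetric]) (auto simp: mult.commute)
    finally show ?case .
  qed simp
  moreover have "{W. \<forall>h\<in>block_cands n k cands W. ennreal r < err h} = {W. \<forall>l<k. bad (block n l W)}"
    by (auto simp: block_cands_def bad_def)
  ultimately show ?thesis
    unfolding err_def by (simp add: measure_pmf.emeasure_eq_measure)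
qed

section \<open>The example distribution and its marginal on X\<close>

lemma example_distribution_space:
  assumes "example_distribution X P"
  shows "space P = X \<times> {0..1}" "prob_space P" "sets P = sets (count_space X \<Otimes>\<^sub>M restrict_space borel {0..1})"
proof -
  show s: "sets P = sets (count_space X \<Otimes>\<^sub>M restrict_space borel {0..1})" and "prob_space P"
    using assms by (auto simp: example_distribution_def example_space_def)
  then have "space P = space (count_space X \<Otimes>\<^sub>M restrict_space (borel :: real measure) {0..1})"
    using sets_eq_imp_space_eq by blast
  then show "space P = X \<times> {0..1}" by (simp add: space_pair_measure space_restrict_space)
qed

lemma measurable_fst_example:
  assumes "example_distribution X P"
  shows "fst \<in> measurable P (count_space UNIV)"
proof -
  have "fst \<in> measurable P (count_space X)"
    using example_distribution_space(3)[OF assms] by (simp cong: measurable_cong_sets)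
  then show ?thesis by (rule measurable_compose) simp
qed

lemma measurable_loss:
  assumes "example_distribution X P"
  shows "(\<lambda>z. \<bar>h (fst z) - snd z\<bar>) \<in> borel_measurable P"
proof -
  have "(\<lambda>z. h (fst z)) \<in> borel_measurable P"
    by (rule measurable_compose[OF measurable_fst_example[OF assms]]) simp
  moreover have "snd \<in> borel_measurable P"
  proof -
    have "snd \<in> measurable P (restrict_space borel {0..1})"
      using example_distribution_space(3)[OF assms] by (simp cong: measurable_cong_sets)
    then show ?thesis by (rule measurable_restrict_space2_iff[THEN iffD1, THEN conjunct1])
  qed
  ultimately show ?thesis by simp
qed

text \<open>A \<open>pmf\<close> requires almost every point to carry positive mass. Since X is
  countable, its points of mass 0 form a null set altogether.\<close>

lemma example_marginal:
  assumes P: "example_distribution X P" and X: "countable X"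
  obtains p where "measure_pmf p = distr P (count_space UNIV) fst" "set_pmf p \<subseteq> X"
proof -
  note fst = measurable_fst_example[OF P]
  interpret prob_space P by (rule example_distribution_space(2)[OF P])
  define Q where "Q = distr P (count_space UNIV) fst"
  interpret Q: prob_space Q unfolding Q_def by (rule prob_space_distr[OF fst])
  have setsQ: "sets Q = UNIV" by (simp add: Q_def)
  have AEX: "AE x in Q. x \<in> X"
    unfolding Q_def by (subst AE_distr_iff[OF fst]) (auto simp: example_distribution_space(1)[OF P])
  have "AE x in Q. \<forall>y\<in>X. measure Q {y} = 0 \<longrightarrow> x \<noteq> y"
  proof (subst AE_ball_countable[OF X], rule ballI)
    fix y
    show "AE x in Q. measure Q {y} = 0 \<longrightarrow> x \<noteq> y"
    proof (cases "measure Q {y} = 0")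
      case True
      then have "{y} \<in> null_sets Q" using setsQ by (auto simp: null_sets_def Q.emeasure_eq_measure)
      then have "AE x in Q. x \<notin> {y}" by (rule AE_not_in)
      then show ?thesis by simp
    qed simp
  qed
  then have "AE x in Q. measure Q {x} \<noteq> 0" using AEX by eventually_elim auto
  then have "measure_pmf (Abs_pmf Q) = Q"
    by (intro Abs_pmf_inverse) (simp add: setsQ Q.prob_space_axioms)
  note eq = this
  have "AE x in measure_pmf (Abs_pmf Q). x \<in> X" unfolding eq by (rule AEX)
  then have "set_pmf (Abs_pmf Q) \<subseteq> X" by (simp add: AE_measure_pmf_iff subset_iff)
  then show thesis by (rule that[OF eq[unfolded Q_def], folded Q_def])
qed

lemma er_nonneg: "er P h \<ge> 0"
  by (simp add: er_def)

lemma loss_bounds: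
  assumes P: "example_distribution X P" and h: "h \<in> X \<rightarrow> {0..1}" and z: "z \<in> space P"
  shows "\<bar>h (fst z) - snd z\<bar> \<in> {0..1}"
proof -
  have "fst z \<in> X" "snd z \<in> {0..1}" using z example_distribution_space(1)[OF P] by (auto simp: mem_Times_iff)
  moreover have "h (fst z) \<in> {0..1}" using h calculation(1) by (rule funcset_mem)
  ultimately show ?thesis by (auto simp: abs_le_iff)
qed

lemma integrable_loss:
  assumes P: "example_distribution X P" and h: "h \<in> X \<rightarrow> {0..1}"
  shows "integrable P (\<lambda>z. \<bar>h (fst z) - snd z\<bar>)"
proof -
  interpret prob_space P by (rule example_distribution_space(2)[OF P])
  show ?thesis
    by (rule integrable_const_bound[where B = 1])
       (use loss_bounds[OF P h] measurable_loss[OF P] in \<open>auto intro!: AE_I2\<close>)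
qed

text \<open>The triangle inequality; the distance between h and f depends on the marginal only, so
  it can be controlled from unlabelled points.\<close>

lemma er_le_add:
  assumes P: "example_distribution X P" and p: "measure_pmf p = distr P (count_space UNIV) fst"
    and h: "h \<in> X \<rightarrow> {0..1}" and f: "f \<in> X \<rightarrow> {0..1}" and r: "r \<ge> 0"
    and le: "(\<integral>\<^sup>+x. ennreal \<bar>h x - f x\<bar> \<partial>measure_pmf p) \<le> ennreal r"
  shows "er P h \<le> er P f + r"
proof -
  note fst = measurable_fst_example[OF P]
  have er: "ennreal (er P g) = (\<integral>\<^sup>+z. ennreal \<bar>g (fst z) - snd z\<bar> \<partial>P)" if "g \<in> X \<rightarrow> {0..1}" for g
    unfolding er_def by (rule nn_integral_eq_integral[symmetric, OF integrable_loss[OF P that]]) simp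
  have m: "(\<lambda>z. \<bar>h (fst z) - f (fst z)\<bar>) \<in> borel_measurable P"
    by (rule measurable_compose[OF fst]) simp
  have "ennreal (er P h) \<le> (\<integral>\<^sup>+z. ennreal \<bar>f (fst z) - snd z\<bar> + ennreal \<bar>h (fst z) - f (fst z)\<bar> \<partial>P)"
    unfolding er[OF h] by (rule nn_integral_mono) (auto simp flip: ennreal_plus intro!: ennreal_leI)
  also have "\<dots> = ennreal (er P f) + (\<integral>\<^sup>+z. ennreal \<bar>h (fst z) - f (fst z)\<bar> \<partial>P)"
    unfolding er[OF f] using measurable_loss[OF P] m by (subst nn_integral_add) auto
  also have "(\<integral>\<^sup>+z. ennreal \<bar>h (fst z) - f (fst z)\<bar> \<partial>P) = (\<integral>\<^sup>+x. ennreal \<bar>h x - f x\<bar> \<partial>measure_pmf p)"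
    unfolding p by (subst nn_integral_distr[OF fst]) auto
  also have "ennreal (er P f) + \<dots> \<le> ennreal (er P f) + ennreal r" by (rule add_left_mono[OF le])
  also have "\<dots> = ennreal (er P f + r)" using r er_nonneg[of P f] by simp
  finally show ?thesis using r er_nonneg[of P f] by (subst (asm) ennreal_le_iff) auto
qed

section \<open>Transfer to the product measure\<close>

definition sample_points :: "nat \<Rightarrow> (nat \<Rightarrow> 'x \<times> real) \<Rightarrow> nat \<Rightarrow> 'x" where
  "sample_points m w = (\<lambda>i. if i < m then fst (w i) else undefined)"

text \<open>The point sequences form a countable set, and the samples over one sequence form a box
  of slices whose measure is the product of the point masses. Every event on the points is a
  countable disjoint union of such boxes, which gives measurability and measure at once.\<close>

lemma sample_points_law:
  assumes P: "example_distribution X P" and X: "countable X"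
    and p: "measure_pmf p = distr P (count_space UNIV) fst" "set_pmf p \<subseteq> X"
  shows "{w\<in>space (\<Pi>\<^sub>M i\<in>{..<m}. P). sample_points m w \<in> S} \<in> sets (\<Pi>\<^sub>M i\<in>{..<m}. P)"
    "emeasure (\<Pi>\<^sub>M i\<in>{..<m}. P) {w\<in>space (\<Pi>\<^sub>M i\<in>{..<m}. P). sample_points m w \<in> S}
      = emeasure (measure_pmf (Pi_pmf {..<m} undefined (\<lambda>_. p))) S"
proof -
  note fst = measurable_fst_example[OF P]
  note spP = example_distribution_space(1)[OF P]
  interpret P: prob_space P by (rule example_distribution_space(2)[OF P])
  interpret PP: product_prob_space "\<lambda>_::nat. P" ..
  interpret PPM: finite_product_prob_space "\<lambda>_. P" "{..<m}" by standard simp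
  let ?M = "\<Pi>\<^sub>M i\<in>{..<m}. P" and ?Q = "Pi_pmf {..<m} undefined (\<lambda>_. p)"
  define \<Omega> where "\<Omega> = PiE {..<m} (\<lambda>_. X)"
  have \<Omega>: "countable \<Omega>" unfolding \<Omega>_def by (rule countable_PiE) (use X in auto)
  have range: "sample_points m w \<in> \<Omega>" if "w \<in> space ?M" for w
    using that spP by (auto simp: sample_points_def \<Omega>_def space_PiM PiE_iff extensional_def mem_Times_iff)
  define slice where "slice x = {z\<in>space P. fst z = x}" for x
  have slice: "slice x \<in> sets P" for x
    using measurable_sets[OF fst, of "{x}"] by (simp add: slice_def vimage_def Int_def conj_commute)
  have slice_p: "measure P (slice x) = pmf p x" for x
  proof -
    have "pmf p x = measure (distr P (count_space UNIV) fst) {x}" by (simp add: pmf.rep_eq p(1))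
    also have "\<dots> = measure P (slice x)"
      by (subst measure_distr[OF fst]) (auto simp: slice_def vimage_def Int_def conj_commute)
    finally show ?thesis by simp
  qed
  have single: "{w\<in>space ?M. sample_points m w = W} = PiE {..<m} (\<lambda>i. slice (W i))" if "W \<in> \<Omega>" for W
  proof (intro equalityI subsetI)
    fix w assume "w \<in> {w\<in>space ?M. sample_points m w = W}"
    then show "w \<in> PiE {..<m} (\<lambda>i. slice (W i))"
      by (auto simp: space_PiM PiE_iff slice_def sample_points_def)
  next
    fix w assume w: "w \<in> PiE {..<m} (\<lambda>i. slice (W i))"
    have "W i = undefined" if "\<not> i < m" for i using \<open>W \<in> \<Omega>\<close> that by (auto simp: \<Omega>_def PiE_iff extensional_def)
    then show "w \<in> {w\<in>space ?M. sample_points m w = W}"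
      using w by (auto simp: space_PiM PiE_iff slice_def sample_points_def fun_eq_iff)
  qed
  have meas1: "{w\<in>space ?M. sample_points m w = W} \<in> sets ?M" if "W \<in> \<Omega>" for W
    unfolding single[OF that] by (rule sets_PiM_I_finite) (use slice in auto)
  have em1: "emeasure ?M {w\<in>space ?M. sample_points m w = W} = ennreal (pmf ?Q W)" if "W \<in> \<Omega>" for W
  proof -
    have "W i = undefined" if "i \<notin> {..<m}" for i using \<open>W \<in> \<Omega>\<close> that by (auto simp: \<Omega>_def PiE_iff extensional_def)
    then have "pmf ?Q W = (\<Prod>i\<in>{..<m}. pmf p (W i))" by (intro pmf_Pi') auto
    moreover have "measure ?M (PiE {..<m} (\<lambda>i. slice (W i))) = (\<Prod>i\<in>{..<m}. measure P (slice (W i)))"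
      by (rule PPM.finite_measure_PiM_emb) (rule slice)
    ultimately show ?thesis unfolding single[OF that] by (simp add: PPM.emeasure_eq_measure slice_p)
  qed
  have eq: "{w\<in>space ?M. sample_points m w \<in> S} = (\<Union>W\<in>S \<inter> \<Omega>. {w\<in>space ?M. sample_points m w = W})" for S
    using range by auto
  have cS: "countable (S \<inter> \<Omega>)" for S using \<Omega> by simp
  show "{w\<in>space ?M. sample_points m w \<in> S} \<in> sets ?M"
    unfolding eq by (rule sets.countable_UN''[OF cS]) (use meas1 in auto)
  have "emeasure ?M {w\<in>space ?M. sample_points m w \<in> S} = (\<integral>\<^sup>+W. emeasure ?M {w\<in>space ?M. sample_points m w = W} \<partial>count_space (S \<inter> \<Omega>))"
    unfolding eq by (rule emeasure_UN_countable[OF _ cS]) (use meas1 in \<open>auto simp: disjoint_family_on_def\<close>)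
  also have "\<dots> = (\<integral>\<^sup>+W. ennreal (pmf ?Q W) \<partial>count_space (S \<inter> \<Omega>))"
    by (rule nn_integral_cong) (use em1 in auto)
  also have "\<dots> = emeasure (measure_pmf ?Q) (S \<inter> \<Omega>)"
    by (rule nn_integral_pmf)
  also have "\<dots> = emeasure (measure_pmf ?Q) S"
  proof (rule emeasure_eq_AE)
    have "W \<in> \<Omega>" if "W \<in> set_pmf ?Q" for W
      using set_Pi_pmf_const[OF _ that] p(2) by (auto simp: \<Omega>_def PiE_iff extensional_def)
    then show "AE W in measure_pmf ?Q. (W \<in> S \<inter> \<Omega>) = (W \<in> S)" by (intro AE_pmfI) auto
  qed auto
  finally show "emeasure ?M {w\<in>space ?M. sample_points m w \<in> S} = emeasure (measure_pmf ?Q) S" .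
qed

text \<open>Hoeffding's inequality for a fixed hypothesis; the work is to show that the coordinates
  of the product measure are independent with law P.\<close>

lemma empirical_deviation:
  assumes P: "example_distribution X P" and h: "h \<in> X \<rightarrow> {0..1}" and J: "finite J" "J \<noteq> {}" and c: "c \<ge> 0"
  shows "measure (\<Pi>\<^sub>M i\<in>J. P) {w\<in>space (\<Pi>\<^sub>M i\<in>J. P).
      c \<le> \<bar>(\<Sum>i\<in>J. \<bar>h (fst (w i)) - snd (w i)\<bar>) / real (card J) - er P h\<bar>} \<le> 2 * exp (- 2 * real (card J) * c\<^sup>2)"
proof -
  interpret P: prob_space P by (rule example_distribution_space(2)[OF P])
  interpret PP: product_prob_space "\<lambda>_. P" J ..
  let ?M = "\<Pi>\<^sub>M i\<in>J. P"
  define loss where "loss z = \<bar>h (fst z) - snd z\<bar>" for z :: "'a \<times> real"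
  have loss: "loss \<in> borel_measurable P" unfolding loss_def by (rule measurable_loss[OF P])
  have comp: "distr ?M P (\<lambda>w. w i) = P" if "i \<in> J" for i by (rule PP.PiM_component[OF that])
  have "PP.P.indep_vars (\<lambda>_. P) (\<lambda>i w. w i) J"
  proof (subst PP.P.indep_vars_iff_distr_eq_PiM'[OF J(2)])
    have "distr ?M ?M (\<lambda>x. \<lambda>i\<in>J. x i) = distr ?M ?M (\<lambda>x. x)"
      by (rule distr_cong) (auto simp: space_PiM PiE_iff extensional_def restrict_def fun_eq_iff)
    also have "\<dots> = ?M" by (rule distr_id)
    also have "\<dots> = (\<Pi>\<^sub>M i\<in>J. distr ?M P (\<lambda>w. w i))"
      by (rule PiM_cong) (use comp in auto)
    finally show "distr ?M ?M (\<lambda>x. \<lambda>i\<in>J. x i) = (\<Pi>\<^sub>M i\<in>J. distr ?M P (\<lambda>w. w i))" .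
  qed simp
  then have indep: "PP.P.indep_vars (\<lambda>_. borel) (\<lambda>i w. loss (w i)) J"
    by (rule PP.P.indep_vars_compose2) (rule loss)
  obtain j where j: "j \<in> J" using J(2) by blast
  have meas: "(\<lambda>w. loss (w i)) \<in> borel_measurable ?M" if "i \<in> J" for i
    using measurable_compose[OF measurable_component_singleton[OF that] loss] .
  have dl: "distr ?M borel (\<lambda>w. loss (w i)) = distr P borel loss" if i: "i \<in> J" for i
  proof -
    have "distr P borel loss = distr (distr ?M P (\<lambda>w. w i)) borel loss" by (simp add: comp[OF i])
    also have "\<dots> = distr ?M borel (loss \<circ> (\<lambda>w. w i))"
      by (rule distr_distr[OF loss]) (use i in simp)
    finally show ?thesis by (simp add: o_def)
  qed
  have ex: "PP.P.expectation (\<lambda>w. loss (w j)) = er P h"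
  proof -
    have "PP.P.expectation (\<lambda>w. loss (w j)) = integral\<^sup>L (distr ?M P (\<lambda>w. w j)) loss"
      by (rule integral_distr[symmetric]) (use j loss in auto)
    moreover have "loss = (\<lambda>z. \<bar>h (fst z) - snd z\<bar>)" by (simp add: loss_def fun_eq_iff)
    ultimately show ?thesis unfolding comp[OF j] er_def by simp
  qed
  interpret H: Hoeffding_ineq_iid ?M J "\<lambda>i w. loss (w i)" "\<lambda>w. loss (w j)" 0 1 "er P h"
  proof unfold_locales
    show "AE w in ?M. loss (w j) \<in> {0..1}"
    proof (rule AE_I2)
      fix w assume "w \<in> space ?M"
      then have "w j \<in> space P" using j by (auto simp: space_PiM PiE_iff)
      then show "loss (w j) \<in> {0..1}" unfolding loss_def by (rule loss_bounds[OF P h])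
    qed
    show "er P h \<equiv> PP.P.expectation (\<lambda>w. loss (w j))" by (simp add: ex)
  qed (use J indep meas j dl in auto)
  show ?thesis using H.Hoeffding_ineq_abs_ge'[OF c] J(2) by (simp add: loss_def)
qed

section \<open>Empirical minimisation on the validation sample\<close>

definition empirical_loss :: "nat set \<Rightarrow> (nat \<Rightarrow> 'x \<times> real) \<Rightarrow> ('x \<Rightarrow> real) \<Rightarrow> real" where
  "empirical_loss J w h = (\<Sum>i\<in>J. \<bar>h (fst (w i)) - snd (w i)\<bar>)"

definition empirical_minimisers :: "nat set \<Rightarrow> ('x \<Rightarrow> real) set \<Rightarrow> (nat \<Rightarrow> 'x \<times> real) \<Rightarrow> ('x \<Rightarrow> real) set" where
  "empirical_minimisers J H w = {h\<in>H. \<forall>h'\<in>H. empirical_loss J w h \<le> empirical_loss J w h'}"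

text \<open>The hypothesis depends on the validation sample only through the set of minimisers, of which
  there are finitely many; this makes the failure event measurable.\<close>

definition pick :: "('x \<Rightarrow> real) set \<Rightarrow> 'x \<Rightarrow> real" where
  "pick S = (if S = {} then (\<lambda>_. 0) else (SOME h. h \<in> S))"

text \<open>The labels of the first m1 examples are discarded, so the candidate list is fixed before
  validation starts. The list enters through \<open>(!)\<close>; for lists of length m \<ge> m1 only
  positions inside the list are read.\<close>

definition erm_learner :: "nat \<Rightarrow> nat \<Rightarrow> ((nat \<Rightarrow> 'x) \<Rightarrow> ('x \<Rightarrow> real) set) \<Rightarrow> ('x \<times> real) list \<Rightarrow> 'x \<Rightarrow> real" where
  "erm_learner m1 m C zs = pick (empirical_minimisers {m1..<m} (C (sample_points m1 ((!) zs))) ((!) zs))"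

lemma pick_in: "S \<noteq> {} \<Longrightarrow> pick S \<in> S"
  unfolding pick_def by (simp add: some_in_eq)

lemma empirical_minimisers_nonempty:
  assumes "finite H" "H \<noteq> {}"
  shows "empirical_minimisers J H w \<noteq> {}"
proof -
  obtain h where "h \<in> H" "\<And>h'. h' \<in> H \<Longrightarrow> empirical_loss J w h \<le> empirical_loss J w h'"
    using arg_min_if_finite(1)[OF assms, of "empirical_loss J w"] arg_min_least[OF assms, of _ "empirical_loss J w"]
    by blast
  then show ?thesis unfolding empirical_minimisers_def by blast
qed

lemma erm_learner_map:
  assumes "m1 \<le> m"
  shows "erm_learner m1 m C (map w [0..<m]) = pick (empirical_minimisers {m1..<m} (C (sample_points m1 w)) w)"
proof -
  have "sample_points m1 ((!) (map w [0..<m])) = sample_points m1 w"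
    using assms by (auto simp: sample_points_def fun_eq_iff)
  moreover have "empirical_loss {m1..<m} ((!) (map w [0..<m])) h = empirical_loss {m1..<m} w h" for h
    unfolding empirical_loss_def by (rule sum.cong) auto
  ultimately show ?thesis unfolding erm_learner_def empirical_minimisers_def by simp
qed

lemma erm_excess:
  assumes H: "finite H" "h0 \<in> H" and J: "finite J" "J \<noteq> {}"
    and dev: "\<And>h. h \<in> H \<Longrightarrow> \<bar>empirical_loss J w h / real (card J) - er P h\<bar> < c"
  shows "er P (pick (empirical_minimisers J H w)) < er P h0 + 2 * c"
proof -
  let ?h = "pick (empirical_minimisers J H w)"
  have "?h \<in> empirical_minimisers J H w"
    by (rule pick_in) (use empirical_minimisers_nonempty H in blast)
  then have h: "?h \<in> H" "empirical_loss J w ?h \<le> empirical_loss J w h0"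
    using H(2) by (auto simp: empirical_minimisers_def)
  have "empirical_loss J w ?h / real (card J) \<le> empirical_loss J w h0 / real (card J)"
    using h(2) by (rule divide_right_mono) simp
  then show ?thesis using dev[OF h(1)] dev[OF H(2)] by linarith
qed

lemma measurable_empirical_loss:
  assumes P: "example_distribution X P" and J: "J \<subseteq> I"
  shows "(\<lambda>w. empirical_loss J w h) \<in> borel_measurable (\<Pi>\<^sub>M i\<in>I. P)"
  unfolding empirical_loss_def
proof (rule borel_measurable_sum)
  fix i assume "i \<in> J"
  then have "(\<lambda>w. w i) \<in> measurable (\<Pi>\<^sub>M i\<in>I. P) P"
    using J by (intro measurable_component_singleton) auto
  then show "(\<lambda>w. \<bar>h (fst (w i)) - snd (w i)\<bar>) \<in> borel_measurable (\<Pi>\<^sub>M i\<in>I. P)"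
    by (rule measurable_compose) (rule measurable_loss[OF P])
qed

text \<open>The predicate G is arbitrary because the hypothesis takes only countably many values: it
  is determined by the point sequence and the set of minimisers, and each such combination is a
  measurable piece on which it is constant.\<close>

lemma erm_event_measurable:
  assumes P: "example_distribution X P" and X: "countable X" and C: "\<And>W. finite (C W)" and m: "m1 \<le> m"
  shows "{w\<in>space (\<Pi>\<^sub>M i\<in>{..<m}. P). G (pick (empirical_minimisers {m1..<m} (C (sample_points m1 w)) w))}
    \<in> sets (\<Pi>\<^sub>M i\<in>{..<m}. P)"
proof -
  let ?M = "\<Pi>\<^sub>M i\<in>{..<m}. P" and ?J = "{m1..<m}"
  obtain p where p: "measure_pmf p = distr P (count_space UNIV) fst" "set_pmf p \<subseteq> X"
    by (rule example_marginal[OF P X])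
  define \<Omega> where "\<Omega> = PiE {..<m1} (\<lambda>_. X)"
  have \<Omega>: "countable \<Omega>" unfolding \<Omega>_def by (rule countable_PiE) (use X in auto)
  have range: "sample_points m1 w \<in> \<Omega>" if "w \<in> space ?M" for w
    using that m example_distribution_space(1)[OF P]
    by (auto simp: sample_points_def \<Omega>_def space_PiM PiE_iff extensional_def mem_Times_iff)
  have loss: "(\<lambda>w. empirical_loss ?J w h) \<in> borel_measurable ?M" for h
    by (rule measurable_empirical_loss[OF P]) auto
  have min: "{w\<in>space ?M. empirical_minimisers ?J (C W) w = S} \<in> sets ?M" if S: "S \<subseteq> C W" for W S
  proof -
    have fin: "finite (C W)" by (rule C)
    have "{w\<in>space ?M. empirical_minimisers ?J (C W) w = S}
      = {w\<in>space ?M. \<forall>h\<in>C W. (h \<in> S) = (\<forall>h'\<in>C W. empirical_loss ?J w h \<le> empirical_loss ?J w h')}"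
      using S by (auto simp: empirical_minimisers_def)
    also have "\<dots> \<in> sets ?M"
    proof (rule sets.sets_Collect_finite_All[OF _ fin])
      fix h
      have all: "{w\<in>space ?M. \<forall>h'\<in>C W. empirical_loss ?J w h \<le> empirical_loss ?J w h'} \<in> sets ?M"
        by (rule sets.sets_Collect_finite_All[OF _ fin]) (rule borel_measurable_le[OF loss loss])
      show "{w\<in>space ?M. (h \<in> S) = (\<forall>h'\<in>C W. empirical_loss ?J w h \<le> empirical_loss ?J w h')} \<in> sets ?M"
        using all sets.sets_Collect_neg[OF all] by (cases "h \<in> S") simp_all
    qed
    finally show ?thesis .
  qed
  have pts: "{w\<in>space ?M. sample_points m1 w = W} \<in> sets ?M" for W
  proof -
    have "{w\<in>space ?M. sample_points m1 w = W} = {w\<in>space ?M. sample_points m w \<in> {V. (\<lambda>i. if i < m1 then V i else undefined) = W}}"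
      using m by (auto simp: sample_points_def fun_eq_iff)
    then show ?thesis by (simp only: sample_points_law(1)[OF P X p])
  qed
  have "{w\<in>space ?M. G (pick (empirical_minimisers ?J (C (sample_points m1 w)) w))}
    = (\<Union>W\<in>\<Omega>. \<Union>S\<in>{S\<in>Pow (C W). G (pick S)}. {w\<in>space ?M. sample_points m1 w = W} \<inter> {w\<in>space ?M. empirical_minimisers ?J (C W) w = S})"
    (is "?L = ?R")
  proof (intro equalityI subsetI)
    fix w assume w: "w \<in> ?L"
    let ?W = "sample_points m1 w"
    have "empirical_minimisers ?J (C ?W) w \<in> {S\<in>Pow (C ?W). G (pick S)}"
      using w by (auto simp: empirical_minimisers_def)
    moreover have "?W \<in> \<Omega>" using range w by simp
    ultimately show "w \<in> ?R" using w by fastforce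
  qed auto
  also have "\<dots> \<in> sets ?M"
  proof (rule sets.countable_UN''[OF \<Omega>])
    fix W
    have "finite {S\<in>Pow (C W). G (pick S)}" using C by simp
    then show "(\<Union>S\<in>{S\<in>Pow (C W). G (pick S)}. {w\<in>space ?M. sample_points m1 w = W} \<inter> {w\<in>space ?M. empirical_minimisers ?J (C W) w = S}) \<in> sets ?M"
      by (rule sets.finite_UN) (use pts min in auto)
  qed
  finally show ?thesis .
qed

lemma sample_points_merge:
  "sample_points m1 (merge {..<m1} J (x, y)) = sample_points m1 x"
  by (auto simp: sample_points_def fun_eq_iff merge_def)

lemma empirical_minimisers_merge:
  "I \<inter> J = {} \<Longrightarrow> empirical_minimisers J H (merge I J (x, y)) = empirical_minimisers J H y"
proof -
  assume "I \<inter> J = {}"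
  then have "empirical_loss J (merge I J (x, y)) h = empirical_loss J y h" for h
    unfolding empirical_loss_def by (intro sum.cong refl) (auto simp: merge_def)
  then show ?thesis by (simp add: empirical_minimisers_def)
qed

lemma (in prob_space) nn_integral_indicator_add_const:
  assumes B: "B \<in> sets M"
  shows "(\<integral>\<^sup>+x. indicator B x + c \<partial>M) = emeasure M B + c"
proof -
  have "(\<integral>\<^sup>+x. indicator B x + c \<partial>M) = (\<integral>\<^sup>+x. indicator B x \<partial>M) + (\<integral>\<^sup>+x. c \<partial>M)"
    by (rule nn_integral_add[OF borel_measurable_indicator[OF B] borel_measurable_const])
  then show ?thesis using B by (simp add: emeasure_space_1)
qed

lemma (in prob_space) measure_le_add:
  assumes "emeasure M A \<le> ennreal a + ennreal b" "0 \<le> a" "0 \<le> b"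
  shows "measure M A \<le> a + b"
proof -
  have "ennreal (measure M A) \<le> ennreal (a + b)"
    using assms by (simp add: emeasure_eq_measure ennreal_plus)
  then show ?thesis using assms by (subst (asm) ennreal_le_iff) auto
qed

text \<open>The budget \<epsilon> is split into the distance r of a candidate from f, the loss 2 c
  of empirical minimisation, and a rest that pays for f itself being only near-optimal. Failure
  implies that all k blocks fail or that one of the at most k N candidates deviates by c on the
  validation sample.\<close>

lemma list_learner_imp_agnostic:
  assumes X: "countable X" and F: "F \<subseteq> X \<rightarrow> {0..1}" "F \<noteq> {}"
    and L: "list_learner X F n N e cands" and e: "e \<le> r / 2" "r > 0" and c: "c > 0" "r + 2 * c < \<epsilon>"
    and m2: "m2 > 0" and \<delta>: "(1/2) ^ k + 2 * (real k * N) * exp (- 2 * real m2 * c\<^sup>2) < \<delta>"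
  shows "\<exists>A. learner X A \<and> agnostically_learns X F A \<epsilon> \<delta> (k * n + m2)"
proof -
  define m1 where "m1 = k * n"
  define m where "m = m1 + m2"
  define C where "C = block_cands n k cands"
  define A where "A = erm_learner m1 m C"
  let ?J = "{m1..<m}"
  have J: "finite ?J" "?J \<noteq> {}" "card ?J = m2" using m2 by (auto simp: m_def)
  have Cfin: "finite (C W)" for W
    using L unfolding C_def block_cands_def list_learner_def by blast
  have C01: "h x \<in> {0..1}" if "h \<in> C W" for h x W
    using L that unfolding C_def block_cands_def list_learner_def by blast
  have Ccard: "real (card (C W)) \<le> real k * N" for W
  proof -
    have "card (C W) \<le> (\<Sum>l<k. card (cands (block n l W)))"
      unfolding C_def block_cands_def by (rule card_UN_le) simp
    then have "real (card (C W)) \<le> (\<Sum>l<k. real (card (cands (block n l W))))"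
      by (metis of_nat_le_iff of_nat_sum)
    also have "\<dots> \<le> (\<Sum>l<k. N)" by (rule sum_mono) (use L in \<open>auto simp: list_learner_def\<close>)
    finally show ?thesis by simp
  qed
  have "learner X A"
    unfolding learner_def
  proof (intro ballI funcsetI)
    fix zs x
    let ?S = "empirical_minimisers ?J (C (sample_points m1 ((!) zs))) ((!) zs)"
    show "A zs x \<in> {0..1}"
    proof (cases "?S = {}")
      case True
      then show ?thesis by (simp add: A_def erm_learner_def pick_def)
    next
      case False
      then have "A zs \<in> ?S" unfolding A_def erm_learner_def by (rule pick_in)
      then show ?thesis using C01 by (auto simp: empirical_minimisers_def simp del: atLeastAtMost_iff)
    qed
  qed
  moreover have "failure_event F A \<epsilon> m P \<in> sets (\<Pi>\<^sub>M i\<in>{..<m}. P) \<and>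
      measure (\<Pi>\<^sub>M i\<in>{..<m}. P) (failure_event F A \<epsilon> m P) < \<delta>" if P: "example_distribution X P" for P
  proof -
    interpret P: prob_space P by (rule example_distribution_space(2)[OF P])
    interpret PP: product_prob_space "\<lambda>_::nat. P" ..
    let ?M = "\<Pi>\<^sub>M i\<in>{..<m}. P" and ?M1 = "\<Pi>\<^sub>M i\<in>{..<m1}. P" and ?M2 = "\<Pi>\<^sub>M i\<in>?J. P"
    let ?fail = "failure_event F A \<epsilon> m P"
    obtain p where p: "measure_pmf p = distr P (count_space UNIV) fst" "set_pmf p \<subseteq> X"
      by (rule example_marginal[OF P X])
    have Aw: "A (map w [0..<m]) = pick (empirical_minimisers ?J (C (sample_points m1 w)) w)" for w
      unfolding A_def by (rule erm_learner_map) (simp add: m_def)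
    have fail: "?fail = {w\<in>space ?M. (INF f\<in>F. ereal (er P f)) + ereal \<epsilon>
        \<le> ereal (er P (pick (empirical_minimisers ?J (C (sample_points m1 w)) w)))}"
      unfolding failure_event_def Aw by simp
    have meas: "?fail \<in> sets ?M"
      unfolding fail by (rule erm_event_measurable[OF P X Cfin]) (simp add: m_def)
    define I where "I = (INF f\<in>F. ereal (er P f))"
    have "0 \<le> I" unfolding I_def by (rule INF_greatest) (simp add: er_nonneg)
    moreover obtain f0 where "f0 \<in> F" using F(2) by blast
    then have "I \<le> ereal (er P f0)" unfolding I_def by (rule INF_lower)
    ultimately obtain i where i: "I = ereal i" by (cases I) auto
    \<comment> \<open>The infimum need not be attained; the strict inequality r + 2 c < \<epsilon>
      leaves room for an f near it.\<close>
    have "I < ereal (i + (\<epsilon> - r - 2 * c))" using i c by simp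
    then obtain f where f: "f \<in> F" "er P f < i + (\<epsilon> - r - 2 * c)"
      unfolding I_def INF_less_iff by auto
    have fX: "f \<in> X \<rightarrow> {0..1}" using f(1) F(1) by blast
    define bad where "bad W \<longleftrightarrow> (\<forall>h\<in>C W. ennreal r < (\<integral>\<^sup>+x. ennreal \<bar>h x - f x\<bar> \<partial>measure_pmf p))" for W
    define dev where "dev h = {w\<in>space ?M2. c \<le> \<bar>empirical_loss ?J w h / real (card ?J) - er P h\<bar>}" for h
    let ?b = "2 * (real k * N) * exp (- 2 * real m2 * c\<^sup>2)"
    have dev_meas: "dev h \<in> sets ?M2" for h
    proof -
      have [measurable]: "(\<lambda>w. empirical_loss ?J w h) \<in> borel_measurable ?M2"
        by (rule measurable_empirical_loss[OF P]) simp
      show ?thesis unfolding dev_def by measurable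
    qed
    interpret P2: prob_space ?M2 by (rule prob_space_PiM) (rule P.prob_space_axioms)
    interpret P1: prob_space ?M1 by (rule prob_space_PiM) (rule P.prob_space_axioms)
    interpret PM: prob_space ?M by (rule prob_space_PiM) (rule P.prob_space_axioms)
    have devs: "emeasure ?M2 (\<Union>h\<in>C W. dev h) \<le> ennreal ?b" for W
    proof -
      have "emeasure ?M2 (\<Union>h\<in>C W. dev h) \<le> (\<Sum>h\<in>C W. emeasure ?M2 (dev h))"
        by (rule emeasure_subadditive_finite[OF Cfin]) (use dev_meas in auto)
      also have "\<dots> \<le> (\<Sum>h\<in>C W. ennreal (2 * exp (- 2 * real m2 * c\<^sup>2)))"
      proof (rule sum_mono)
        fix h assume "h \<in> C W"
        then have hX: "h \<in> X \<rightarrow> {0..1}" using C01 by blast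
        show "emeasure ?M2 (dev h) \<le> ennreal (2 * exp (- 2 * real m2 * c\<^sup>2))"
          using empirical_deviation[OF P hX J(1,2), of c] c(1) J(3)
          unfolding dev_def empirical_loss_def P2.emeasure_eq_measure by (intro ennreal_leI) simp
      qed
      also have "\<dots> = ennreal (real (card (C W)) * (2 * exp (- 2 * real m2 * c\<^sup>2)))"
        by (simp add: ennreal_mult ennreal_of_nat_eq_real_of_nat)
      also have "\<dots> \<le> ennreal (real k * N * (2 * exp (- 2 * real m2 * c\<^sup>2)))"
        by (intro ennreal_leI mult_right_mono Ccard) simp
      finally show ?thesis by (simp add: mult_ac)
    qed
    have good: "merge {..<m1} ?J (x, y) \<notin> ?fail"
      if x: "\<not> bad (sample_points m1 x)" and y: "y \<in> space ?M2" "y \<notin> (\<Union>h\<in>C (sample_points m1 x). dev h)" for x y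
    proof -
      let ?H = "C (sample_points m1 x)"
      obtain h0 where h0: "h0 \<in> ?H" "(\<integral>\<^sup>+x. ennreal \<bar>h0 x - f x\<bar> \<partial>measure_pmf p) \<le> ennreal r"
        using x unfolding bad_def by (auto simp: not_less)
      have h0X: "h0 \<in> X \<rightarrow> {0..1}" using C01[OF h0(1)] by blast
      have "er P (pick (empirical_minimisers ?J ?H y)) < er P h0 + 2 * c"
        by (rule erm_excess[OF Cfin h0(1) J(1,2)]) (use y in \<open>auto simp: dev_def\<close>)
      also have "er P h0 \<le> er P f + r" by (rule er_le_add[OF P p(1) h0X fX _ h0(2)]) (use e in simp)
      finally have "er P (pick (empirical_minimisers ?J ?H y)) < i + \<epsilon>" using f(2) by simp
      then have "\<not> I + ereal \<epsilon> \<le> ereal (er P (pick (empirical_minimisers ?J ?H y)))"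
        unfolding i by simp
      moreover have "empirical_minimisers ?J ?H (merge {..<m1} ?J (x, y)) = empirical_minimisers ?J ?H y"
        by (rule empirical_minimisers_merge) auto
      ultimately show ?thesis unfolding fail I_def by (simp add: sample_points_merge)
    qed
    have un: "{..<m} = {..<m1} \<union> ?J" by (auto simp: m_def)
    have badm: "{x\<in>space ?M1. bad (sample_points m1 x)} \<in> sets ?M1"
      using sample_points_law(1)[OF P X p, of m1 "{W. bad W}"] by simp
    have "emeasure ?M ?fail = (\<integral>\<^sup>+w. indicator ?fail w \<partial>(\<Pi>\<^sub>M i\<in>{..<m1} \<union> ?J. P))"
      using meas unfolding un by simp
    \<comment> \<open>Integrating over the validation part first freezes the points x, hence the
      candidate list, so that Hoeffding's inequality applies to each fixed candidate.\<close>
    also have "\<dots> = (\<integral>\<^sup>+x. (\<integral>\<^sup>+y. indicator ?fail (merge {..<m1} ?J (x, y)) \<partial>?M2) \<partial>?M1)"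
      by (rule PP.product_nn_integral_fold) (use meas in \<open>auto simp flip: un\<close>)
    also have "\<dots> \<le> (\<integral>\<^sup>+x. indicator {x\<in>space ?M1. bad (sample_points m1 x)} x + ennreal ?b \<partial>?M1)"
    proof (rule nn_integral_mono)
      fix x assume x: "x \<in> space ?M1"
      show "(\<integral>\<^sup>+y. indicator ?fail (merge {..<m1} ?J (x, y)) \<partial>?M2) \<le> indicator {x\<in>space ?M1. bad (sample_points m1 x)} x + ennreal ?b"
      proof (cases "bad (sample_points m1 x)")
        case True
        have "(\<integral>\<^sup>+y. indicator ?fail (merge {..<m1} ?J (x, y)) \<partial>?M2) \<le> (\<integral>\<^sup>+y. 1 \<partial>?M2)"
          by (rule nn_integral_mono) (simp add: indicator_def)
        also have "\<dots> = 1" by (simp add: P2.emeasure_space_1)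
        also have "1 \<le> indicator {x\<in>space ?M1. bad (sample_points m1 x)} x + ennreal ?b"
          using True x by simp
        finally show ?thesis .
      next
        case False
        have "(\<integral>\<^sup>+y. indicator ?fail (merge {..<m1} ?J (x, y)) \<partial>?M2)
          \<le> (\<integral>\<^sup>+y. indicator (\<Union>h\<in>C (sample_points m1 x). dev h) y \<partial>?M2)"
          by (rule nn_integral_mono) (use good[OF False] in \<open>auto simp: indicator_def\<close>)
        also have "\<dots> = emeasure ?M2 (\<Union>h\<in>C (sample_points m1 x). dev h)"
          by (rule nn_integral_indicator) (use dev_meas Cfin in auto)
        also have "\<dots> \<le> ennreal ?b" by (rule devs)
        finally show ?thesis using False by simp
      qed
    qed
    finally have 1: "emeasure ?M ?fail \<le> (\<integral>\<^sup>+x. indicator {x\<in>space ?M1. bad (sample_points m1 x)} x + ennreal ?b \<partial>?M1)" .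
    have 2: "(\<integral>\<^sup>+x. indicator {x\<in>space ?M1. bad (sample_points m1 x)} x + ennreal ?b \<partial>?M1)
        = emeasure ?M1 {x\<in>space ?M1. bad (sample_points m1 x)} + ennreal ?b"
      by (rule P1.nn_integral_indicator_add_const[OF badm])
    have 3: "emeasure ?M1 {x\<in>space ?M1. bad (sample_points m1 x)} = emeasure (measure_pmf (Pi_pmf {..<m1} undefined (\<lambda>_. p))) {W. bad W}"
      using sample_points_law(2)[OF P X p, of m1 "{W. bad W}"] by simp
    have 4: "emeasure (measure_pmf (Pi_pmf {..<m1} undefined (\<lambda>_. p))) {W. bad W} \<le> ennreal ((1/2) ^ k)"
      using block_cands_failure[OF L p(2) f(1) e(2,1), of k]
      unfolding measure_pmf.emeasure_eq_measure bad_def C_def m1_def by (intro ennreal_leI)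
    have up: "emeasure ?M ?fail \<le> ennreal ((1/2) ^ k) + ennreal ?b"
      by (rule order.trans[OF 1[unfolded 2 3] add_right_mono[OF 4]])
    have b0: "?b \<ge> 0"
    proof -
      \<comment> \<open>The sign of k N comes from the size of an actual candidate set.\<close>
      have "0 \<le> real k * N" using Ccard[of undefined] by (rule order.trans[rotated]) simp
      then show ?thesis by simp
    qed
    have "measure ?M ?fail \<le> (1/2) ^ k + ?b"
      by (rule PM.measure_le_add[OF up _ b0]) simp
    then show ?thesis using meas by (intro conjI) (assumption, rule le_less_trans[OF _ \<delta>])
  qed
  then have "agnostically_learns X F A \<epsilon> \<delta> m" unfolding agnostically_learns_def by blast
  ultimately show ?thesis unfolding m_def m1_def by blast
qed

section \<open>Sample sizes\<close>

lemma constant_learner: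
  assumes h: "h \<in> X \<rightarrow> {0..1}" and \<delta>: "\<delta> > 0"
    and er: "\<And>P. example_distribution X P \<Longrightarrow> ereal (er P h) < (INF f\<in>F. ereal (er P f)) + ereal \<epsilon>"
  shows "\<exists>A. learner X A \<and> agnostically_learns X F A \<epsilon> \<delta> 0"
proof (intro exI conjI)
  show "learner X (\<lambda>_. h)" using h by (simp add: learner_def)
  have "failure_event F (\<lambda>_. h) \<epsilon> 0 P = {}" if "example_distribution X P" for P
    using er[OF that] by (auto simp: failure_event_def not_le)
  then show "agnostically_learns X F (\<lambda>_. h) \<epsilon> \<delta> 0"
    using \<delta> by (auto simp: agnostically_learns_def)
qed

text \<open>Every label is within 1/2 of the constant 1/2. The case \<epsilon> > 1/2 is separated
  because ln (1/\<epsilon>) tends to 0 as \<epsilon> tends to 1, which leaves no room for a positive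
  sample size.\<close>

lemma constant_learner_half:
  assumes "1/2 < \<epsilon>" "\<delta> > 0"
  shows "\<exists>A. learner X A \<and> agnostically_learns X F A \<epsilon> \<delta> 0"
proof (rule constant_learner[of "\<lambda>_. 1/2"])
  fix P assume P: "example_distribution X P"
  interpret prob_space P by (rule example_distribution_space(2)[OF P])
  have "er P (\<lambda>_. 1/2) \<le> (\<integral>z. 1/2 \<partial>P)"
    unfolding er_def
  proof (rule integral_mono)
    show "integrable P (\<lambda>z. \<bar>1/2 - snd z\<bar>)"
      using integrable_loss[OF P, of "\<lambda>_. 1/2"] by simp
    fix z assume "z \<in> space P"
    then have "snd z \<in> {0..1}" using example_distribution_space(1)[OF P] by (auto simp: mem_Times_iff)
    then show "\<bar>1/2 - snd z\<bar> \<le> 1/2" by (auto simp: abs_if)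
  qed simp
  then have "er P (\<lambda>_. 1/2) \<le> 1/2" by (simp add: prob_space)
  then have "ereal (er P (\<lambda>_. 1/2)) < 0 + ereal \<epsilon>" using assms by simp
  also have "\<dots> \<le> (INF f\<in>F. ereal (er P f)) + ereal \<epsilon>"
    by (intro add_right_mono INF_greatest) (simp add: er_nonneg)
  finally show "ereal (er P (\<lambda>_. 1/2)) < (INF f\<in>F. ereal (er P f)) + ereal \<epsilon>" .
qed (use assms in auto)

text \<open>An empty X carries no distribution, and an empty F has infimum \<infinity>, so the
  failure event cannot occur.\<close>

lemma constant_learner_degenerate:
  assumes "X = {} \<or> F = {}" "\<delta> > 0"
  shows "\<exists>A. learner X A \<and> agnostically_learns X F A \<epsilon> \<delta> 0"
proof (rule constant_learner[of "\<lambda>_. 0"])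
  fix P assume P: "example_distribution X P"
  interpret prob_space P by (rule example_distribution_space(2)[OF P])
  have "F = {}"
    using assms(1) not_empty example_distribution_space(1)[OF P] by auto
  then show "ereal (er P (\<lambda>_. 0)) < (INF f\<in>F. ereal (er P f)) + ereal \<epsilon>"
    by (simp add: top_ereal_def)
qed (use assms in auto)

text \<open>If all members of F are uniformly close, any one of them is near-optimal for every P.
  This settles dimension 0, where the bound is 0.\<close>

lemma constant_learner_close:
  assumes X: "countable X" and F: "F \<subseteq> X \<rightarrow> {0..1}" "F \<noteq> {}" and \<delta>: "\<delta> > 0" and r: "0 \<le> r" "r < \<epsilon>"
    and close: "\<And>f g x. f \<in> F \<Longrightarrow> g \<in> F \<Longrightarrow> x \<in> X \<Longrightarrow> f x - g x < r"
  shows "\<exists>A. learner X A \<and> agnostically_learns X F A \<epsilon> \<delta> 0"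
proof -
  obtain f where f: "f \<in> F" using F(2) by blast
  then have fX: "f \<in> X \<rightarrow> {0..1}" using F(1) by blast
  show ?thesis
  proof (rule constant_learner[OF fX \<delta>])
    fix P assume P: "example_distribution X P"
    obtain p where p: "measure_pmf p = distr P (count_space UNIV) fst" "set_pmf p \<subseteq> X"
      by (rule example_marginal[OF P X])
    have le: "er P f \<le> er P g + r" if g: "g \<in> F" for g
    proof (rule er_le_add[OF P p(1) fX _ r(1)])
      show "g \<in> X \<rightarrow> {0..1}" using g F(1) by blast
      have "\<bar>f x - g x\<bar> \<le> r" if "x \<in> set_pmf p" for x
        using close[OF f g, of x] close[OF g f, of x] that p(2) by auto
      then have "(\<integral>\<^sup>+x. ennreal \<bar>f x - g x\<bar> \<partial>measure_pmf p) \<le> (\<integral>\<^sup>+x. ennreal r \<partial>measure_pmf p)"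
        by (intro nn_integral_mono_AE AE_pmfI ennreal_leI)
      then show "(\<integral>\<^sup>+x. ennreal \<bar>f x - g x\<bar> \<partial>measure_pmf p) \<le> ennreal r" by simp
    qed
    have "ereal (er P f - r) \<le> (INF f\<in>F. ereal (er P f))"
      using le by (intro INF_greatest) (simp add: algebra_simps)
    then have "ereal (er P f - r) + ereal \<epsilon> \<le> (INF f\<in>F. ereal (er P f)) + ereal \<epsilon>"
      by (rule add_right_mono)
    moreover have "ereal (er P f) < ereal (er P f - r) + ereal \<epsilon>" using r by simp
    ultimately show "ereal (er P f) < (INF f\<in>F. ereal (er P f)) + ereal \<epsilon>" by (rule less_le_trans[rotated])
  qed
qed

lemma shatters_pair:
  assumes "x \<in> X" "f \<in> F" "g \<in> F" "F \<subseteq> X \<rightarrow> {0..1}" "\<gamma> > 0" "f x - g x \<ge> 2 * \<gamma>"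
  shows "\<exists>r\<in>{0..1}. fatly_shatters X F \<gamma> [(x, r)]"
proof
  have "f x \<in> {0..1}" "g x \<in> {0..1}"
    using funcset_mem[OF subsetD[OF assms(4)] assms(1)] assms(2,3) by blast+
  then show r: "(f x + g x) / 2 \<in> {0..1}" by auto
  have gap: "(f x + g x) / 2 + \<gamma> \<le> f x" "g x \<le> (f x + g x) / 2 - \<gamma>" using assms(6) by (auto simp: field_simps)
  show "fatly_shatters X F \<gamma> [(x, (f x + g x) / 2)]"
    unfolding fatly_shatters_def
  proof (intro conjI allI impI)
    fix b :: "bool list" assume "length b = length [(x, (f x + g x) / 2)]"
    show "\<exists>f'\<in>F. \<forall>j<length [(x, (f x + g x) / 2)].
      (b ! j \<longrightarrow> f' (fst ([(x, (f x + g x) / 2)] ! j)) \<ge> snd ([(x, (f x + g x) / 2)] ! j) + \<gamma>) \<and>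
      (\<not> b ! j \<longrightarrow> f' (fst ([(x, (f x + g x) / 2)] ! j)) \<le> snd ([(x, (f x + g x) / 2)] ! j) - \<gamma>)"
      by (rule bexI[of _ "if b ! 0 then f else g"]) (use assms(2,3) gap in auto)
  qed (use assms r in auto)
qed

text \<open>Two members of F that are 2 \<gamma> apart at x would shatter this single point, with
  the midpoint of their values as threshold.\<close>

lemma fat_0_close:
  assumes "fat X F \<gamma> = 0 \<or> fatV X F \<gamma> = 0"
    and "x \<in> X" "f \<in> F" "g \<in> F" "F \<subseteq> X \<rightarrow> {0..1}" "\<gamma> > 0"
  shows "f x - g x < 2 * \<gamma>"
proof (rule ccontr)
  assume "\<not> ?thesis"
  then obtain r where r: "r \<in> {0..1}" "fatly_shatters X F \<gamma> [(x, r)]"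
    using shatters_pair[OF assms(2-6)] by auto
  have "enat (length [(x, r)]) \<le> fat X F \<gamma>"
    unfolding fat_def using r by (intro Sup_upper) blast
  moreover have "enat (length [x]) \<le> fatV X F \<gamma>"
    unfolding fatV_def using r by (intro Sup_upper CollectI exI[of _ "[x]"]) auto
  ultimately show False using assms(1) by (auto simp: zero_enat_def)
qed

text \<open>At a nonpositive scale a single f realises both bits at the threshold f x, and sequences
  may repeat points. So for \<kappa> \<ge> 1/2 the finiteness hypothesis can hold only if X or F is
  empty.\<close>

lemma fat_nonpos_scale:
  assumes "x \<in> X" "f \<in> F" "F \<subseteq> X \<rightarrow> {0..1}" "\<gamma> \<le> 0"
  shows "fat X F \<gamma> = \<infinity>" "fatV X F \<gamma> = \<infinity>"
proof -
  have r: "f x \<in> {0..1}" using funcset_mem[OF subsetD[OF assms(3,2)] assms(1)] .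
  have sh: "fatly_shatters X F \<gamma> (replicate n (x, f x))" for n
    unfolding fatly_shatters_def using assms r by (auto intro!: bexI[of _ f])
  have "enat n \<le> fat X F \<gamma>" for n
    unfolding fat_def using sh[of n] by (intro Sup_upper CollectI exI[of _ "replicate n (x, f x)"]) auto
  then show "fat X F \<gamma> = \<infinity>" by (metis enat_ord_code(4) enat.exhaust enat_ord_simps(1) not_less_eq_eq order_refl)
  have "enat n \<le> fatV X F \<gamma>" for n
    unfolding fatV_def using sh[of n] r
    by (intro Sup_upper CollectI exI[of _ "replicate n x"]) (auto intro!: bexI[of _ "f x"])
  then show "fatV X F \<gamma> = \<infinity>" by (metis enat_ord_code(4) enat.exhaust enat_ord_simps(1) not_less_eq_eq order_refl)
qed

section \<open>Choice of parameters\<close>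

lemma nat_ceiling_bounds:
  assumes "0 < (x::real)"
  shows "0 < nat \<lceil>x\<rceil>" "x \<le> real (nat \<lceil>x\<rceil>)" "real (nat \<lceil>x\<rceil>) \<le> x + 1"
  using assms by linarith+

text \<open>The factor 2 makes up for the natural logarithm, since 2 ln 2 \<ge> 1.\<close>

lemma power_half_le:
  assumes "1 \<le> (z::real)" "2 * ln z \<le> real k"
  shows "z \<le> 2 ^ k"
proof -
  have "ln z \<le> real k * ln 2"
  proof -
    have "ln z * 1 \<le> ln z * (2 * ln 2)"
      using assms(1) ln2_ge_two_thirds by (intro mult_left_mono) auto
    also have "\<dots> = (2 * ln z) * ln 2" by simp
    also have "\<dots> \<le> real k * ln 2" by (rule mult_right_mono[OF assms(2)]) simp
    finally show ?thesis by simp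
  qed
  then have "exp (ln z) \<le> exp (real k * ln 2)" by simp
  then show ?thesis using assms(1) by (simp add: exp_of_nat_mult)
qed

text \<open>r = (1 - \<kappa>) \<epsilon> and c = \<kappa> \<epsilon> / 8 leave a positive rest of
  \<epsilon>. With k about 2 ln (4/\<delta>) blocks and about (\<Lambda> + ln (8 k / \<delta>)) / (2
  c^2) validation examples, either kind of failure is bounded by \<delta>/4. Additive constants are
  absorbed by \<open>l / l0\<close> \<ge> 1, which is where \<delta> \<le> \<open>\<delta>0\<close>
  < 1 enters.\<close>

lemma list_learner_sample_size:
  fixes \<kappa> \<delta>0 :: real
  assumes \<kappa>: "0 < \<kappa>" "\<kappa> < 1/2" and \<delta>0: "0 < \<delta>0" "\<delta>0 < 1"
  shows "\<exists>K>0. \<forall>(X::'x set) F n N e cands \<Lambda> \<epsilon> \<delta>. countable X \<longrightarrow> F \<subseteq> X \<rightarrow> {0..1} \<longrightarrow> F \<noteq> {} \<longrightarrow>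
    list_learner X F n N e cands \<longrightarrow> e \<le> (1 - \<kappa>) * \<epsilon> / 2 \<longrightarrow> 0 < \<epsilon> \<longrightarrow> \<epsilon> \<le> 1 \<longrightarrow> 0 < \<delta> \<longrightarrow> \<delta> \<le> \<delta>0 \<longrightarrow>
    N \<le> exp \<Lambda> \<longrightarrow> 1 \<le> \<Lambda> \<longrightarrow>
    (\<exists>A m. learner X A \<and> agnostically_learns X F A \<epsilon> \<delta> m \<and> real m \<le> K * (real n + \<Lambda> / \<epsilon>\<^sup>2) * ln (1 / \<delta>))"
proof -
  define l0 where "l0 = ln (1 / \<delta>0)"
  have l0: "l0 > 0" using \<delta>0 by (simp add: l0_def)
  \<comment> \<open>These collect the constants found below: k \<le> a l, and ln (8 k / \<delta>) +
    \<Lambda> \<le> b \<Lambda> l.\<close>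
  define a where "a = 2 * (1 + ln 4 / l0) + 1 / l0"
  define b where "b = 3 / l0 + a + 1 + 1 / l0"
  define K where "K = a + b * (32 / \<kappa>\<^sup>2) + 1 / l0"
  have a: "a > 0" using l0 by (simp add: a_def add_pos_pos)
  have b: "b > 0" using l0 a by (simp add: b_def add_pos_pos)
  have K: "K > 0" using a b \<kappa> l0 by (simp add: K_def add_pos_pos)
  have main: "\<exists>A m. learner X A \<and> agnostically_learns X F A \<epsilon> \<delta> m \<and> real m \<le> K * (real n + \<Lambda> / \<epsilon>\<^sup>2) * ln (1 / \<delta>)"
    if X: "countable X" and F: "F \<subseteq> X \<rightarrow> {0..1}" "F \<noteq> {}" and L: "list_learner X F n N e cands"
      and e: "e \<le> (1 - \<kappa>) * \<epsilon> / 2" and \<epsilon>: "0 < \<epsilon>" "\<epsilon> \<le> 1" and \<delta>: "0 < \<delta>" "\<delta> \<le> \<delta>0"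
      and N: "N \<le> exp \<Lambda>" and \<Lambda>: "1 \<le> \<Lambda>"
    for X :: "'x set" and F n N e cands \<Lambda> \<epsilon> \<delta>
  proof -
    define l where "l = ln (1 / \<delta>)"
    define c where "c = \<kappa> * \<epsilon> / 8"
    have l: "l \<ge> l0" unfolding l_def l0_def using \<delta> \<delta>0 by (simp add: ln_div)
    then have lpos: "l > 0" and l1: "1 \<le> l / l0" using l0 by auto
    define k where "k = nat \<lceil>2 * ln (4 / \<delta>)\<rceil>"
    have d4: "4 / \<delta> \<ge> 4" using \<delta> \<delta>0 by (simp add: field_simps)
    have ln4: "ln (4 / \<delta>) = ln 4 + l" using \<delta> by (simp add: l_def ln_div)
    have "ln (4 / \<delta>) > 0" using d4 by (intro ln_gt_zero) simp
    then have k: "0 < k" "2 * ln (4 / \<delta>) \<le> real k" "real k \<le> 2 * ln (4 / \<delta>) + 1"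
      using nat_ceiling_bounds[of "2 * ln (4 / \<delta>)"] by (auto simp: k_def)
    have "4 / \<delta> \<le> 2 ^ k" by (rule power_half_le) (use d4 k in auto)
    then have half: "(1/2) ^ k \<le> \<delta> / 4" using \<delta> by (simp add: power_divide field_simps)
    have ll: "ln 4 * 1 \<le> ln 4 * (l / l0)" by (rule mult_left_mono[OF l1]) simp
    have "a * l = 2 * l + 2 * (ln 4 * (l / l0)) + l / l0" by (simp add: a_def algebra_simps)
    then have kl: "real k \<le> a * l" using k(3) l1 ll unfolding ln4 by simp
    define Y where "Y = (ln (8 * real k / \<delta>) + \<Lambda>) / (2 * c\<^sup>2)"
    define m2 where "m2 = nat \<lceil>Y\<rceil>"
    have c: "c > 0" using \<kappa> \<epsilon> by (simp add: c_def)
    have k8: "8 * real k / \<delta> \<ge> 1"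
    proof -
      have "\<delta> \<le> 1" using \<delta> \<delta>0 by simp
      moreover have "1 \<le> real k" using k(1) by simp
      ultimately have "\<delta> \<le> 8 * real k" by linarith
      then show ?thesis using \<delta> by simp
    qed
    then have lnk: "ln (8 * real k / \<delta>) \<ge> 0" by simp
    then have "Y > 0" unfolding Y_def using \<Lambda> c by (intro divide_pos_pos) auto
    then have m2: "0 < m2" "Y \<le> real m2" "real m2 \<le> Y + 1" using nat_ceiling_bounds by (auto simp: m2_def)
    have "2 * real m2 * c\<^sup>2 \<ge> ln (8 * real k / \<delta>) + \<Lambda>"
      using m2(2) c unfolding Y_def by (simp add: field_simps)
    then have "exp (- 2 * real m2 * c\<^sup>2) \<le> exp (- ln (8 * real k / \<delta>) - \<Lambda>)" by simp
    also have "\<dots> = \<delta> / (8 * real k) * exp (- \<Lambda>)"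
      using k8 k(1) \<delta> by (simp add: exp_diff exp_minus field_simps)
    finally have ex: "exp (- 2 * real m2 * c\<^sup>2) \<le> \<delta> / (8 * real k) * exp (- \<Lambda>)" .
    have "2 * (real k * N) * exp (- 2 * real m2 * c\<^sup>2) \<le> 2 * (real k * exp \<Lambda>) * exp (- 2 * real m2 * c\<^sup>2)"
      using N by (intro mult_right_mono mult_left_mono) auto
    also have "\<dots> \<le> 2 * (real k * exp \<Lambda>) * (\<delta> / (8 * real k) * exp (- \<Lambda>))"
      by (rule mult_left_mono[OF ex]) simp
    also have "\<dots> = \<delta> / 4" using k(1) by (simp add: exp_minus field_simps)
    finally have "(1/2) ^ k + 2 * (real k * N) * exp (- 2 * real m2 * c\<^sup>2) < \<delta>" using half \<delta> by linarith
    moreover have "e \<le> ((1 - \<kappa>) * \<epsilon>) / 2" "(1 - \<kappa>) * \<epsilon> > 0" "(1 - \<kappa>) * \<epsilon> + 2 * c < \<epsilon>"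
      using e \<kappa> \<epsilon> by (auto simp: c_def algebra_simps)
    ultimately obtain A where A: "learner X A" "agnostically_learns X F A \<epsilon> \<delta> (k * n + m2)"
      using list_learner_imp_agnostic[OF X F L, of "(1 - \<kappa>) * \<epsilon>" c \<epsilon> m2 k \<delta>] c m2(1) by blast
    have Ll: "\<Lambda> * l > 0" using \<Lambda> lpos by simp
    have "ln (8 * real k / \<delta>) = ln 8 + ln (real k) + l" using k(1) \<delta> by (simp add: l_def ln_div ln_mult)
    also have "\<dots> \<le> 3 + real k + l"
    proof -
      have "ln (8::real) = 3 * ln 2" using ln_realpow[of 2 3] by simp
      then have "ln (8::real) \<le> 3" using ln_2_less_1 by simp
      moreover have "ln (real k) \<le> real k" using k(1) ln_le_minus_one[of "real k"] by simp
      ultimately show ?thesis by simp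
    qed
    also have "\<dots> \<le> 3 * (l / l0) + a * l + l" using kl l1 by simp
    also have "\<dots> = (3 / l0 + a + 1) * l" by (simp add: algebra_simps)
    also have "\<dots> = (3 / l0 + a + 1) * l * 1" by simp
    also have "\<dots> \<le> (3 / l0 + a + 1) * l * \<Lambda>"
      by (rule mult_left_mono[OF \<Lambda>]) (use lpos a l0 in simp)
    finally have "ln (8 * real k / \<delta>) + \<Lambda> \<le> (3 / l0 + a + 1) * l * \<Lambda> + \<Lambda> * (l / l0)"
      using mult_left_mono[OF l1, of \<Lambda>] \<Lambda> by simp
    also have "\<dots> = b * (\<Lambda> * l)" by (simp add: b_def algebra_simps)
    finally have "Y \<le> b * (\<Lambda> * l) / (2 * c\<^sup>2)" unfolding Y_def by (intro divide_right_mono) auto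
    also have "\<dots> = b * (32 / \<kappa>\<^sup>2) * (\<Lambda> / \<epsilon>\<^sup>2) * l"
      using \<kappa> \<epsilon> by (simp add: c_def power_mult_distrib power_divide field_simps)
    finally have Y: "Y \<le> b * (32 / \<kappa>\<^sup>2) * (\<Lambda> / \<epsilon>\<^sup>2) * l" .
    have "\<epsilon>\<^sup>2 \<le> 1" using \<epsilon> by (simp add: power_le_one)
    then have Le: "1 \<le> \<Lambda> / \<epsilon>\<^sup>2" using \<Lambda> \<epsilon> by (simp add: pos_le_divide_eq)
    have "1 * 1 \<le> (\<Lambda> / \<epsilon>\<^sup>2) * (l / l0)" by (rule mult_mono[OF Le l1]) (use Le in auto)
    then have one: "1 \<le> 1 / l0 * (\<Lambda> / \<epsilon>\<^sup>2) * l" by (simp add: field_simps)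
    have "real (k * n + m2) \<le> a * l * real n + (b * (32 / \<kappa>\<^sup>2) * (\<Lambda> / \<epsilon>\<^sup>2) * l + 1 / l0 * (\<Lambda> / \<epsilon>\<^sup>2) * l)"
      using mult_right_mono[OF kl, of "real n"] m2(3) Y one by simp
    also have "\<dots> = (a * real n + (b * (32 / \<kappa>\<^sup>2) + 1 / l0) * (\<Lambda> / \<epsilon>\<^sup>2)) * l" by (simp add: algebra_simps)
    also have "\<dots> \<le> (K * real n + K * (\<Lambda> / \<epsilon>\<^sup>2)) * l"
    proof (intro mult_right_mono add_mono)
      show "a \<le> K" "b * (32 / \<kappa>\<^sup>2) + 1 / l0 \<le> K" using a b l0 by (auto simp: K_def)
    qed (use lpos Le in auto)
    finally have "real (k * n + m2) \<le> K * (real n + \<Lambda> / \<epsilon>\<^sup>2) * ln (1 / \<delta>)" by (simp add: l_def algebra_simps)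
    then show ?thesis using A by blast
  qed
  show ?thesis
    by (intro exI[of _ K] conjI K allI impI) (rule main)
qed

text \<open>The size T of the coarse sample enters its own requirement, since a larger sample has a
  larger cover. Through the logarithm of the cover size it contributes only a squared logarithm, so
  a large T satisfies the requirement.\<close>

lemma exists_coarse_scale:
  fixes b c e :: real
  shows "\<exists>T\<ge>1. b * (c + (2 * (e + ln (T + 1)) + 1)\<^sup>2) \<le> T"
proof -
  have "((\<lambda>T. b * (c + (2 * (e + ln (T + 1)) + 1)\<^sup>2) / T) \<longlongrightarrow> 0) at_top"
    by real_asymp
  then have "eventually (\<lambda>T. b * (c + (2 * (e + ln (T + 1)) + 1)\<^sup>2) / T < 1) at_top"
    by (rule order_tendstoD) simp
  then have "eventually (\<lambda>T. T \<ge> 1 \<and> b * (c + (2 * (e + ln (T + 1)) + 1)\<^sup>2) / T < 1) at_top"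
    using eventually_ge_at_top[of 1] by eventually_elim simp
  then obtain T where T: "T \<ge> 1" "b * (c + (2 * (e + ln (T + 1)) + 1)\<^sup>2) / T < 1"
    using eventually_happens'[OF trivial_limit_at_top_linorder] by blast
  then show ?thesis by (intro exI[of _ T]) (simp add: divide_less_eq)
qed

text \<open>The target error (1 - \<kappa>) \<epsilon> / 2 exceeds the scale \<gamma> by \<kappa>
  \<epsilon> / 2; half of that is spent here. The 3 in \<open>G + 3\<close> is 1 for rounding and 2
  from the leave-one-out term 2 d B / n. At most 9/2 steps \<tau> beyond \<gamma> fit into \<kappa>
  \<epsilon> / 4 because \<tau> = \<kappa> \<epsilon> / 20.\<close>

lemma scale_parameters:
  fixes \<kappa> \<epsilon> :: real
  assumes \<kappa>: "0 < \<kappa>" "\<kappa> < 1/2" and \<epsilon>: "0 < \<epsilon>"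
  defines "\<tau> \<equiv> \<kappa> * \<epsilon> / 20" and "\<gamma> \<equiv> (1/2 - \<kappa>) * \<epsilon>"
  defines "G \<equiv> \<lceil>\<gamma> / \<tau> + 1/2\<rceil>"
  shows "\<tau> > 0" "\<gamma> > 0" "G \<ge> 1" "\<gamma> \<le> \<tau> * (real_of_int G - 1/2)" "\<tau> * (real_of_int G + 3) \<le> \<gamma> + \<kappa> * \<epsilon> / 4"
    "real_of_int G \<le> 10 / \<kappa>"
proof -
  show \<tau>: "\<tau> > 0" and \<gamma>: "\<gamma> > 0" using \<kappa> \<epsilon> by (auto simp: \<tau>_def \<gamma>_def)
  have q: "\<gamma> / \<tau> > 0" using \<tau> \<gamma> by simp
  have G: "\<gamma> / \<tau> + 1/2 \<le> real_of_int G" "real_of_int G \<le> \<gamma> / \<tau> + 3/2"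
    unfolding G_def by linarith+
  show "G \<ge> 1" using q G(1) by linarith
  have "\<gamma> / \<tau> \<le> real_of_int G - 1/2" using G(1) by linarith
  then show "\<gamma> \<le> \<tau> * (real_of_int G - 1/2)" using \<tau> by (simp add: pos_divide_le_eq mult.commute)
  have "\<tau> * (real_of_int G + 3) \<le> \<tau> * (\<gamma> / \<tau> + 9/2)" using G(2) \<tau> by (intro mult_left_mono) auto
  also have "\<dots> = \<gamma> + \<tau> * (9/2)" using \<tau> by (simp add: distrib_left)
  also have "\<dots> \<le> \<gamma> + \<kappa> * \<epsilon> / 4" using \<kappa> \<epsilon> by (simp add: \<tau>_def)
  finally show "\<tau> * (real_of_int G + 3) \<le> \<gamma> + \<kappa> * \<epsilon> / 4" .
  have "\<gamma> / \<tau> = 10 / \<kappa> - 20" using \<kappa> \<epsilon> by (simp add: \<gamma>_def \<tau>_def field_simps)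
  then show "real_of_int G \<le> 10 / \<kappa>" using G(2) by linarith
qed

lemma grid_size:
  fixes \<kappa> \<epsilon> :: real
  assumes \<kappa>: "0 < \<kappa>" "\<kappa> < 1/2" and \<epsilon>: "0 < \<epsilon>" "\<epsilon> \<le> 1/2"
  defines "\<tau> \<equiv> \<kappa> * \<epsilon> / 20"
  defines "B \<equiv> \<lceil>1 / \<tau>\<rceil>"
  shows "B \<ge> 1" "1 < \<tau> * real_of_int (B + 1)" "real_of_int B + 1 \<le> 22 / (\<kappa> * \<epsilon>)"
proof -
  have \<tau>: "\<tau> > 0" using \<kappa> \<epsilon> by (simp add: \<tau>_def)
  have "1 / \<tau> > 0" using \<tau> by simp
  then show "B \<ge> 1" unfolding B_def by linarith
  have "1 / \<tau> < real_of_int B + 1" unfolding B_def by linarith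
  then show "1 < \<tau> * real_of_int (B + 1)" using \<tau> by (simp add: pos_divide_less_eq mult.commute)
  define v where "v = 1 / (\<kappa> * \<epsilon>)"
  have "\<kappa> * \<epsilon> \<le> 1 * 1" using \<kappa> \<epsilon> by (intro mult_mono) auto
  then have "1 \<le> v" using \<kappa> \<epsilon> by (simp add: v_def)
  moreover have "real_of_int B + 1 \<le> 1 / \<tau> + 2" unfolding B_def by linarith
  moreover have "1 / \<tau> = 20 * v" by (simp add: \<tau>_def v_def)
  ultimately have "real_of_int B + 1 \<le> 22 * v" by linarith
  then show "real_of_int B + 1 \<le> 22 / (\<kappa> * \<epsilon>)" by (simp add: v_def)
qed

text \<open>\<epsilon> \<le> 1/2 keeps ln (1/\<epsilon>) away from 0, so that constants can be
  absorbed into it; by the other two bounds one factor \<epsilon> absorbs logarithms in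
  turn.\<close>

lemma ln_inverse_bounds:
  fixes \<epsilon> :: real
  assumes "0 < \<epsilon>" "\<epsilon> \<le> 1/2"
  shows "1/2 \<le> ln (1 / \<epsilon>)" "\<epsilon> * ln (1 / \<epsilon>) \<le> 1" "\<epsilon> * (ln (1 / \<epsilon>))\<^sup>2 \<le> 4"
proof -
  have "ln 2 \<le> ln (1 / \<epsilon>)" using assms by (simp add: field_simps)
  then show L: "1/2 \<le> ln (1 / \<epsilon>)" using ln2_ge_two_thirds by linarith
  have "ln (1 / \<epsilon>) \<le> 1 / \<epsilon>" using ln_le_minus_one[of "1 / \<epsilon>"] assms by simp
  then show "\<epsilon> * ln (1 / \<epsilon>) \<le> 1" using assms by (simp add: pos_le_divide_eq mult.commute)
  have "ln (1 / \<epsilon>) = 2 * ln (sqrt (1 / \<epsilon>))" using assms by (simp add: ln_sqrt)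
  also have "\<dots> \<le> 2 * sqrt (1 / \<epsilon>)" using ln_le_minus_one[of "sqrt (1 / \<epsilon>)"] assms by simp
  finally have "(ln (1 / \<epsilon>))\<^sup>2 \<le> (2 * sqrt (1 / \<epsilon>))\<^sup>2" using L by (intro power_mono) auto
  also have "\<dots> = 4 / \<epsilon>" using assms by (simp add: power_mult_distrib)
  finally show "\<epsilon> * (ln (1 / \<epsilon>))\<^sup>2 \<le> 4" using assms by (simp add: pos_le_divide_eq mult.commute)
qed

lemma of_nat_le_exp: "real n \<le> exp (real n)"
  using exp_ge_add_one_self[of "real n"] by linarith

text \<open>b is the sample size up to a constant and the factor log (1/\<delta>): n unlabelled
  points for one block, and \<Lambda> / \<epsilon>^2 for validating a list whose length has
  logarithm at most \<Lambda>.\<close>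

definition candidate_lists :: "real \<Rightarrow> 'x set \<Rightarrow> ('x \<Rightarrow> real) set \<Rightarrow> real \<Rightarrow> real \<Rightarrow> bool" where
  "candidate_lists \<kappa> X F \<epsilon> b \<longleftrightarrow>
    (\<exists>n N e cands \<Lambda>. list_learner X F n N e cands \<and> e \<le> (1 - \<kappa>) * \<epsilon> / 2 \<and> N \<le> exp \<Lambda> \<and> 1 \<le> \<Lambda> \<and>
      real n + \<Lambda> / \<epsilon>\<^sup>2 \<le> b)"

text \<open>With n = d B the leave-one-out term 2 d B / n is 2. The list enumerates all labellings,
  so the logarithm of its length is about n ln B, that is (d/\<epsilon>) ln (1/\<epsilon>), and
  validation multiplies it by 1 / \<epsilon>^2.\<close>

lemma fatV_list_learner:
  fixes \<kappa> :: real
  assumes \<kappa>: "0 < \<kappa>" "\<kappa> < 1/2"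
  shows "\<exists>C>0. \<forall>(X::'x set) F d \<epsilon>. F \<subseteq> X \<rightarrow> {0..1} \<longrightarrow> 1 \<le> d \<longrightarrow> 0 < \<epsilon> \<longrightarrow> \<epsilon> \<le> 1/2 \<longrightarrow>
    fatV X F ((1/2 - \<kappa>) * \<epsilon>) \<le> enat d \<longrightarrow>
    candidate_lists \<kappa> X F \<epsilon> (C * (1 / \<epsilon>^3 * real d * ln (1 / \<epsilon>)))"
proof -
  define c where "c = 3 + 2 * ln (22 / \<kappa>)"
  have "ln (22 / \<kappa>) \<ge> 0" using \<kappa> by (simp add: field_simps)
  then have c: "c \<ge> 3" "ln (22 / \<kappa>) = (c - 3) / 2" by (auto simp: c_def)
  have main: "candidate_lists \<kappa> X F \<epsilon> (2 * (22 / \<kappa> * c) * (1 / \<epsilon>^3 * real d * ln (1 / \<epsilon>)))"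
    if F: "F \<subseteq> X \<rightarrow> {0..1}" and d: "1 \<le> d" and \<epsilon>: "0 < \<epsilon>" "\<epsilon> \<le> 1/2"
      and fat: "fatV X F ((1/2 - \<kappa>) * \<epsilon>) \<le> enat d" for X :: "'x set" and F d \<epsilon>
  proof -
    define \<tau> where "\<tau> = \<kappa> * \<epsilon> / 20"
    define \<gamma> where "\<gamma> = (1/2 - \<kappa>) * \<epsilon>"
    define G where "G = \<lceil>\<gamma> / \<tau> + 1/2\<rceil>"
    define B where "B = \<lceil>1 / \<tau>\<rceil>"
    define n where "n = d * nat B"
    define L where "L = ln (1 / \<epsilon>)"
    note par = scale_parameters[OF \<kappa> \<epsilon>(1), folded \<tau>_def \<gamma>_def, folded G_def]
    note grid = grid_size[OF \<kappa> \<epsilon>, folded \<tau>_def, folded B_def]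
    have L: "1/2 \<le> L" unfolding L_def by (rule ln_inverse_bounds[OF \<epsilon>])
    have n: "n > 0" "real n = real d * real_of_int B" using d grid(1) by (auto simp: n_def)
    have n1: "real n \<ge> 1" using n(1) by simp
    have B0: "B \<ge> 0" using grid(1) by simp
    have vc: "gap_dim_le X F (\<lambda>_. 0) \<tau> B G d {..<n}"
      by (rule gap_dim_le_fatV[OF F _ par(3,1,2,4) fat[folded \<gamma>_def]]) simp
    have ll: "list_learner X F n (real n * (real_of_int B + 1) ^ n) (\<tau> * (real_of_int G + 1 + 2 * real d * real_of_int B / real n))
        (refine_cands F (\<lambda>_. 0) \<tau> B G d {..<n})"
      by (rule refine_list_learner[OF n(1) par(3) B0 par(1) grid(2) vc F])
    have "2 * real d * real_of_int B / real n = 2" using n(2) d grid(1) by simp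
    then have "\<tau> * (real_of_int G + 1 + 2 * real d * real_of_int B / real n) = \<tau> * (real_of_int G + 3)" by simp
    also have "\<dots> \<le> (1 - \<kappa>) * \<epsilon> / 2" using par(5) mult_pos_pos[OF \<kappa>(1) \<epsilon>(1)] by (simp add: \<gamma>_def algebra_simps)
    finally have e: "\<tau> * (real_of_int G + 1 + 2 * real d * real_of_int B / real n) \<le> (1 - \<kappa>) * \<epsilon> / 2" .
    define \<Lambda> where "\<Lambda> = real n * (1 + ln (real_of_int B + 1))"
    have B1: "real_of_int B + 1 \<ge> 1" using grid(1) by simp
    then have lnB: "ln (real_of_int B + 1) \<ge> 0" by simp
    have "(real_of_int B + 1) ^ n = exp (real n * ln (real_of_int B + 1))"
      using B1 by (simp add: exp_of_nat_mult)
    then have N: "real n * (real_of_int B + 1) ^ n \<le> exp \<Lambda>"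
      using mult_right_mono[OF of_nat_le_exp[of n], of "exp (real n * ln (real_of_int B + 1))"]
      by (simp add: \<Lambda>_def distrib_left exp_add)
    have n\<Lambda>: "real n \<le> \<Lambda>" using mult_left_mono[of 1 "1 + ln (real_of_int B + 1)" "real n"] lnB by (simp add: \<Lambda>_def)
    have "ln (real_of_int B + 1) \<le> ln (22 / (\<kappa> * \<epsilon>))" using grid(3) B1 \<kappa> \<epsilon> by simp
    also have "\<dots> = (c - 3) / 2 + L" using \<kappa> \<epsilon> by (simp add: L_def ln_div ln_mult flip: c(2))
    finally have "1 + ln (real_of_int B + 1) \<le> (c - 1) / 2 + L" by (simp add: diff_divide_distrib)
    also have "(c - 1) / 2 + L \<le> c * L"
    proof -
      have "(c - 1) / 2 * 1 \<le> (c - 1) / 2 * (2 * L)" using L c(1) by (intro mult_left_mono) auto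
      also have "\<dots> = c * L - L" by (simp add: left_diff_distrib)
      finally show ?thesis by linarith
    qed
    finally have cL: "1 + ln (real_of_int B + 1) \<le> c * L" .
    have "real n \<le> real d * (22 / (\<kappa> * \<epsilon>))" unfolding n(2) using grid(3) by (intro mult_left_mono) auto
    then have "\<Lambda> \<le> real d * (22 / (\<kappa> * \<epsilon>)) * (c * L)"
      unfolding \<Lambda>_def using cL lnB \<kappa> \<epsilon> by (intro mult_mono) auto
    then have "\<Lambda> / \<epsilon>\<^sup>2 \<le> real d * (22 / (\<kappa> * \<epsilon>)) * (c * L) / \<epsilon>\<^sup>2" by (rule divide_right_mono) simp
    also have "\<dots> = 22 / \<kappa> * c * (1 / \<epsilon>^3 * real d * L)" by (simp add: power2_eq_square power3_eq_cube mult_ac)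
    finally have le: "\<Lambda> / \<epsilon>\<^sup>2 \<le> 22 / \<kappa> * c * (1 / \<epsilon>^3 * real d * L)" .
    have "\<epsilon>\<^sup>2 \<le> 1" using \<epsilon> by (simp add: power_le_one)
    then have "\<Lambda> * \<epsilon>\<^sup>2 \<le> \<Lambda> * 1" using n\<Lambda> n1 by (intro mult_left_mono) auto
    then have "\<Lambda> \<le> \<Lambda> / \<epsilon>\<^sup>2" using \<epsilon> by (simp add: pos_le_divide_eq)
    then have "real n + \<Lambda> / \<epsilon>\<^sup>2 \<le> 2 * (22 / \<kappa> * c) * (1 / \<epsilon>^3 * real d * L)" using n\<Lambda> le by linarith
    then show ?thesis
      using ll e N n\<Lambda> n1 unfolding L_def candidate_lists_def
      by (intro exI[of _ n] exI[of _ "real n * (real_of_int B + 1) ^ n"]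
        exI[of _ "\<tau> * (real_of_int G + 1 + 2 * real d * real_of_int B / real n)"]
        exI[of _ "refine_cands F (\<lambda>_. 0) \<tau> B G d {..<n}"] exI[of _ \<Lambda>] conjI) linarith+
  qed
  have "0 < 2 * (22 / \<kappa> * c)" using \<kappa> c(1) by simp
  then show ?thesis
    by (intro exI[of _ "2 * (22 / \<kappa> * c)"] conjI allI impI) (assumption, rule main)
qed

text \<open>Around a representative only 8 G + 2 levels matter, and G \<le> 10 / \<kappa>, so the
  refinement guesses a number of labels that is at most a constant times d, independently of
  \<epsilon>. The squared logarithm comes from the cover of size \<open>2 ^ (d * q\<^sup>2)\<close>
  alone. The coarse sample has about d T / \<epsilon>^2 points; since \<epsilon> q^2 is bounded,
  this makes its error k / n1 of order \<epsilon>.\<close>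

lemma fat_list_learner:
  fixes \<kappa> :: real
  assumes \<kappa>: "0 < \<kappa>" "\<kappa> < 1/2"
  shows "\<exists>C>0. \<forall>(X::'x set) F d \<epsilon>. F \<subseteq> X \<rightarrow> {0..1} \<longrightarrow> 1 \<le> d \<longrightarrow> 0 < \<epsilon> \<longrightarrow> \<epsilon> \<le> 1/2 \<longrightarrow>
    fat X F ((1/2 - \<kappa>) * \<epsilon>) \<le> enat d \<longrightarrow>
    candidate_lists \<kappa> X F \<epsilon> (C * (1 / \<epsilon>\<^sup>2 * real d * (ln (1 / \<epsilon>))\<^sup>2))"
proof -
  define E where "E = ln (132 / \<kappa>)"
  obtain T where T: "T \<ge> 1" "8 / \<kappa> * (291 + 2 * ln (8 / \<kappa>) + (2 * (E + ln (T + 1)) + 1)\<^sup>2) \<le> T"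
    using exists_coarse_scale by blast
  define w where "w = 2 * (E + ln (T + 1)) + 1"
  have E: "E \<ge> 0" unfolding E_def using \<kappa> by (simp add: field_simps)
  have w: "w \<ge> 0" unfolding w_def using E T(1) by simp
  have ln8: "ln (8 / \<kappa>) \<ge> 0" using \<kappa> by (simp add: field_simps)
  \<comment> \<open>The summands account for the cover, the guessed labels of the refinement and the
    unlabelled points. Here 81 / \<kappa> bounds 8 G + 1, 6723 is 81 times 83, and each factor 4
    comes from 1 \<le> 4 L^2.\<close>
  define C where "C = (2 * w + 6)\<^sup>2 + 4 * 6723 / \<kappa>\<^sup>2 + 4 * (T + 1 + 81 / \<kappa>)"
  have main: "candidate_lists \<kappa> X F \<epsilon> (C * (1 / \<epsilon>\<^sup>2 * real d * (ln (1 / \<epsilon>))\<^sup>2))"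
    if F: "F \<subseteq> X \<rightarrow> {0..1}" and d: "1 \<le> d" and \<epsilon>: "0 < \<epsilon>" "\<epsilon> \<le> 1/2"
      and fat: "fat X F ((1/2 - \<kappa>) * \<epsilon>) \<le> enat d" for X :: "'x set" and F d \<epsilon>
  proof -
    define \<tau> where "\<tau> = \<kappa> * \<epsilon> / 20"
    define \<gamma> where "\<gamma> = (1/2 - \<kappa>) * \<epsilon>"
    define G where "G = \<lceil>\<gamma> / \<tau> + 1/2\<rceil>"
    define B where "B = \<lceil>1 / \<tau>\<rceil>"
    define L where "L = ln (1 / \<epsilon>)"
    define t where "t = nat \<lceil>T / \<epsilon>\<^sup>2\<rceil>"
    define n1 where "n1 = d * t"
    define n2 where "n2 = d * nat (8 * G + 1)"
    \<comment> \<open>The quantity exp 1 card J (B + 1) / d of the covering bound, for the doubled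
      index set with card J = 2 d t.\<close>
    define Z where "Z = exp 1 * (2 * real t * (real_of_int B + 1))"
    define q where "q = nat \<lceil>2 * ln Z\<rceil>"
    define j where "j = nat \<lceil>2 * ln (8 / (\<kappa> * \<epsilon>))\<rceil>"
    \<comment> \<open>The first summand cancels the size of the cover, so \<open>Nc / 2 ^ k\<close>
      = 2^-j, and j makes this at most \<kappa> \<epsilon> / 8.\<close>
    define k where "k = d * q\<^sup>2 + j"
    define Nc :: real where "Nc = 2 ^ (d * q\<^sup>2)"
    note par = scale_parameters[OF \<kappa> \<epsilon>(1), folded \<tau>_def \<gamma>_def, folded G_def]
    note grid = grid_size[OF \<kappa> \<epsilon>, folded \<tau>_def, folded B_def]
    note L = ln_inverse_bounds[OF \<epsilon>, folded L_def]
    have B0: "B \<ge> 0" using grid(1) by simp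
    have \<epsilon>2: "0 < \<epsilon>\<^sup>2" "\<epsilon>\<^sup>2 \<le> 1" using \<epsilon> by (auto simp: power_le_one)
    have "T / \<epsilon>\<^sup>2 > 0" using T \<epsilon>2 by simp
    from nat_ceiling_bounds[OF this] have t: "0 < t" "T / \<epsilon>\<^sup>2 \<le> real t" "real t \<le> T / \<epsilon>\<^sup>2 + 1"
      by (auto simp: t_def)
    have "1 \<le> 1 / \<epsilon>\<^sup>2" using \<epsilon>2 by simp
    then have t': "real t \<le> (T + 1) / \<epsilon>\<^sup>2" using t(3) by (simp add: add_divide_distrib)
    have t1: "1 \<le> real t" using t(1) by simp
    have n1: "n1 > 0" "real n1 = real d * real t" using d t(1) by (auto simp: n1_def)
    have n2: "n2 > 0" "real n2 = real d * (8 * real_of_int G + 1)" using d par(3) by (auto simp: n2_def)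
    have card: "card ({..<n1} \<times> (UNIV :: bool set)) = 2 * n1" by (simp add: card_cartesian_product)
    have Z1: "Z \<ge> 1"
    proof -
      have "1 * (2 * 1 * 1) \<le> Z" unfolding Z_def using t1 grid(1) by (intro mult_mono) auto
      then show ?thesis by simp
    qed
    have q: "2 * ln Z \<le> real q" "real q \<le> 2 * ln Z + 1"
      using Z1 by (auto simp: q_def ceiling_le_iff intro: real_nat_ceiling_ge)
    have Zq: "Z \<le> 2 ^ q" by (rule power_half_le[OF Z1 q(1)])
    \<comment> \<open>132 is 3 times 2 times 22, from exp 1 \<le> 3 and B + 1 \<le> 22 / (\<kappa>
      \<epsilon>); the third power of 1/\<epsilon> becomes the 6 L in the bound on q.\<close>
    have "Z \<le> 3 * (2 * ((T + 1) / \<epsilon>\<^sup>2) * (22 / (\<kappa> * \<epsilon>)))"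
      unfolding Z_def using exp_le t' grid(1,3) T(1) \<epsilon>2 by (intro mult_mono) auto
    also have "\<dots> = (132 / \<kappa>) * (T + 1) * (1 / \<epsilon>) ^ 3"
      using \<kappa> \<epsilon> by (simp add: power2_eq_square power3_eq_cube)
    finally have "ln Z \<le> ln ((132 / \<kappa>) * (T + 1) * (1 / \<epsilon>) ^ 3)" using Z1 by simp
    also have "\<dots> = E + ln (T + 1) + 3 * L"
    proof -
      have "ln ((132 / \<kappa>) * (T + 1) * (1 / \<epsilon>) ^ 3) = ln ((132 / \<kappa>) * (T + 1)) + ln ((1 / \<epsilon>) ^ 3)"
        using \<kappa> \<epsilon> T(1) by (intro ln_mult_pos) auto
      also have "ln ((132 / \<kappa>) * (T + 1)) = E + ln (T + 1)"
        unfolding E_def using \<kappa> T(1) by (intro ln_mult_pos) auto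
      also have "ln ((1 / \<epsilon>) ^ 3) = 3 * L"
        unfolding L_def using \<epsilon> ln_realpow[of "1 / \<epsilon>" 3] by simp
      finally show ?thesis .
    qed
    finally have qw: "real q \<le> w + 6 * L" using q(2) unfolding w_def by simp
    have q2: "(real q)\<^sup>2 \<le> 2 * w\<^sup>2 + 72 * L\<^sup>2"
    proof -
      have "(real q)\<^sup>2 \<le> (w + 6 * L)\<^sup>2" using qw by (intro power_mono) auto
      also have "\<dots> \<le> 2 * w\<^sup>2 + 72 * L\<^sup>2"
        using zero_le_power2[of "w - 6 * L"] by (simp add: power2_eq_square algebra_simps)
      finally show ?thesis .
    qed
    \<comment> \<open>2 \<epsilon> \<le> 1 and \<epsilon> L^2 \<le> 4 turn the logarithmic growth of
      q into a constant: 288 is 72 times 4.\<close>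
    have \<epsilon>q: "\<epsilon> * (real q)\<^sup>2 \<le> w\<^sup>2 + 288"
    proof -
      have "\<epsilon> * (real q)\<^sup>2 \<le> \<epsilon> * (2 * w\<^sup>2 + 72 * L\<^sup>2)" using q2 \<epsilon> by (intro mult_left_mono) auto
      also have "\<dots> = (\<epsilon> * 2) * w\<^sup>2 + 72 * (\<epsilon> * L\<^sup>2)" by (simp add: algebra_simps)
      also have "(\<epsilon> * 2) * w\<^sup>2 \<le> 1 * w\<^sup>2" using \<epsilon> by (intro mult_right_mono) auto
      finally show ?thesis using L(3) by simp
    qed
    have ke: "8 / (\<kappa> * \<epsilon>) \<ge> 1"
    proof -
      have "\<kappa> * \<epsilon> \<le> 1 * 1" using \<kappa> \<epsilon> by (intro mult_mono) auto
      then show ?thesis using \<kappa> \<epsilon> by simp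
    qed
    have j: "2 * ln (8 / (\<kappa> * \<epsilon>)) \<le> real j" "real j \<le> 2 * ln (8 / (\<kappa> * \<epsilon>)) + 1"
      using ke by (auto simp: j_def ceiling_le_iff intro: real_nat_ceiling_ge)
    have j2: "8 / (\<kappa> * \<epsilon>) \<le> 2 ^ j" by (rule power_half_le[OF ke j(1)])
    have "ln (8 / (\<kappa> * \<epsilon>)) = ln (8 / \<kappa>) + L" using \<kappa> \<epsilon> by (simp add: L_def ln_div ln_mult)
    then have "\<epsilon> * real j \<le> \<epsilon> * (2 * ln (8 / \<kappa>) + 1) + 2 * (\<epsilon> * L)"
      using mult_left_mono[OF j(2), of \<epsilon>] \<epsilon> by (simp add: algebra_simps)
    also have "\<epsilon> * (2 * ln (8 / \<kappa>) + 1) \<le> 1 * (2 * ln (8 / \<kappa>) + 1)"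
      using \<epsilon> ln8 by (intro mult_right_mono) auto
    finally have \<epsilon>j: "\<epsilon> * real j \<le> 2 * ln (8 / \<kappa>) + 3" using L(2) by simp
    have "real k \<le> real d * ((real q)\<^sup>2 + real j)"
    proof -
      have "1 * real j \<le> real d * real j" using d by (intro mult_right_mono) auto
      then show ?thesis by (simp add: k_def distrib_left)
    qed
    then have "real k * \<epsilon> \<le> real d * ((real q)\<^sup>2 + real j) * \<epsilon>" using \<epsilon> by (intro mult_right_mono) auto
    also have "\<dots> = real d * (\<epsilon> * (real q)\<^sup>2 + \<epsilon> * real j)" by (simp add: algebra_simps)
    also have "\<dots> \<le> real d * (291 + 2 * ln (8 / \<kappa>) + w\<^sup>2)" using \<epsilon>q \<epsilon>j by (intro mult_left_mono) auto
    also have "\<dots> \<le> real d * (\<kappa> / 8 * T)"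
    proof (rule mult_left_mono)
      have "8 / \<kappa> * (291 + 2 * ln (8 / \<kappa>) + w\<^sup>2) \<le> T" using T(2) unfolding w_def .
      then show "291 + 2 * ln (8 / \<kappa>) + w\<^sup>2 \<le> \<kappa> / 8 * T" using \<kappa> by (simp add: field_simps)
    qed simp
    finally have "real k * \<epsilon> \<le> real d * (\<kappa> / 8 * T)" .
    also have "T \<le> real t * \<epsilon>\<^sup>2" using t(2) \<epsilon>2 by (simp add: pos_divide_le_eq)
    then have "real d * (\<kappa> / 8 * T) \<le> real d * (\<kappa> / 8 * (real t * \<epsilon>\<^sup>2))" using \<kappa> by (intro mult_left_mono) auto
    also have "\<dots> = (\<kappa> * \<epsilon> / 8 * real n1) * \<epsilon>" by (simp add: n1(2) power2_eq_square)
    finally have "real k \<le> \<kappa> * \<epsilon> / 8 * real n1" by (rule mult_right_le_imp_le) (rule \<epsilon>(1))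
    then have kn1: "real k / real n1 \<le> \<kappa> * \<epsilon> / 8" using n1(1) by (simp add: pos_divide_le_eq)
    have "Nc / 2 ^ k = 1 / 2 ^ j" by (simp add: Nc_def k_def power_add)
    also have "\<dots> \<le> \<kappa> * \<epsilon> / 8" using j2 \<kappa> \<epsilon> by (simp add: field_simps)
    finally have Nck: "Nc / 2 ^ k \<le> \<kappa> * \<epsilon> / 8" .
    have cover: "\<exists>C. finite C \<and> real (card C) \<le> Nc \<and>
        (\<forall>g\<in>quantise (\<lambda>_. 0) \<tau> B ` F. \<exists>c\<in>C. \<forall>j\<in>{..<n1} \<times> UNIV. \<bar>g (D j) - c j\<bar> \<le> G)"
      if D: "D ` ({..<n1} \<times> UNIV) \<subseteq> X" for D :: "nat \<times> bool \<Rightarrow> 'x"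
    proof -
      have J: "finite ({..<n1} \<times> (UNIV :: bool set))" by simp
      have "real d * (1 * 1) \<le> real d * (2 * real t * (real_of_int B + 1))"
        using t1 grid(1) by (intro mult_left_mono mult_mono) auto
      then have 1: "real d \<le> real (card ({..<n1} \<times> (UNIV :: bool set))) * (real_of_int B + 1)"
        unfolding card by (simp add: n1(2) mult_ac)
      have "exp 1 * (real (card ({..<n1} \<times> (UNIV :: bool set))) * (real_of_int B + 1)) / real d = Z"
        using d unfolding card Z_def by (simp add: n1(2) mult_ac)
      then have 2: "exp 1 * (real (card ({..<n1} \<times> (UNIV :: bool set))) * (real_of_int B + 1)) / real d \<le> 2 ^ q"
        using Zq by simp
      show ?thesis
        unfolding Nc_def
        by (rule fat_cover[OF F J B0 par(3,1,2,4) fat[folded \<gamma>_def] d _ _ D]) (use 1 2 in simp_all)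
    qed
    have vc: "gap_dim_le X F lo \<tau> B' G d {n1..<n1 + n2}" for lo B'
      by (rule gap_dim_le_fat[OF F _ par(3,1,2,4) fat[folded \<gamma>_def]]) simp
    have Nc0: "Nc \<ge> 0" by (simp add: Nc_def)
    define e where "e = \<tau> * (real_of_int G + 1 + 2 * real d * (8 * real_of_int G + 1) / real n2) + (real k / real n1 + Nc / 2 ^ k)"
    obtain cands where ll: "list_learner X F (n1 + n2) (Nc * (real n2 * (8 * real_of_int G + 2) ^ n2)) e cands"
      using coarse_refine_list_learner[OF F par(3,1) B0 grid(2) n1(1) n2(1) Nc0 vc cover, of k]
      unfolding e_def by (auto simp: of_int_add)
    have "2 * real d * (8 * real_of_int G + 1) / real n2 = 2" using n2(2) d par(3) by simp
    then have "e = \<tau> * (real_of_int G + 3) + (real k / real n1 + Nc / 2 ^ k)" by (simp add: e_def)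
    \<comment> \<open>The refinement takes \<kappa> \<epsilon> / 4 beyond \<gamma>; the two terms of
      the coarse error share the other \<kappa> \<epsilon> / 4.\<close>
    also have "\<dots> \<le> \<gamma> + \<kappa> * \<epsilon> / 4 + (\<kappa> * \<epsilon> / 8 + \<kappa> * \<epsilon> / 8)"
      by (intro add_mono par(5) kn1 Nck)
    also have "\<dots> = (1 - \<kappa>) * \<epsilon> / 2" by (simp add: \<gamma>_def field_simps)
    finally have e: "e \<le> (1 - \<kappa>) * \<epsilon> / 2" .
    define \<Lambda> where "\<Lambda> = real d * (real q)\<^sup>2 + real n2 * (8 * real_of_int G + 3)"
    have G1: "real_of_int G \<ge> 1" using par(3) by simp
    have n21: "real n2 \<ge> 1" using n2(1) by simp
    have N: "Nc * (real n2 * (8 * real_of_int G + 2) ^ n2) \<le> exp \<Lambda>"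
    proof -
      have "Nc \<le> exp 1 ^ (d * q\<^sup>2)" unfolding Nc_def using exp_ge_add_one_self[of "1::real"] by (intro power_mono) auto
      also have "\<dots> = exp (real d * (real q)\<^sup>2)" by (simp add: exp_of_nat_mult[symmetric])
      finally have 1: "Nc \<le> exp (real d * (real q)\<^sup>2)" .
      have "(8 * real_of_int G + 2) ^ n2 \<le> exp (8 * real_of_int G + 2) ^ n2"
        using exp_ge_add_one_self[of "8 * real_of_int G + 2"] G1 by (intro power_mono) auto
      also have "\<dots> = exp (real n2 * (8 * real_of_int G + 2))" by (simp add: exp_of_nat_mult)
      finally have 2: "(8 * real_of_int G + 2) ^ n2 \<le> exp (real n2 * (8 * real_of_int G + 2))" .
      have "Nc * (real n2 * (8 * real_of_int G + 2) ^ n2) \<le> exp (real d * (real q)\<^sup>2) * (exp (real n2) * exp (real n2 * (8 * real_of_int G + 2)))"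
        using 1 2 of_nat_le_exp[of n2] G1 by (intro mult_mono) auto
      also have "\<dots> = exp \<Lambda>" by (simp add: \<Lambda>_def algebra_simps flip: exp_add)
      finally show ?thesis .
    qed
    have "1 * 1 \<le> real n2 * (8 * real_of_int G + 3)" using n21 G1 by (intro mult_mono) auto
    then have \<Lambda>1: "1 \<le> \<Lambda>" unfolding \<Lambda>_def by (intro add_increasing) auto
    have L4: "1 \<le> 4 * L\<^sup>2" using power_mono[of "1/2" L 2] L(1) by (simp add: power2_eq_square)
    have ik: "1 \<le> 1 / \<kappa>" using \<kappa> by simp
    have g1: "8 * real_of_int G + 1 \<le> 81 / \<kappa>" "8 * real_of_int G + 3 \<le> 83 / \<kappa>"
      using par(6) ik by (auto simp: field_simps)
    have "w * 1 \<le> w * (2 * L)" using L(1) w by (intro mult_left_mono) auto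
    then have "real q \<le> (2 * w + 6) * L" using qw by (simp add: algebra_simps)
    then have "(real q)\<^sup>2 \<le> ((2 * w + 6) * L)\<^sup>2" by (intro power_mono) auto
    then have q3: "(real q)\<^sup>2 \<le> (2 * w + 6)\<^sup>2 * L\<^sup>2" by (simp add: power_mult_distrib)
    have "\<Lambda> = real d * ((real q)\<^sup>2 + (8 * real_of_int G + 1) * (8 * real_of_int G + 3))"
      by (simp add: \<Lambda>_def n2(2) algebra_simps)
    also have "\<dots> \<le> real d * ((2 * w + 6)\<^sup>2 * L\<^sup>2 + 6723 / \<kappa>\<^sup>2 * (4 * L\<^sup>2))"
    proof (intro mult_left_mono add_mono q3)
      have "(8 * real_of_int G + 1) * (8 * real_of_int G + 3) \<le> (81 / \<kappa>) * (83 / \<kappa>)"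
        using g1 G1 \<kappa> by (intro mult_mono) auto
      also have "\<dots> = 6723 / \<kappa>\<^sup>2 * 1" by (simp add: power2_eq_square)
      also have "\<dots> \<le> 6723 / \<kappa>\<^sup>2 * (4 * L\<^sup>2)" using L4 by (intro mult_left_mono) auto
      finally show "(8 * real_of_int G + 1) * (8 * real_of_int G + 3) \<le> 6723 / \<kappa>\<^sup>2 * (4 * L\<^sup>2)" .
    qed simp
    finally have "\<Lambda> / \<epsilon>\<^sup>2 \<le> real d * ((2 * w + 6)\<^sup>2 * L\<^sup>2 + 6723 / \<kappa>\<^sup>2 * (4 * L\<^sup>2)) / \<epsilon>\<^sup>2"
      by (rule divide_right_mono) simp
    also have "\<dots> = ((2 * w + 6)\<^sup>2 + 4 * 6723 / \<kappa>\<^sup>2) * (1 / \<epsilon>\<^sup>2 * real d * L\<^sup>2)"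
      by (simp add: add_divide_distrib algebra_simps)
    finally have le1: "\<Lambda> / \<epsilon>\<^sup>2 \<le> ((2 * w + 6)\<^sup>2 + 4 * 6723 / \<kappa>\<^sup>2) * (1 / \<epsilon>\<^sup>2 * real d * L\<^sup>2)" .
    have "real (n1 + n2) = real d * (real t + (8 * real_of_int G + 1))" by (simp add: n1(2) n2(2) algebra_simps)
    also have "\<dots> \<le> real d * ((T + 1) / \<epsilon>\<^sup>2 + (81 / \<kappa>) / \<epsilon>\<^sup>2)"
    proof (intro mult_left_mono add_mono t')
      have "81 / \<kappa> * 1 \<le> 81 / \<kappa> * (1 / \<epsilon>\<^sup>2)" using \<open>1 \<le> 1 / \<epsilon>\<^sup>2\<close> \<kappa> by (intro mult_left_mono) auto
      then show "8 * real_of_int G + 1 \<le> (81 / \<kappa>) / \<epsilon>\<^sup>2" using g1(1) by simp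
    qed simp
    also have "\<dots> = (T + 1 + 81 / \<kappa>) * (1 / \<epsilon>\<^sup>2 * real d) * 1" by (simp add: add_divide_distrib algebra_simps)
    also have "\<dots> \<le> (T + 1 + 81 / \<kappa>) * (1 / \<epsilon>\<^sup>2 * real d) * (4 * L\<^sup>2)"
      using L4 T(1) \<kappa> by (intro mult_left_mono mult_nonneg_nonneg) auto
    also have "\<dots> = 4 * (T + 1 + 81 / \<kappa>) * (1 / \<epsilon>\<^sup>2 * real d * L\<^sup>2)" by simp
    finally have "real (n1 + n2) + \<Lambda> / \<epsilon>\<^sup>2 \<le> C * (1 / \<epsilon>\<^sup>2 * real d * L\<^sup>2)"
      unfolding C_def distrib_right[of "(2 * w + 6)\<^sup>2 + 4 * 6723 / \<kappa>\<^sup>2"] using le1 by linarith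
    then show ?thesis
      using ll e N \<Lambda>1 unfolding L_def candidate_lists_def
      by (intro exI[of _ "n1 + n2"] exI[of _ "Nc * (real n2 * (8 * real_of_int G + 2) ^ n2)"]
        exI[of _ e] exI[of _ cands] exI[of _ \<Lambda>] conjI)
  qed
  have "C > 0" unfolding C_def using \<kappa> T(1) by (intro add_nonneg_pos add_nonneg_nonneg mult_pos_pos add_pos_pos) auto
  then show ?thesis
    by (intro exI[of _ C] conjI allI impI) (assumption, rule main)
qed


section \<open>Assembling the two bounds\<close>

lemma degenerate_learner:
  fixes \<kappa> :: real
  assumes F: "F \<subseteq> X \<rightarrow> {0..1}" and X: "countable X" and \<kappa>: "0 < \<kappa>" and \<epsilon>: "0 < \<epsilon>" and \<delta>: "0 < \<delta>"
    and dim: "D = fat X F ((1/2 - \<kappa>) * \<epsilon>) \<or> D = fatV X F ((1/2 - \<kappa>) * \<epsilon>)" "D < \<infinity>"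
    and deg: "1/2 \<le> \<kappa> \<or> 1/2 < \<epsilon> \<or> F = {} \<or> D = 0"
  shows "\<exists>A. learner X A \<and> agnostically_learns X F A \<epsilon> \<delta> 0"
proof (cases "X = {} \<or> F = {} \<or> 1/2 < \<epsilon>")
  case True
  then show ?thesis
    using constant_learner_degenerate[OF _ \<delta>] constant_learner_half[OF _ \<delta>] by blast
next
  case False
  then obtain x f where xf: "x \<in> X" "f \<in> F" by blast
  let ?\<gamma> = "(1/2 - \<kappa>) * \<epsilon>"
  have "\<kappa> < 1/2"
  proof (rule ccontr)
    assume "\<not> \<kappa> < 1/2"
    then have "?\<gamma> \<le> 0" using \<epsilon> by (intro mult_nonpos_nonneg) auto
    then show False using fat_nonpos_scale[OF xf F] dim by auto
  qed
  then have \<gamma>: "?\<gamma> > 0" using \<epsilon> by simp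
  have D0: "fat X F ?\<gamma> = 0 \<or> fatV X F ?\<gamma> = 0" using deg False \<open>\<kappa> < 1/2\<close> dim(1) by auto
  have F0: "F \<noteq> {}" using xf(2) by blast
  have lt: "2 * ?\<gamma> < \<epsilon>" using \<kappa> \<epsilon> by (simp add: algebra_simps)
  show ?thesis
    by (rule constant_learner_close[OF X F F0 \<delta> _ lt]) (use \<gamma> fat_0_close[OF D0 _ _ _ F \<gamma>] in simp_all)
qed

text \<open>Both bounds have the same shape, so the dimension D and the rate \<Phi> are abstracted.
  The constant is fixed before X and F, as the O-notation requires. In the degenerate cases a
  constant hypothesis is used, and there the nonnegativity of the bound suffices.\<close>

lemma sample_complexity:
  fixes \<kappa> \<delta>0 :: real and D :: "'x set \<Rightarrow> ('x \<Rightarrow> real) set \<Rightarrow> real \<Rightarrow> enat" and \<Phi> :: "real \<Rightarrow> nat \<Rightarrow> real"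
  assumes \<kappa>: "\<kappa> > 0" and \<delta>0: "0 < \<delta>0" "\<delta>0 < 1"
    and D: "D = fat \<or> D = fatV" and \<Phi>: "\<And>\<epsilon> d. 0 < \<epsilon> \<Longrightarrow> \<epsilon> < 1 \<Longrightarrow> 0 \<le> \<Phi> \<epsilon> d"
    and lists: "\<kappa> < 1/2 \<Longrightarrow> \<exists>C>0. \<forall>(X::'x set) F d \<epsilon>. F \<subseteq> X \<rightarrow> {0..1} \<longrightarrow> 1 \<le> d \<longrightarrow> 0 < \<epsilon> \<longrightarrow> \<epsilon> \<le> 1/2 \<longrightarrow>
      D X F ((1/2 - \<kappa>) * \<epsilon>) \<le> enat d \<longrightarrow>
      candidate_lists \<kappa> X F \<epsilon> (C * \<Phi> \<epsilon> d)"
  shows "\<exists>C::real. \<forall>(X::'x set) (F::('x \<Rightarrow> real) set).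
        countable X \<longrightarrow> F \<subseteq> X \<rightarrow> {0..1} \<longrightarrow>
        (\<forall>\<epsilon>'>0. D X F ((1/2 - \<kappa>) * \<epsilon>') < \<infinity>) \<longrightarrow>
        (\<forall>\<epsilon> \<delta>. 0 < \<epsilon> \<longrightarrow> \<epsilon> < 1 \<longrightarrow> 0 < \<delta> \<longrightarrow> \<delta> \<le> \<delta>0 \<longrightarrow>
          (\<exists>A m. learner X A \<and> agnostically_learns X F A \<epsilon> \<delta> m \<and>
             real m \<le> C * (\<Phi> \<epsilon> (the_enat (D X F ((1/2 - \<kappa>) * \<epsilon>))) * ln (1/\<delta>))))"
proof -
  obtain C :: real where C: "C \<ge> 0" and lists': "\<And>(X::'x set) F d \<epsilon>. \<kappa> < 1/2 \<Longrightarrow> F \<subseteq> X \<rightarrow> {0..1} \<Longrightarrow> 1 \<le> d \<Longrightarrow>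
      0 < \<epsilon> \<Longrightarrow> \<epsilon> \<le> 1/2 \<Longrightarrow> D X F ((1/2 - \<kappa>) * \<epsilon>) \<le> enat d \<Longrightarrow>
      candidate_lists \<kappa> X F \<epsilon> (C * \<Phi> \<epsilon> d)"
  proof (cases "\<kappa> < 1/2")
    case True
    from lists[OF this] obtain C where C0: "C > 0" and C: "\<forall>(X::'x set) F d \<epsilon>. F \<subseteq> X \<rightarrow> {0..1} \<longrightarrow> 1 \<le> d \<longrightarrow> 0 < \<epsilon> \<longrightarrow> \<epsilon> \<le> 1/2 \<longrightarrow>
      D X F ((1/2 - \<kappa>) * \<epsilon>) \<le> enat d \<longrightarrow>
      candidate_lists \<kappa> X F \<epsilon> (C * \<Phi> \<epsilon> d)" by (elim exE conjE)
    show thesis by (rule that[of C], use C0 in simp) (rule C[rule_format])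
  next
    case False
    \<comment> \<open>For \<kappa> \<ge> 1/2 the required property is vacuous and any nonnegative
      constant will do.\<close>
    then show thesis by (intro that[of 0]) simp_all
  qed
  obtain K :: real where K: "K \<ge> 0" and learn: "\<And>(X::'x set) F n N e cands \<Lambda> \<epsilon> \<delta>. \<kappa> < 1/2 \<Longrightarrow> countable X \<Longrightarrow> F \<subseteq> X \<rightarrow> {0..1} \<Longrightarrow> F \<noteq> {} \<Longrightarrow>
    list_learner X F n N e cands \<Longrightarrow> e \<le> (1 - \<kappa>) * \<epsilon> / 2 \<Longrightarrow> 0 < \<epsilon> \<Longrightarrow> \<epsilon> \<le> 1 \<Longrightarrow> 0 < \<delta> \<Longrightarrow> \<delta> \<le> \<delta>0 \<Longrightarrow>
    N \<le> exp \<Lambda> \<Longrightarrow> 1 \<le> \<Lambda> \<Longrightarrow>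
    \<exists>A m. learner X A \<and> agnostically_learns X F A \<epsilon> \<delta> m \<and> real m \<le> K * (real n + \<Lambda> / \<epsilon>\<^sup>2) * ln (1 / \<delta>)"
  proof (cases "\<kappa> < 1/2")
    case True
    from list_learner_sample_size[OF \<kappa> this \<delta>0, where ?'x = 'x] obtain K where K0: "K > 0" and K:
      "\<forall>(X::'x set) F n N e cands \<Lambda> \<epsilon> \<delta>. countable X \<longrightarrow> F \<subseteq> X \<rightarrow> {0..1} \<longrightarrow> F \<noteq> {} \<longrightarrow>
    list_learner X F n N e cands \<longrightarrow> e \<le> (1 - \<kappa>) * \<epsilon> / 2 \<longrightarrow> 0 < \<epsilon> \<longrightarrow> \<epsilon> \<le> 1 \<longrightarrow> 0 < \<delta> \<longrightarrow> \<delta> \<le> \<delta>0 \<longrightarrow>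
    N \<le> exp \<Lambda> \<longrightarrow> 1 \<le> \<Lambda> \<longrightarrow>
    (\<exists>A m. learner X A \<and> agnostically_learns X F A \<epsilon> \<delta> m \<and> real m \<le> K * (real n + \<Lambda> / \<epsilon>\<^sup>2) * ln (1 / \<delta>))"
      by (elim exE conjE)
    show thesis by (rule that[of K], use K0 in simp) (rule K[rule_format])
  next
    case False
    then show thesis by (intro that[of 0]) simp_all
  qed
  show ?thesis
  proof (intro exI[of _ "K * C"] allI impI)
    fix X :: "'x set" and F and \<epsilon> \<delta> :: real
    assume X: "countable X" and F: "F \<subseteq> X \<rightarrow> {0..1}" and fin: "\<forall>\<epsilon>'>0. D X F ((1/2 - \<kappa>) * \<epsilon>') < \<infinity>"
      and \<epsilon>: "0 < \<epsilon>" "\<epsilon> < 1" and \<delta>: "0 < \<delta>" "\<delta> \<le> \<delta>0"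
    define d where "d = the_enat (D X F ((1/2 - \<kappa>) * \<epsilon>))"
    have Dfin: "D X F ((1/2 - \<kappa>) * \<epsilon>) < \<infinity>" using fin \<epsilon>(1) by blast
    then have d: "D X F ((1/2 - \<kappa>) * \<epsilon>) = enat d" unfolding d_def by (cases "D X F ((1/2 - \<kappa>) * \<epsilon>)") auto
    have l: "ln (1 / \<delta>) \<ge> 0" using \<delta> \<delta>0 by simp
    have "\<exists>A m. learner X A \<and> agnostically_learns X F A \<epsilon> \<delta> m \<and> real m \<le> K * C * (\<Phi> \<epsilon> d * ln (1/\<delta>))"
    proof (cases "1/2 \<le> \<kappa> \<or> 1/2 < \<epsilon> \<or> F = {} \<or> d = 0")
      case True
      have "\<exists>A. learner X A \<and> agnostically_learns X F A \<epsilon> \<delta> 0"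
        by (rule degenerate_learner[OF F X \<kappa> \<epsilon>(1) \<delta>(1), of "enat d"])
           (use D True d in \<open>auto simp: zero_enat_def\<close>)
      then obtain A where A: "learner X A" "agnostically_learns X F A \<epsilon> \<delta> 0" by blast
      have "real 0 \<le> K * C * (\<Phi> \<epsilon> d * ln (1/\<delta>))"
        using K C \<Phi>[OF \<epsilon>] l by simp
      then show ?thesis using A by blast
    next
      case False
      then have k: "\<kappa> < 1/2" "\<epsilon> \<le> 1/2" "F \<noteq> {}" "1 \<le> d" by auto
      have "D X F ((1/2 - \<kappa>) * \<epsilon>) \<le> enat d" by (simp add: d)
      from lists'[OF k(1) F k(4) \<epsilon>(1) k(2) this] obtain n N e cands \<Lambda> where
        L: "list_learner X F n N e cands" "e \<le> (1 - \<kappa>) * \<epsilon> / 2" "N \<le> exp \<Lambda>" "1 \<le> \<Lambda>"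
          "real n + \<Lambda> / \<epsilon>\<^sup>2 \<le> C * \<Phi> \<epsilon> d"
        unfolding candidate_lists_def by blast
      have "\<epsilon> \<le> 1" using \<epsilon> by simp
      from learn[OF k(1) X F k(3) L(1,2) \<epsilon>(1) this \<delta> L(3,4)] obtain A m where
        A: "learner X A" "agnostically_learns X F A \<epsilon> \<delta> m" "real m \<le> K * (real n + \<Lambda> / \<epsilon>\<^sup>2) * ln (1 / \<delta>)"
        by blast
      note A(3)
      also have "K * (real n + \<Lambda> / \<epsilon>\<^sup>2) * ln (1 / \<delta>) \<le> K * (C * \<Phi> \<epsilon> d) * ln (1 / \<delta>)"
        using L(5) K l by (intro mult_right_mono mult_left_mono) auto
      finally have "real m \<le> K * C * (\<Phi> \<epsilon> d * ln (1/\<delta>))" by (simp add: mult_ac)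
      then show ?thesis using A by blast
    qed
    then show "\<exists>A m. learner X A \<and> agnostically_learns X F A \<epsilon> \<delta> m \<and>
        real m \<le> K * C * (\<Phi> \<epsilon> (the_enat (D X F ((1/2 - \<kappa>) * \<epsilon>))) * ln (1/\<delta>))"
      unfolding d_def .
  qed
qed

theorem theorem21:
  fixes \<kappa> \<delta>0 :: real
  assumes "\<kappa> > 0" and "0 < \<delta>0" and "\<delta>0 < 1"
  shows
    "(\<exists>C::real. \<forall>(X::'x set) (F::('x \<Rightarrow> real) set).
        countable X \<longrightarrow> F \<subseteq> X \<rightarrow> {0..1} \<longrightarrow>
        (\<forall>\<epsilon>'>0. fat X F ((1/2 - \<kappa>) * \<epsilon>') < \<infinity>) \<longrightarrow>
        (\<forall>\<epsilon> \<delta>. 0 < \<epsilon> \<longrightarrow> \<epsilon> < 1 \<longrightarrow> 0 < \<delta> \<longrightarrow> \<delta> \<le> \<delta>0 \<longrightarrow>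
          (\<exists>A m. learner X A \<and> agnostically_learns X F A \<epsilon> \<delta> m \<and>
             real m \<le> C * (1 / \<epsilon>^2 * real (the_enat (fat X F ((1/2 - \<kappa>) * \<epsilon>)))
                            * (ln (1/\<epsilon>))^2 * ln (1/\<delta>))))) \<and>
     (\<exists>C::real. \<forall>(X::'x set) (F::('x \<Rightarrow> real) set).
        countable X \<longrightarrow> F \<subseteq> X \<rightarrow> {0..1} \<longrightarrow>
        (\<forall>\<epsilon>'>0. fatV X F ((1/2 - \<kappa>) * \<epsilon>') < \<infinity>) \<longrightarrow>
        (\<forall>\<epsilon> \<delta>. 0 < \<epsilon> \<longrightarrow> \<epsilon> < 1 \<longrightarrow> 0 < \<delta> \<longrightarrow> \<delta> \<le> \<delta>0 \<longrightarrow>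
          (\<exists>A m. learner X A \<and> agnostically_learns X F A \<epsilon> \<delta> m \<and>
             real m \<le> C * (1 / \<epsilon>^3 * real (the_enat (fatV X F ((1/2 - \<kappa>) * \<epsilon>)))
                            * ln (1/\<epsilon>) * ln (1/\<delta>)))))"
proof (rule conjI, goal_cases)
  case 1
  show ?case
    by (rule sample_complexity[OF assms, of fat "\<lambda>\<epsilon> d. 1 / \<epsilon>^2 * real d * (ln (1/\<epsilon>))^2"])
       (use fat_list_learner[OF assms(1)] in simp_all)
next
  case 2
  show ?case
    by (rule sample_complexity[OF assms, of fatV "\<lambda>\<epsilon> d. 1 / \<epsilon>^3 * real d * ln (1/\<epsilon>)"])
       (use fatV_list_learner[OF assms(1)] in simp_all)
qed

end
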